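(* Let $n\ge0$ be an integer. There exists $\delta>0$ such that for every uniformly discrete set $\Gamma\subset\mathbf{U}$ satisfying $B(z,\delta)\cap\Gamma\neq\varnothing$ for every $z\in\mathbf U$, the system $\{T_{x}D_{s}\Phi_{n}: x+is\in\Gamma\}$ is a wavelet frame for $H^{2}(\mathbf{U})$.
   Context: $\mathbf U=\{x+is:s>0\}$ is the upper half plane. $B(z,\delta)$ is the ball of center $z$ and radius $\delta$ for the hyperbolic distance $d(z_1,z_2)=\frac12\log\frac{1+\rho(z_1,z_2)}{1-\rho(z_1,z_2)}$, $\rho(z_1,z_2)=\left|\frac{z_1-z_2}{z_1-\overline{z_2}}\right|$. $\Gamma$ is uniformly discrete if $\inf\{d(z,w):z,w\in\Gamma,\ z\ne w\}>0$. $H^2(\mathbf U)$ is the Hardy space, identified via boundary values with the closed subspace of $L^2(\mathbb R)$ of functions whose Fourier transform $\mathcal Ff(\omega)=\int_{\mathbb R}f(x)e^{-ix\omega}\,dx$ is supported in $[0,\infty)$, with the $L^2(\mathbb R)$ inner product. $T_xg(t)=g(t-x)$, $D_sg(t)=s^{-1/2}g(s^{-1}t)$. $\Phi_n\in H^2(\mathbf U)$ is defined by $\mathcal F\Phi_n(t)=t^{1/2}l_n^0(2t)$ for $t>0$ (and $0$ for $t\le 0$), where $l_n^0(t)=\mathbf 1_{[0,\infty)}(t)e^{-t/2}L_n^0(t)$ and $L_n^0(t)=\sum_{k=0}^n(-1)^k\binom nk\frac{t^k}{k!}$. The system is a wavelet frame for $H^2(\mathbf U)$ if there are constants $A,B>0$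 with $A\|f\|^2\le\sum_{x+is\in\Gamma}|\langle f,T_xD_s\Phi_n\rangle|^2\le B\|f\|^2$ for all $f\in H^2(\mathbf U)$. *)

theory Defs
  imports "HOL-Analysis.Analysis"
begin

section \<open>The hyperbolic upper half plane\<close>

definition upper_half_plane :: "complex set" where
  "upper_half_plane = {z. Im z > 0}"

definition pseudohyp_dist :: "complex \<Rightarrow> complex \<Rightarrow> real" where
  "pseudohyp_dist z w = cmod ((z - w) / (z - cnj w))"

definition hyp_dist :: "complex \<Rightarrow> complex \<Rightarrow> real" where
  "hyp_dist z w = 1/2 * ln ((1 + pseudohyp_dist z w) / (1 - pseudohyp_dist z w))"

definition hyp_ball :: "complex \<Rightarrow> real \<Rightarrow> complex set" where
  "hyp_ball z r = {w \<in> upper_half_plane. hyp_dist z w < r}"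

(* The infimum is taken in ereal, so that it is infinity for sets with at most one point. *)
definition hyp_uniformly_discrete :: "complex set \<Rightarrow> bool" where
  "hyp_uniformly_discrete \<Gamma> \<longleftrightarrow>
     (INF (z, w) \<in> {(z, w). z \<in> \<Gamma> \<and> w \<in> \<Gamma> \<and> z \<noteq> w}. ereal (hyp_dist z w)) > 0"


section \<open>The Hardy space as a subspace of \<open>L\<^sup>2(\<real>)\<close>\<close>

(* Elements of L2 are Borel representatives; functions are not identified when equal a.e. *)
definition L2 :: "(real \<Rightarrow> complex) set" where
  "L2 = {f \<in> borel_measurable lborel. integrable lborel (\<lambda>x. (cmod (f x))\<^sup>2)}"

definition L2_norm :: "(real \<Rightarrow> complex) \<Rightarrow> real" where
  "L2_norm f = sqrt (LINT x|lborel. (cmod (f x))\<^sup>2)"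

definition L2_inner :: "(real \<Rightarrow> complex) \<Rightarrow> (real \<Rightarrow> complex) \<Rightarrow> complex" where
  "L2_inner f g = (LINT x|lborel. f x * cnj (g x))"

definition fourier_integral :: "(real \<Rightarrow> complex) \<Rightarrow> real \<Rightarrow> complex" where
  "fourier_integral f \<omega> =
     (LINT x|lborel. f x * exp (- \<i> * complex_of_real x * complex_of_real \<omega>))"

(* The Fourier transform on L2 (Plancherel): g is the limit in L2 of the Fourier integrals of
   the truncations of f to [-R, R]. It determines g up to null sets. The distance is measured
   by a nonnegative integral, which is infinite when the difference is not square integrable. *)
definition has_L2_fourier :: "(real \<Rightarrow> complex) \<Rightarrow> (real \<Rightarrow> complex) \<Rightarrow> bool" where
  "has_L2_fourier f g \<longleftrightarrow> f \<in> L2 \<and> g \<in> L2 \<and>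
     ((\<lambda>R::real. \<integral>\<^sup>+ \<omega>. ennreal
         ((cmod (fourier_integral (\<lambda>x. if x \<in> {-R..R} then f x else 0) \<omega> - g \<omega>))\<^sup>2) \<partial>lborel)
       \<longlongrightarrow> 0) at_top"

definition Hardy2 :: "(real \<Rightarrow> complex) set" where
  "Hardy2 = {f \<in> L2. \<exists>g. has_L2_fourier f g \<and> (AE \<omega> in lborel. \<omega> < 0 \<longrightarrow> g \<omega> = 0)}"


section \<open>The wavelets and their frames\<close>

definition laguerre :: "nat \<Rightarrow> real \<Rightarrow> real" where
  "laguerre n t = (\<Sum>k\<le>n. (-1) ^ k * real (n choose k) * (t ^ k / fact k))"

definition laguerre_fun :: "nat \<Rightarrow> real \<Rightarrow> real" where
  "laguerre_fun n t = indicator {0..} t * exp (- t / 2) * laguerre n t"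

definition Phi_hat :: "nat \<Rightarrow> real \<Rightarrow> complex" where
  "Phi_hat n t = (if t > 0 then complex_of_real (t powr (1/2) * laguerre_fun n (2 * t)) else 0)"

(* The defining property determines the function up to null sets, so inner products with it
   and with its translates and dilates do not depend on the choice. *)
definition Phi :: "nat \<Rightarrow> real \<Rightarrow> complex" where
  "Phi n = (SOME f. f \<in> Hardy2 \<and> has_L2_fourier f (Phi_hat n))"

definition translation :: "real \<Rightarrow> (real \<Rightarrow> complex) \<Rightarrow> real \<Rightarrow> complex" where
  "translation x g t = g (t - x)"

definition dilation :: "real \<Rightarrow> (real \<Rightarrow> complex) \<Rightarrow> real \<Rightarrow> complex" where
  "dilation s g t = complex_of_real (s powr (-1/2)) * g (t / s)"

definition wavelet_frame :: "(real \<Rightarrow> complex) \<Rightarrow> complex set \<Rightarrow> bool" where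
  "wavelet_frame \<psi> \<Gamma> \<longleftrightarrow>
     (\<exists>A B::real. A > 0 \<and> B > 0 \<and>
       (\<forall>f \<in> Hardy2.
          let c = (\<lambda>z. (cmod (L2_inner f (translation (Re z) (dilation (Im z) \<psi>))))\<^sup>2)
          in c summable_on \<Gamma> \<and>
             A * (L2_norm f)\<^sup>2 \<le> (\<Sum>\<^sub>\<infinity>z\<in>\<Gamma>. c z) \<and>
             (\<Sum>\<^sub>\<infinity>z\<in>\<Gamma>. c z) \<le> B * (L2_norm f)\<^sup>2))"

end

theory Submission
  imports Defs "HOL-Probability.Probability" "HOL-Computational_Algebra.Polynomial"
begin

text \<open>Write \<open>g\<close> for the Fourier transform of \<open>f\<close> and \<open>m u = exp (- u) * laguerre n (2 * u)\<close>.
By Plancherel's formula the coefficient of \<open>f\<close> at \<open>x + \<i>s\<close> is \<open>s / (2 * pi)\<close> times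
\<open>G x s = \<integral>\<^sub>0\<^sup>\<infinity> g w * sqrt w * m (s * w) * exp (\<i> * x * w) dw\<close> (\<open>wavelet_coefficient\<close>). Plancherel in
\<open>x\<close> followed by the substitution \<open>u = s * w\<close> shows that the integral of \<open>\<bar>G\<bar>\<^sup>2\<close> over the half plane,
which is the integral of \<open>\<bar>s * G\<bar>\<^sup>2\<close> for the hyperbolic area \<open>dx ds / s\<^sup>2\<close>, is a constant multiple
of the squared norm of \<open>f\<close> (\<open>wave_energy\<close>). The frame inequality says that the discrete sum of
\<open>\<bar>s * G\<bar>\<^sup>2\<close> over \<open>\<Gamma>\<close> is comparable with this integral.

The derivatives \<open>s * \<partial>\<^sub>x G\<close>, \<open>s * \<partial>\<^sub>s G\<close> and \<open>s\<^sup>2 * \<partial>\<^sub>x \<partial>\<^sub>s G\<close> are integrals of the same kind,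
with \<open>u * m u\<close>, \<open>u * m' u\<close> and \<open>u\<^sup>2 * m' u\<close> in place of \<open>m u\<close>, so they obey the same energy
identity with other constants. On a Euclidean square of side \<open>h * b\<close> at height \<open>b\<close> an elementary
Sobolev estimate (\<open>cell_oscillation\<close>) compares \<open>G\<close> with its value at any one point of the square, up
to \<open>h\<^sup>2\<close> times the energy of these derivatives in the square. These squares, with \<open>b\<close> running through
the powers of \<open>1 + h\<close>, tile the half plane, and summing over the tiles gives both inequalities
(\<open>sample_versus_cell\<close>).

For the lower bound, \<open>h\<close> is taken so small, in terms of \<open>n\<close> only, that the oscillation is at most
half of the energy; every tile contains a hyperbolic ball of a fixed radius \<open>\<delta>\<close>, so a
\<open>\<delta>\<close>-dense \<open>\<Gamma>\<close> meets every tile. For the upper bound, a second grid, depending on the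
separation of \<open>\<Gamma>\<close>, is used whose tiles contain at most one point of \<open>\<Gamma>\<close> each.

Plancherel's formula is first proved on \<open>L\<^sup>1 \<inter> L\<^sup>2\<close> by Gaussian regularisation and the
continuity of translations (\<open>Plancherel_L1_L2\<close>), and then transferred to the transform defined by
truncation (\<open>Plancherel\<close>). The identification of the chosen wavelet with an explicit Fourier
integral rests on the injectivity of that transform (\<open>has_L2_fourier_unique\<close>).\<close>

section \<open>Continuity of translations\<close>

text \<open>For an open set the indicators of the translates converge pointwise on the set itself; this suffices
because the measure of the symmetric difference of two sets of equal measure is determined by that of
their intersection.\<close>

lemma L1_translation_tendsto_open:
  fixes t :: "nat \<Rightarrow> real"
  assumes U: "open U" "emeasure lborel U < \<infinity>" and t: "t \<longlonglongrightarrow> 0"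
  shows "(\<lambda>n. \<integral>x. \<bar>indicator U (x + t n) - indicator U x :: real\<bar> \<partial>lborel) \<longlonglongrightarrow> 0"
proof -
  have [measurable]: "U \<in> sets borel" using U by auto
  have int: "integrable lborel (indicator U :: real \<Rightarrow> real)" using U by simp
  have shift: "integrable lborel (\<lambda>x. indicator U (x + s) :: real)"
      "(\<integral>x. indicator U (x + s) \<partial>lborel) = measure lborel U" for s
    using lborel_integrable_real_affine[OF int, of 1 s]
      lborel_integral_real_affine[of 1 "indicator U :: real \<Rightarrow> real" s] by (auto simp: add.commute)
  have prod: "integrable lborel (\<lambda>x. indicator U x * indicator U (x + s) :: real)" for s
    by (rule Bochner_Integration.integrable_bound[OF int]) (auto simp: indicator_def)
  have "(\<lambda>n. \<integral>x. indicator U x * indicator U (x + t n) \<partial>lborel) \<longlonglongrightarrow> (\<integral>x. indicator U x \<partial>lborel :: real)"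
  proof (rule integral_dominated_convergence[where w="indicator U :: real \<Rightarrow> real"])
    show "AE x in lborel. (\<lambda>n. indicator U x * indicator U (x + t n)) \<longlonglongrightarrow> (indicator U x :: real)"
    proof (intro AE_I2 tendsto_eventually)
      fix x
      have lim: "(\<lambda>n. x + t n) \<longlonglongrightarrow> x" using tendsto_add[OF tendsto_const t, of x] by simp
      show "\<forall>\<^sub>F n in sequentially. indicator U x * indicator U (x + t n) = (indicator U x :: real)"
      proof (cases "x \<in> U")
        case True
        then show ?thesis using topological_tendstoD[OF lim U(1) True] True
          by (auto elim!: eventually_mono)
      qed auto
    qed
  qed (use int in \<open>auto simp: indicator_def\<close>)
  then have "(\<lambda>n. 2 * measure lborel U - 2 * (\<integral>x. indicator U x * indicator U (x + t n) \<partial>lborel)) \<longlonglongrightarrow>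
      2 * measure lborel U - 2 * measure lborel U"
    by (intro tendsto_intros) simp
  moreover have "(\<integral>x. \<bar>indicator U (x + t n) - indicator U x :: real\<bar> \<partial>lborel) =
     2 * measure lborel U - 2 * (\<integral>x. indicator U x * indicator U (x + t n) \<partial>lborel)" for n
  proof -
    have "(\<integral>x. \<bar>indicator U (x + t n) - indicator U x :: real\<bar> \<partial>lborel) =
       (\<integral>x. indicator U (x + t n) + indicator U x - 2 * (indicator U x * indicator U (x + t n)) \<partial>lborel)"
      by (intro Bochner_Integration.integral_cong) (auto simp: indicator_def)
    also have "\<dots> = 2 * measure lborel U - 2 * (\<integral>x. indicator U x * indicator U (x + t n) \<partial>lborel)"
      using int shift prod by simp
    finally show ?thesis .
  qed
  ultimately show ?thesis by simp
qed

text \<open>The functions with continuous translation are closed in \<open>L\<^sup>1\<close>, since translations are isometries.\<close>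

lemma translation_tendsto_approx:
  fixes f :: "real \<Rightarrow> complex" and t :: "nat \<Rightarrow> real"
  assumes f: "integrable lborel f"
    and approx: "\<And>e. e > 0 \<Longrightarrow> \<exists>g. integrable lborel g \<and> (\<integral>x. cmod (f x - g x) \<partial>lborel) \<le> e \<and>
        (\<lambda>n. \<integral>x. cmod (g (x + t n) - g x) \<partial>lborel) \<longlonglongrightarrow> 0"
  shows "(\<lambda>n. \<integral>x. cmod (f (x + t n) - f x) \<partial>lborel) \<longlonglongrightarrow> 0"
proof (rule LIMSEQ_I)
  fix e :: real assume "0 < e"
  then obtain g where g: "integrable lborel g" "(\<integral>x. cmod (f x - g x) \<partial>lborel) \<le> e/4"
     "(\<lambda>n. \<integral>x. cmod (g (x + t n) - g x) \<partial>lborel) \<longlonglongrightarrow> 0"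
    using approx[of "e/4"] by auto
  obtain N where N: "\<And>n. n \<ge> N \<Longrightarrow> (\<integral>x. cmod (g (x + t n) - g x) \<partial>lborel) < e/2"
    using LIMSEQ_D[OF g(3), of "e/2"] \<open>0 < e\<close> by fastforce
  have "norm ((\<integral>x. cmod (f (x + t n) - f x) \<partial>lborel) - 0) < e" if n: "n \<ge> N" for n
  proof -
    have fs: "integrable lborel (\<lambda>x. f (x + t n))" and gs: "integrable lborel (\<lambda>x. g (x + t n))"
      using lborel_integrable_real_affine[OF f, of 1 "t n"] lborel_integrable_real_affine[OF g(1), of 1 "t n"]
      by (simp_all add: add.commute)
    have sh: "(\<integral>x. cmod (f (x + t n) - g (x + t n)) \<partial>lborel) = (\<integral>x. cmod (f x - g x) \<partial>lborel)"
      using lborel_integral_real_affine[of 1 "\<lambda>x. cmod (f x - g x)" "t n"] by (simp add: add.commute)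
    have "(\<integral>x. cmod (f (x + t n) - f x) \<partial>lborel) \<le>
      (\<integral>x. cmod (f (x + t n) - g (x + t n)) + cmod (g (x + t n) - g x) + cmod (f x - g x) \<partial>lborel)"
    proof (rule integral_mono)
      fix x
      have "f (x + t n) - f x = (f (x + t n) - g (x + t n)) + (g (x + t n) - g x) + - (f x - g x)" by simp
      then show "cmod (f (x + t n) - f x) \<le> cmod (f (x + t n) - g (x + t n)) + cmod (g (x + t n) - g x) + cmod (f x - g x)"
        by (metis norm_minus_cancel norm_triangle_le norm_triangle_ineq add_right_mono)
    qed (use f g fs gs in auto)
    also have "\<dots> = (\<integral>x. cmod (f x - g x) \<partial>lborel) + (\<integral>x. cmod (g (x + t n) - g x) \<partial>lborel) + (\<integral>x. cmod (f x - g x) \<partial>lborel)"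
      using f g fs gs by (simp add: sh)
    also have "\<dots> < e" using g(2) N[OF n] by linarith
    finally show ?thesis by simp
  qed
  then show "\<exists>no. \<forall>n\<ge>no. norm ((\<integral>x. cmod (f (x + t n) - f x) \<partial>lborel) - 0) < e" by blast
qed

text \<open>By outer regularity, measurable sets of finite measure are approximated by open ones; simple functions
and \<open>L\<^sup>1\<close> limits then give all integrable functions.\<close>

lemma L1_translation_tendsto:
  fixes f :: "real \<Rightarrow> complex" and t :: "nat \<Rightarrow> real"
  assumes f: "integrable lborel f" and t: "t \<longlonglongrightarrow> 0"
  shows "(\<lambda>n. \<integral>x. cmod (f (x + t n) - f x) \<partial>lborel) \<longlonglongrightarrow> 0"
  using f
proof (induction rule: integrable_induct)
  case (base A c)
  have A[measurable]: "A \<in> sets borel" using base by auto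
  have intA: "integrable lborel (\<lambda>x. indicator A x *\<^sub>R c)" using base by auto
  show ?case
  proof (rule translation_tendsto_approx[OF intA])
    fix e :: real assume e: "e > 0"
    define d where "d = e / (cmod c + 1)"
    have d: "d > 0" using e by (simp add: d_def add_nonneg_pos)
    obtain U where U: "open U" "A \<subseteq> U" "emeasure lborel (U - A) < d"
      using outer_regular_lborel[OF A d] by auto
    have [measurable]: "U \<in> sets borel" using U by auto
    have UA: "emeasure lborel (U - A) < \<infinity>"
      using U(3) by (rule less_trans) simp
    have "emeasure lborel U = emeasure lborel (U - A) + emeasure lborel A"
      using U by (subst plus_emeasure) (auto intro!: arg_cong[where f="emeasure lborel"])
    also have "\<dots> < \<infinity>" using UA base by (simp add: ennreal_add_less_top)
    finally have Uf: "emeasure lborel U < \<infinity>" .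
    have intU: "integrable lborel (\<lambda>x. indicator U x *\<^sub>R c)" using Uf by auto
    have "(\<integral>x. cmod (indicator A x *\<^sub>R c - indicator U x *\<^sub>R c) \<partial>lborel) =
      (\<integral>x. indicator (U - A) x * cmod c \<partial>lborel)"
      using U(2) by (intro Bochner_Integration.integral_cong) (auto simp: indicator_def)
    also have "\<dots> = measure lborel (U - A) * cmod c" using UA by simp
    also have "\<dots> \<le> d * cmod c"
      using U(3) d by (intro mult_right_mono) (auto simp: measure_def intro!: enn2real_leI)
    also have "\<dots> \<le> d * (cmod c + 1)" using d by (intro mult_left_mono) auto
    also have "\<dots> = e" by (simp add: d_def add_nonneg_eq_0_iff)
    finally have 1: "(\<integral>x. cmod (indicator A x *\<^sub>R c - indicator U x *\<^sub>R c) \<partial>lborel) \<le> e" .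
    have "(\<integral>x. cmod (indicator U (x + t n) *\<^sub>R c - indicator U x *\<^sub>R c) \<partial>lborel) =
      (\<integral>x. \<bar>indicator U (x + t n) - indicator U x :: real\<bar> \<partial>lborel) * cmod c" for n
      by (subst integral_mult_left_zero[symmetric])
         (auto intro!: Bochner_Integration.integral_cong simp flip: scaleR_diff_left)
    then have 2: "(\<lambda>n. \<integral>x. cmod (indicator U (x + t n) *\<^sub>R c - indicator U x *\<^sub>R c) \<partial>lborel) \<longlonglongrightarrow> 0"
      using tendsto_mult_right[OF L1_translation_tendsto_open[OF U(1) Uf t], of "cmod c"] by simp
    show "\<exists>g. integrable lborel g \<and> (\<integral>x. cmod (indicator A x *\<^sub>R c - g x) \<partial>lborel) \<le> e \<and>
        (\<lambda>n. \<integral>x. cmod (g (x + t n) - g x) \<partial>lborel) \<longlonglongrightarrow> 0"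
      by (rule exI[of _ "\<lambda>x. indicator U x *\<^sub>R c"]) (use 1 2 intU in simp)
  qed
next
  case (add f g)
  have "(\<lambda>n. (\<integral>x. cmod (f (x + t n) - f x) \<partial>lborel) + (\<integral>x. cmod (g (x + t n) - g x) \<partial>lborel)) \<longlonglongrightarrow> 0"
    using tendsto_add[OF add(3,4)] by simp
  then show ?case
  proof (rule Lim_null_comparison[rotated])
    show "\<forall>\<^sub>F n in sequentially. norm (\<integral>x. cmod (f (x + t n) + g (x + t n) - (f x + g x)) \<partial>lborel) \<le>
       (\<integral>x. cmod (f (x + t n) - f x) \<partial>lborel) + (\<integral>x. cmod (g (x + t n) - g x) \<partial>lborel)"
    proof (rule always_eventually, rule allI)
      fix n
      have s: "integrable lborel (\<lambda>x. f (x + t n))" "integrable lborel (\<lambda>x. g (x + t n))"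
        using lborel_integrable_real_affine[OF add(1), of 1 "t n"] lborel_integrable_real_affine[OF add(2), of 1 "t n"]
        by (simp_all add: add.commute)
      have "(\<integral>x. cmod (f (x + t n) + g (x + t n) - (f x + g x)) \<partial>lborel) \<le>
        (\<integral>x. cmod (f (x + t n) - f x) + cmod (g (x + t n) - g x) \<partial>lborel)"
        using s add(1,2) by (intro integral_mono) (auto simp: add_diff_add norm_triangle_ineq)
      then show "norm (\<integral>x. cmod (f (x + t n) + g (x + t n) - (f x + g x)) \<partial>lborel) \<le>
       (\<integral>x. cmod (f (x + t n) - f x) \<partial>lborel) + (\<integral>x. cmod (g (x + t n) - g x) \<partial>lborel)"
        using s add(1,2) by simp
    qed
  qed
next
  case (lim f s)
  show ?case
  proof (rule translation_tendsto_approx[OF lim(4)])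
    fix e :: real assume e: "e > 0"
    have [measurable]: "f \<in> borel_measurable borel" "\<And>i. s i \<in> borel_measurable borel"
      using lim(1,4) by auto
    have "(\<lambda>i. \<integral>x. cmod (f x - s i x) \<partial>lborel) \<longlonglongrightarrow> (\<integral>x. 0 \<partial>(lborel::real measure))"
    proof (rule integral_dominated_convergence[where w="\<lambda>x. 3 * cmod (f x)"])
      show "AE x in lborel. norm (cmod (f x - s i x)) \<le> 3 * cmod (f x)" for i
      proof (rule AE_I2)
        fix x show "norm (cmod (f x - s i x)) \<le> 3 * cmod (f x)"
          using lim(3)[of x i] norm_triangle_ineq4[of "f x" "s i x"] by simp
      qed
      show "AE x in lborel. (\<lambda>i. cmod (f x - s i x)) \<longlonglongrightarrow> 0"
      proof (rule AE_I2)
        fix x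
        have "(\<lambda>i. f x - s i x) \<longlonglongrightarrow> f x - f x"
          using lim(2)[of x] by (intro tendsto_intros) simp
        then show "(\<lambda>i. cmod (f x - s i x)) \<longlonglongrightarrow> 0" using tendsto_norm_zero by force
      qed
    qed (use lim(4) in auto)
    then have "\<forall>\<^sub>F i in sequentially. (\<integral>x. cmod (f x - s i x) \<partial>lborel) < e"
      using e by (intro order_tendstoD(2)) simp_all
    then obtain i where "(\<integral>x. cmod (f x - s i x) \<partial>lborel) < e"
      by (auto simp: eventually_sequentially)
    then show "\<exists>g. integrable lborel g \<and> (\<integral>x. cmod (f x - g x) \<partial>lborel) \<le> e \<and>
        (\<lambda>n. \<integral>x. cmod (g (x + t n) - g x) \<partial>lborel) \<longlonglongrightarrow> 0"
      using lim(1,5) by (intro exI[of _ "s i"]) auto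
  qed
qed

text \<open>Fubini's theorem in the form in which it serves all the duality arguments with the kernel
\<open>exp (\<i> * x * w)\<close>.\<close>

lemma integral_swap_bounded_kernel:
  fixes f g :: "real \<Rightarrow> complex" and K :: "real \<Rightarrow> real \<Rightarrow> complex"
  assumes f: "integrable lborel f" and g: "integrable lborel g"
    and K[measurable]: "case_prod K \<in> borel_measurable (borel \<Otimes>\<^sub>M borel)"
    and bound: "\<And>x y. cmod (K x y) \<le> C"
  shows "integrable lborel (\<lambda>x. f x * (LINT y|lborel. g y * K x y))"
    and "(LINT x|lborel. f x * (LINT y|lborel. g y * K x y)) =
         (LINT y|lborel. g y * (LINT x|lborel. f x * K x y))"
proof -
  have [measurable]: "f \<in> borel_measurable borel" "g \<in> borel_measurable borel"
    using f g by auto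
  have C: "0 \<le> C" using bound[of 0 0] norm_ge_zero order_trans by blast
  have le: "cmod (a * K x y) \<le> norm (C * cmod a)" for a x y
    using mult_left_mono[OF bound[of x y], of "cmod a"] C by (simp add: norm_mult abs_mult mult.commute)
  have Kx: "integrable lborel (\<lambda>y. g y * K x y)" for x
    by (rule Bochner_Integration.integrable_bound[of _ "\<lambda>y. C * cmod (g y)"]) (use g le in auto)
  have Ky: "integrable lborel (\<lambda>x. f x * K x y)" for y
    by (rule Bochner_Integration.integrable_bound[of _ "\<lambda>y. C * cmod (f y)"]) (use f le in auto)
  have int: "integrable (lborel \<Otimes>\<^sub>M lborel) (\<lambda>(x, y). f x * (g y * K x y))"
  proof (rule Bochner_Integration.integrable_bound[where f="\<lambda>(x,y). C * (cmod (f x) * cmod (g y))"])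
    show "integrable (lborel \<Otimes>\<^sub>M lborel) (\<lambda>(x, y). C * (cmod (f x) * cmod (g y)))"
      by (rule lborel_pair.Fubini_integrable) (use f g C in \<open>auto simp: abs_mult\<close>)
    show "AE p in lborel \<Otimes>\<^sub>M lborel. norm (case p of (x, y) \<Rightarrow> f x * (g y * K x y))
            \<le> norm (case p of (x, y) \<Rightarrow> C * (cmod (f x) * cmod (g y)))"
    proof (rule AE_I2, clarify)
      fix x y
      show "cmod (f x * (g y * K x y)) \<le> norm (C * (cmod (f x) * cmod (g y)))"
        using le[of "f x * g y" x y] by (simp add: norm_mult mult.assoc)
    qed
  qed measurable
  show "integrable lborel (\<lambda>x. f x * (LINT y|lborel. g y * K x y))"
    using lborel_pair.integrable_fst'[OF int] Kx by simp
  have "(LINT x|lborel. f x * (LINT y|lborel. g y * K x y)) = (LINT x|lborel. LINT y|lborel. f x * (g y * K x y))"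
    using Kx by simp
  also have "\<dots> = (LINT y|lborel. LINT x|lborel. f x * (g y * K x y))"
    using lborel_pair.Fubini_integral[OF int] by simp
  also have "\<dots> = (LINT y|lborel. LINT x|lborel. g y * (f x * K x y))"
    by (simp add: ac_simps)
  finally show "(LINT x|lborel. f x * (LINT y|lborel. g y * K x y)) =
         (LINT y|lborel. g y * (LINT x|lborel. f x * K x y))"
    using Ky by simp
qed

section \<open>Plancherel's formula for integrable functions\<close>

lemma norm_exp_i_times_of_real [simp]:
  "cmod (exp (\<i> * complex_of_real x * complex_of_real y)) = 1"
  "cmod (exp (- \<i> * complex_of_real x * complex_of_real y)) = 1"
  "cmod (exp (- (\<i> * complex_of_real x * complex_of_real y))) = 1"
  "cmod (exp (\<i> * (complex_of_real x * complex_of_real y))) = 1"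
  by (simp_all add: norm_exp_eq_Re)

text \<open>The Gaussian is its own characteristic function; rescaling gives the transform of every dilate.\<close>

lemma Gaussian_Fourier:
  fixes e t :: real
  assumes e: "e > 0"
  shows "integrable lborel (\<lambda>w. exp (- (e * w)\<^sup>2 / 2))"
    and "(LINT w|lborel. complex_of_real (exp (- (e * w)\<^sup>2 / 2)) * exp (\<i> * complex_of_real t * complex_of_real w)) =
         complex_of_real (2 * pi * (std_normal_density (t / e) / e))"
proof -
  have 1: "(LINT u|lborel. complex_of_real (std_normal_density u) * exp (\<i> * complex_of_real (s * u))) = complex_of_real (exp (- s\<^sup>2 / 2))" for s
  proof -
    have "complex_of_real (exp (- s\<^sup>2 / 2)) = char std_normal_distribution s"
      by (simp add: char_std_normal_distribution)
    also have "\<dots> = (LINT u|lborel. std_normal_density u *\<^sub>R iexp (s * u))"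
      unfolding char_def by (rule integral_density) auto
    finally show ?thesis by (simp add: scaleR_conv_of_real)
  qed
  have sq2: "sqrt (2 * pi) \<noteq> 0" by simp
  have dens: "std_normal_density u = (1 / sqrt (2 * pi)) * exp (- u\<^sup>2 / 2)" for u
    by (rule std_normal_density_def)
  have "integrable lborel (\<lambda>u. std_normal_density (0 + e * u))"
    using lborel_integrable_real_affine[OF integrable_normal_density[of 1 0], of e 0] e by auto
  then have "integrable lborel (\<lambda>w. sqrt (2 * pi) * std_normal_density (0 + e * w))"
    by (rule integrable_mult_right)
  moreover have "sqrt (2 * pi) * std_normal_density (0 + e * w) = exp (- (e * w)\<^sup>2 / 2)" for w
    unfolding dens using sq2 by simp
  ultimately show "integrable lborel (\<lambda>w. exp (- (e * w)\<^sup>2 / 2))" by (simp only:)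
  define J where "J = (LINT w|lborel. complex_of_real (exp (- (e * w)\<^sup>2 / 2)) * exp (\<i> * complex_of_real t * complex_of_real w))"
  have "complex_of_real (exp (- (t / e)\<^sup>2 / 2)) =
    \<bar>e\<bar> *\<^sub>R (LINT w|lborel. complex_of_real (std_normal_density (0 + e * w)) * exp (\<i> * complex_of_real (t / e * (0 + e * w))))"
    unfolding 1[symmetric] using e by (intro lborel_integral_real_affine) simp
  also have "(LINT w|lborel. complex_of_real (std_normal_density (0 + e * w)) * exp (\<i> * complex_of_real (t / e * (0 + e * w)))) =
    (LINT w|lborel. complex_of_real (1 / sqrt (2 * pi)) * (complex_of_real (exp (- (e * w)\<^sup>2 / 2)) * exp (\<i> * complex_of_real t * complex_of_real w)))"
    using e by (intro Bochner_Integration.integral_cong) (simp_all add: dens mult.assoc)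
  also have "\<dots> = complex_of_real (1 / sqrt (2 * pi)) * J"
    unfolding J_def by (rule integral_mult_right_zero)
  finally have 2: "complex_of_real (exp (- (t / e)\<^sup>2 / 2)) = of_real (e * (1 / sqrt (2 * pi))) * J"
    using e by (simp add: scaleR_conv_of_real)
  have "complex_of_real (2 * pi * (std_normal_density (t / e) / e)) =
      of_real (2 * pi * (1 / sqrt (2 * pi)) / e) * complex_of_real (exp (- (t / e)\<^sup>2 / 2))"
    unfolding dens by simp
  also have "\<dots> = of_real (2 * pi * (1 / sqrt (2 * pi)) / e * (e * (1 / sqrt (2 * pi)))) * J"
    unfolding 2 by (simp only: of_real_mult mult.assoc)
  also have "2 * pi * (1 / sqrt (2 * pi)) / e * (e * (1 / sqrt (2 * pi))) = 2 * pi / (sqrt (2 * pi) * sqrt (2 * pi))"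
    using e by simp
  also have "\<dots> = 1" by (simp only: real_sqrt_mult_self) simp
  finally show "(LINT w|lborel. complex_of_real (exp (- (e * w)\<^sup>2 / 2)) * exp (\<i> * complex_of_real t * complex_of_real w)) =
         complex_of_real (2 * pi * (std_normal_density (t / e) / e))"
    unfolding J_def by simp
qed

lemma borel_measurable_cnj [measurable (raw)]:
  "f \<in> borel_measurable M \<Longrightarrow> (\<lambda>x. cnj (f x)) \<in> borel_measurable M"
  by (rule borel_measurable_continuous_on[OF continuous_on_cnj[OF continuous_on_id]])

lemma fourier_integral_measurable [measurable (raw)]:
  assumes [measurable]: "f \<in> borel_measurable borel" "h \<in> borel_measurable M"
  shows "(\<lambda>x. fourier_integral f (h x)) \<in> borel_measurable M"
proof -
  have "fourier_integral f \<in> borel_measurable borel"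
    unfolding fourier_integral_def[abs_def] by measurable
  then show ?thesis using assms(2) by (rule measurable_compose_rev)
qed

lemma cmod_fourier_integral_le: "cmod (fourier_integral f w) \<le> (LINT x|lborel. cmod (f x))"
  unfolding fourier_integral_def
  by (rule order_trans[OF integral_norm_bound]) (simp add: norm_mult)

text \<open>The factor \<open>exp (- (e * w)\<^sup>2 / 2)\<close> makes the double integral absolutely convergent. Integrating it out
turns the weighted energy of the transform into the pairing of \<open>f\<close> with its average over translates,
the translates being weighted by a Gaussian of width \<open>e\<close>.\<close>

lemma Gaussian_regularised_Plancherel:
  fixes f :: "real \<Rightarrow> complex" and e :: real
  assumes f: "integrable lborel f" and e: "e > 0"
  shows "(LINT w|lborel. complex_of_real (exp (- (e * w)\<^sup>2 / 2) * (cmod (fourier_integral f w))\<^sup>2)) =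
     2 * pi * (LINT x|lborel. f x * (LINT u|lborel. cnj (f (x + e * u)) * std_normal_density u))"
   and "integrable lborel (\<lambda>w. exp (- (e * w)\<^sup>2 / 2) * (cmod (fourier_integral f w))\<^sup>2)"
   and "integrable lborel (\<lambda>x. f x * (LINT u|lborel. cnj (f (x + e * u)) * std_normal_density u))"
proof -
  have [measurable]: "f \<in> borel_measurable borel" using f by auto
  define w where "w = (\<lambda>v. complex_of_real (exp (- (e * v)\<^sup>2 / 2)))"
  define I where "I = (LINT x|lborel. cmod (f x))"
  have I: "I \<ge> 0" by (simp add: I_def)
  have w: "integrable lborel w"
    unfolding w_def using Gaussian_Fourier(1)[OF e] by simp
  have [measurable]: "w \<in> borel_measurable borel" using w by auto
  have h: "integrable lborel (\<lambda>v. w v * cnj (fourier_integral f v))"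
    by (rule Bochner_Integration.integrable_bound[of _ "\<lambda>v. w v * of_real I"])
       (use w I in \<open>auto simp: norm_mult I_def intro!: mult_left_mono cmod_fourier_integral_le AE_I2\<close>)
  have cf: "integrable lborel (\<lambda>x. cnj (f x))" using f by simp
  have cnjF: "cnj (fourier_integral f v) = (LINT y|lborel. cnj (f y) * exp (\<i> * of_real y * of_real v))" for v
    unfolding fourier_integral_def by (subst Bochner_Integration.integral_cnj[symmetric]) (simp add: exp_cnj)
  have normal: "(LINT v|lborel. w v * exp (\<i> * complex_of_real t * complex_of_real v)) =
         complex_of_real (2 * pi * (std_normal_density (t / e) / e))" for t
    unfolding w_def by (rule Gaussian_Fourier(2)[OF e])
  have inner: "(LINT v|lborel. (w v * cnj (fourier_integral f v)) * exp (- \<i> * of_real x * of_real v)) =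
     2 * pi * (LINT u|lborel. cnj (f (x + e * u)) * std_normal_density u)" for x
  proof -
    have wx: "integrable lborel (\<lambda>v. w v * exp (- \<i> * of_real x * of_real v))"
      by (rule Bochner_Integration.integrable_bound[OF w]) (auto simp: norm_mult)
    have "(LINT v|lborel. (w v * cnj (fourier_integral f v)) * exp (- \<i> * of_real x * of_real v)) =
      (LINT v|lborel. (w v * exp (- \<i> * of_real x * of_real v)) * (LINT y|lborel. cnj (f y) * exp (\<i> * of_real y * of_real v)))"
      unfolding cnjF by (simp add: ac_simps)
    also have "\<dots> = (LINT y|lborel. cnj (f y) * (LINT v|lborel. (w v * exp (- \<i> * of_real x * of_real v)) * exp (\<i> * of_real y * of_real v)))"
      by (rule integral_swap_bounded_kernel(2)[OF wx cf, where C=1]) auto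
    also have "\<dots> = (LINT y|lborel. cnj (f y) * (LINT v|lborel. w v * exp (\<i> * of_real (y - x) * of_real v)))"
    proof -
      have "- \<i> * of_real x * of_real v + \<i> * of_real y * of_real v = \<i> * of_real (y - x) * complex_of_real v" for y v
        by (simp add: algebra_simps)
      then have "exp (- \<i> * of_real x * of_real v) * exp (\<i> * of_real y * of_real v) = exp (\<i> * of_real (y - x) * complex_of_real v)" for y v
        by (metis exp_add)
      then show ?thesis by (simp only: mult.assoc[of "w _"])
    qed
    also have "\<dots> = (LINT y|lborel. cnj (f y) * complex_of_real (2 * pi * (std_normal_density ((y - x) / e) / e)))"
      unfolding normal ..
    also have "\<dots> = e * (LINT u|lborel. cnj (f (x + e * u)) * complex_of_real (2 * pi * (std_normal_density (((x + e * u) - x) / e) / e)))"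
      using e by (subst lborel_integral_real_affine[of e _ x]) (auto simp: scaleR_conv_of_real)
    also have "\<dots> = (LINT u|lborel. e * (cnj (f (x + e * u)) * complex_of_real (2 * pi * (std_normal_density (((x + e * u) - x) / e) / e))))"
      by (rule integral_mult_right_zero[symmetric])
    also have "\<dots> = (LINT u|lborel. (2 * pi) * (cnj (f (x + e * u)) * std_normal_density u))"
      using e by (intro Bochner_Integration.integral_cong) (auto simp: ac_simps)
    finally show ?thesis by simp
  qed
  have sq: "w v * cnj (fourier_integral f v) * fourier_integral f v = complex_of_real (exp (- (e * v)\<^sup>2 / 2) * (cmod (fourier_integral f v))\<^sup>2)" for v
    unfolding w_def of_real_mult complex_norm_square by (simp add: ac_simps)
  have eq1: "(LINT v|lborel. w v * cnj (fourier_integral f v) * fourier_integral f v) =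
     (LINT x|lborel. f x * (LINT v|lborel. (w v * cnj (fourier_integral f v)) * exp (- \<i> * of_real x * of_real v)))"
    unfolding fourier_integral_def[of f]
    by (rule integral_swap_bounded_kernel(2)[OF h[unfolded fourier_integral_def] f, where C=1 and K="\<lambda>v x. exp (- \<i> * of_real x * of_real v)"]) auto
  have "(LINT x|lborel. f x * (2 * pi * (LINT u|lborel. cnj (f (x + e * u)) * std_normal_density u))) =
     (LINT x|lborel. 2 * pi * (f x * (LINT u|lborel. cnj (f (x + e * u)) * std_normal_density u)))"
    by (rule Bochner_Integration.integral_cong) (simp_all only: mult.left_commute)
  also have "\<dots> = 2 * pi * (LINT x|lborel. f x * (LINT u|lborel. cnj (f (x + e * u)) * std_normal_density u))"
    by (rule integral_mult_right_zero)
  finally show "(LINT w|lborel. complex_of_real (exp (- (e * w)\<^sup>2 / 2) * (cmod (fourier_integral f w))\<^sup>2)) =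
     2 * pi * (LINT x|lborel. f x * (LINT u|lborel. cnj (f (x + e * u)) * std_normal_density u))"
    using eq1 unfolding inner sq by (rule trans[rotated])
  have "integrable lborel (\<lambda>v. w v * cnj (fourier_integral f v) * fourier_integral f v)"
    unfolding fourier_integral_def[of f]
    by (rule integral_swap_bounded_kernel(1)[OF h[unfolded fourier_integral_def] f, where C=1 and K="\<lambda>v x. exp (- \<i> * of_real x * of_real v)"]) auto
  then show "integrable lborel (\<lambda>w. exp (- (e * w)\<^sup>2 / 2) * (cmod (fourier_integral f w))\<^sup>2)"
    unfolding sq by (drule_tac integrable_Re) (simp only: Re_complex_of_real)
  have "integrable lborel (\<lambda>x. f x * (LINT v|lborel. (w v * cnj (fourier_integral f v)) * exp (- \<i> * of_real x * of_real v)))"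
    by (rule integral_swap_bounded_kernel(1)[OF f h, where C=1]) auto
  then have "integrable lborel (\<lambda>x. complex_of_real (1 / (2*pi)) * (f x * (2 * pi * (LINT u|lborel. cnj (f (x + e * u)) * std_normal_density u))))"
    unfolding inner by (rule integrable_mult_right)
  then show "integrable lborel (\<lambda>x. f x * (LINT u|lborel. cnj (f (x + e * u)) * std_normal_density u))"
    by simp
qed


lemma integrable_translate:
  fixes f :: "real \<Rightarrow> 'b :: {banach, second_countable_topology}"
  shows "integrable lborel f \<Longrightarrow> integrable lborel (\<lambda>x. f (x + t))"
  using lborel_integrable_real_affine[of f 1 t] by (simp add: add.commute)

lemma integral_translate:
  fixes f :: "real \<Rightarrow> 'b :: {banach, second_countable_topology}"
  shows "(LINT x|lborel. f (x + t)) = (LINT x|lborel. f x)"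
  using lborel_integral_real_affine[of 1 f t] by (simp add: add.commute)

lemma cmod_diff_square_le: "(cmod (a - b))\<^sup>2 \<le> 2 * (cmod a)\<^sup>2 + 2 * (cmod b)\<^sup>2"
proof -
  have "(cmod (a - b))\<^sup>2 \<le> (cmod a + cmod b)\<^sup>2"
    by (intro power_mono norm_triangle_ineq4) simp
  also have "\<dots> \<le> 2 * (cmod a)\<^sup>2 + 2 * (cmod b)\<^sup>2"
    using zero_le_power2[of "cmod a - cmod b"] by (simp add: power2_eq_square algebra_simps)
  finally show ?thesis .
qed

text \<open>Crude bounds, uniform in \<open>t\<close>, which provide the dominating function in the limit of vanishing width.\<close>

lemma L2_translation_difference:
  fixes f :: "real \<Rightarrow> complex"
  assumes f: "f \<in> borel_measurable borel" and f2: "integrable lborel (\<lambda>x. (cmod (f x))\<^sup>2)"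
  shows "integrable lborel (\<lambda>x. (cmod (f (x + t) - f x))\<^sup>2)"
    and "(LINT x|lborel. (cmod (f (x + t) - f x))\<^sup>2) \<le> 4 * (LINT x|lborel. (cmod (f x))\<^sup>2)"
    and "integrable lborel (\<lambda>x. cmod (f x) * cmod (f (x + t) - f x))"
    and "(LINT x|lborel. cmod (f x) * cmod (f (x + t) - f x)) \<le> 3 * (LINT x|lborel. (cmod (f x))\<^sup>2)"
proof -
  note [measurable] = f
  have shift: "integrable lborel (\<lambda>x. (cmod (f (x + t)))\<^sup>2)"
    by (rule integrable_translate[OF f2])
  have le: "(cmod (f (x + t) - f x))\<^sup>2 \<le> 2 * (cmod (f (x + t)))\<^sup>2 + 2 * (cmod (f x))\<^sup>2" for x
    by (rule cmod_diff_square_le)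
  show i: "integrable lborel (\<lambda>x. (cmod (f (x + t) - f x))\<^sup>2)"
    by (rule Bochner_Integration.integrable_bound[where f="\<lambda>x. 2 * (cmod (f (x + t)))\<^sup>2 + 2 * (cmod (f x))\<^sup>2"])
       (use shift f2 le in \<open>auto simp: order_trans[OF le abs_ge_self]\<close>)
  have "(LINT x|lborel. (cmod (f (x + t) - f x))\<^sup>2) \<le> (LINT x|lborel. 2 * (cmod (f (x + t)))\<^sup>2 + 2 * (cmod (f x))\<^sup>2)"
    using i shift f2 le by (intro integral_mono) auto
  also have "\<dots> = 4 * (LINT x|lborel. (cmod (f x))\<^sup>2)"
    using shift f2 by (simp add: integral_translate[where f="\<lambda>x. (cmod (f x))\<^sup>2"])
  finally show i4: "(LINT x|lborel. (cmod (f (x + t) - f x))\<^sup>2) \<le> 4 * (LINT x|lborel. (cmod (f x))\<^sup>2)" .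
  have le2: "cmod (f x) * cmod (f (x + t) - f x) \<le> (cmod (f x))\<^sup>2 + (cmod (f (x + t) - f x))\<^sup>2 / 2" for x
  proof -
    define a b where "a = cmod (f x)" and "b = cmod (f (x + t) - f x)"
    have "0 \<le> (a - b)\<^sup>2 + a\<^sup>2" by simp
    then have "a * b \<le> a\<^sup>2 + b\<^sup>2 / 2" by (simp add: power2_eq_square algebra_simps)
    then show ?thesis by (simp add: a_def b_def)
  qed
  show i2: "integrable lborel (\<lambda>x. cmod (f x) * cmod (f (x + t) - f x))"
    by (rule Bochner_Integration.integrable_bound[where f="\<lambda>x. (cmod (f x))\<^sup>2 + (cmod (f (x + t) - f x))\<^sup>2 / 2"])
       (use i f2 le2 in \<open>auto simp: order_trans[OF le2 abs_ge_self]\<close>)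
  have "(LINT x|lborel. cmod (f x) * cmod (f (x + t) - f x)) \<le> (LINT x|lborel. (cmod (f x))\<^sup>2 + (cmod (f (x + t) - f x))\<^sup>2 / 2)"
    using i i2 f2 le2 by (intro integral_mono) auto
  also have "\<dots> \<le> 3 * (LINT x|lborel. (cmod (f x))\<^sup>2)"
    using i f2 i4 by simp
  finally show "(LINT x|lborel. cmod (f x) * cmod (f (x + t) - f x)) \<le> 3 * (LINT x|lborel. (cmod (f x))\<^sup>2)" .
qed

text \<open>Where \<open>f\<close> is bounded by \<open>N\<close>, the continuity of translations in \<open>L\<^sup>1\<close> applies; the part above \<open>N\<close> is
small in \<open>L\<^sup>2\<close>.\<close>

lemma L2_translation_weakly_continuous:
  fixes f :: "real \<Rightarrow> complex" and t :: "nat \<Rightarrow> real"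
  assumes f: "integrable lborel f" and f2: "integrable lborel (\<lambda>x. (cmod (f x))\<^sup>2)" and t: "t \<longlonglongrightarrow> 0"
  shows "(\<lambda>n. LINT x|lborel. cmod (f x) * cmod (f (x + t n) - f x)) \<longlonglongrightarrow> 0"
proof (rule LIMSEQ_I)
  fix e :: real assume e: "0 < e"
  have [measurable]: "f \<in> borel_measurable borel" using f by auto
  define S where "S = (LINT x|lborel. (cmod (f x))\<^sup>2)"
  (* the weight in \<open>a * b \<le> A * a\<^sup>2 + b\<^sup>2 / (4 * A)\<close>, which makes the contribution of \<open>b\<close> at most \<open>S / A < e / 2\<close> *)
  define A where "A = 4 * (S + 1) / e"
  have S: "S \<ge> 0" by (simp add: S_def)
  have A: "A > 0" using S e by (simp add: A_def)
  have SA: "S / A < e / 2" proof -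
    have "S * e < 2 * (S + 1) * e" using S e by (intro mult_strict_right_mono) auto
    then show ?thesis using S e by (simp add: A_def field_simps)
  qed
  define T where "T = (\<lambda>N x. if cmod (f x) > real N then cmod (f x) else 0)"
  have T2: "integrable lborel (\<lambda>x. (T N x)\<^sup>2)" for N
    by (rule Bochner_Integration.integrable_bound[OF f2]) (auto simp: T_def)
  have "(\<lambda>N. LINT x|lborel. (T N x)\<^sup>2) \<longlonglongrightarrow> (LINT x|(lborel :: real measure). 0)"
  proof (rule integral_dominated_convergence[where w="\<lambda>x. (cmod (f x))\<^sup>2"])
    show "AE x in lborel. (\<lambda>N. (T N x)\<^sup>2) \<longlonglongrightarrow> 0"
    proof (intro AE_I2 tendsto_eventually)
      fix x
      show "\<forall>\<^sub>F N in sequentially. (T N x)\<^sup>2 = 0"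
        using eventually_ge_at_top[of "nat \<lceil>cmod (f x)\<rceil>"]
        by eventually_elim (auto simp: T_def nat_le_iff ceiling_le_iff)
    qed
  qed (use f2 in \<open>auto simp: T_def\<close>)
  then have "(\<lambda>N. LINT x|lborel. (T N x)\<^sup>2) \<longlonglongrightarrow> 0" by simp
  then have "\<forall>\<^sub>F N in sequentially. (LINT x|lborel. (T N x)\<^sup>2) < e / (4 * A)"
    by (rule order_tendstoD(2)) (use e A in simp)
  then obtain N where N: "(LINT x|lborel. (T N x)\<^sup>2) < e / (4 * A)"
    by (auto simp: eventually_sequentially)
  have "(\<lambda>n. real N * (LINT x|lborel. cmod (f (x + t n) - f x))) \<longlonglongrightarrow> real N * 0"
    by (intro tendsto_intros L1_translation_tendsto f t)
  then have "\<forall>\<^sub>F n in sequentially. real N * (LINT x|lborel. cmod (f (x + t n) - f x)) < e / 4"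
    by (rule order_tendstoD(2)) (use e in simp)
  then have "\<forall>\<^sub>F n in sequentially. norm ((LINT x|lborel. cmod (f x) * cmod (f (x + t n) - f x)) - 0) < e"
  proof eventually_elim
    case (elim n)
    note D = L2_translation_difference[of f "t n", OF _ f2, simplified]
    have le: "cmod (f x) * cmod (f (x + t n) - f x) \<le> real N * cmod (f (x + t n) - f x) + A * (T N x)\<^sup>2 + (cmod (f (x + t n) - f x))\<^sup>2 / (4 * A)" for x
    proof (cases "cmod (f x) > real N")
      case True
      define a b where "a = cmod (f x)" and "b = cmod (f (x + t n) - f x)"
      have "0 \<le> (2 * A * a - b)\<^sup>2" by simp
      then have "a * b \<le> A * a\<^sup>2 + b\<^sup>2 / (4 * A)"
        using A by (simp add: power2_eq_square field_simps)
      moreover have "T N x = a" using True by (simp add: T_def a_def)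
      moreover have "0 \<le> real N * b" by (simp add: b_def)
      ultimately show ?thesis unfolding a_def[symmetric] b_def[symmetric] by simp
    next
      case False
      then show ?thesis using A by (auto simp: T_def mult_right_mono add_increasing2)
    qed
    have fd: "integrable lborel (\<lambda>x. cmod (f (x + t n) - f x))"
      using f integrable_translate[OF f] by simp
    have "(LINT x|lborel. cmod (f x) * cmod (f (x + t n) - f x)) \<le>
      (LINT x|lborel. real N * cmod (f (x + t n) - f x) + A * (T N x)\<^sup>2 + (cmod (f (x + t n) - f x))\<^sup>2 / (4 * A))"
      using D T2 fd le by (intro integral_mono) auto
    also have "\<dots> = real N * (LINT x|lborel. cmod (f (x + t n) - f x)) + A * (LINT x|lborel. (T N x)\<^sup>2) + (LINT x|lborel. (cmod (f (x + t n) - f x))\<^sup>2) / (4 * A)"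
      using D T2 fd by simp
    also have "\<dots> < e / 4 + e / 4 + S / A"
    proof -
      have "A * (LINT x|lborel. (T N x)\<^sup>2) < e / 4" using N A by (simp add: field_simps)
      moreover have "(LINT x|lborel. (cmod (f (x + t n) - f x))\<^sup>2) / (4 * A) \<le> S / A"
        using D(2) A by (simp add: S_def field_simps)
      ultimately show ?thesis using elim by linarith
    qed
    also have "\<dots> < e" using SA by linarith
    finally show ?case by simp
  qed
  then show "\<exists>no. \<forall>n\<ge>no. norm ((LINT x|lborel. cmod (f x) * cmod (f (x + t n) - f x)) - 0) < e"
    by (simp add: eventually_sequentially)
qed

text \<open>Estimates the error of replacing the Gaussian average of the translates by \<open>f\<close> itself; after an
exchange of integrals it only involves the translation differences of \<open>f\<close>.\<close>

lemma Gaussian_average_bound: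
  fixes f :: "real \<Rightarrow> complex"
  assumes f: "integrable lborel f" and f2: "integrable lborel (\<lambda>x. (cmod (f x))\<^sup>2)" and e: "e > 0"
  shows "ennreal (cmod ((LINT x|lborel. f x * (LINT u|lborel. cnj (f (x + e * u)) * std_normal_density u)) - (LINT x|lborel. (cmod (f x))\<^sup>2)))
     \<le> (\<integral>\<^sup>+u. ennreal (std_normal_density u * (LINT x|lborel. cmod (f x) * cmod (f (x + e * u) - f x))) \<partial>lborel)"
proof -
  have fm[measurable]: "f \<in> borel_measurable borel" using f by auto
  have nn: "integrable lborel std_normal_density" "(LINT u|lborel. std_normal_density u) = 1"
    by (simp_all add: integrable_normal_density integral_normal_density)
  have nle: "std_normal_density u \<le> 1" for u
  proof -
    have "sqrt 1 \<le> sqrt (2 * pi)" using pi_gt3 by (intro real_sqrt_le_mono) simp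
    moreover have "exp (- u\<^sup>2 / 2) \<le> 1" by simp
    ultimately have "exp (- u\<^sup>2 / 2) \<le> sqrt (2 * pi)" unfolding real_sqrt_one by linarith
    then show ?thesis unfolding std_normal_density_def by simp
  qed
  have int1: "integrable lborel (\<lambda>u. cnj (f (x + e * u)) * std_normal_density u)" for x
  proof (rule Bochner_Integration.integrable_bound[where f="\<lambda>u. f (x + e * u)"])
    show "integrable lborel (\<lambda>u. f (x + e * u))"
      using lborel_integrable_real_affine[OF f, of e x] e by simp
  qed (auto simp: norm_mult mult_left_le nle)
  have int2: "integrable lborel (\<lambda>u. cnj (f x) * std_normal_density u)" for x
    by (intro integrable_mult_right) (simp add: nn)
  have c: "(LINT u|lborel. cnj (f (x + e * u)) * std_normal_density u) - cnj (f x) =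
     (LINT u|lborel. (cnj (f (x + e * u)) - cnj (f x)) * std_normal_density u)" for x
  proof -
    have "(LINT u|lborel. cnj (f x) * std_normal_density u) = cnj (f x)"
      using nn by simp
    then show ?thesis using Bochner_Integration.integral_diff[OF int1 int2, of x x] by (simp add: left_diff_distrib)
  qed
  have sq: "complex_of_real (LINT x|lborel. (cmod (f x))\<^sup>2) = (LINT x|lborel. f x * cnj (f x))"
    unfolding complex_norm_square[symmetric] by (rule integral_complex_of_real[symmetric])
  have i3: "integrable lborel (\<lambda>x. f x * cnj (f x))"
    unfolding complex_norm_square[symmetric] using f2 by (rule integrable_of_real)
  have "(LINT x|lborel. f x * (LINT u|lborel. cnj (f (x + e * u)) * std_normal_density u)) - complex_of_real (LINT x|lborel. (cmod (f x))\<^sup>2) =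
    (LINT x|lborel. f x * (LINT u|lborel. (cnj (f (x + e * u)) - cnj (f x)) * std_normal_density u))"
    unfolding sq c[symmetric] using Bochner_Integration.integral_diff[OF Gaussian_regularised_Plancherel(3)[OF f e] i3]
    by (simp add: right_diff_distrib)
  also have "ennreal (cmod \<dots>) \<le> (\<integral>\<^sup>+x. ennreal (cmod (f x * (LINT u|lborel. (cnj (f (x + e * u)) - cnj (f x)) * std_normal_density u))) \<partial>lborel)"
  proof (rule integral_norm_bound_ennreal)
    show "integrable lborel (\<lambda>x. f x * (LINT u|lborel. (cnj (f (x + e * u)) - cnj (f x)) * std_normal_density u))"
      unfolding c[symmetric] right_diff_distrib
      using Gaussian_regularised_Plancherel(3)[OF f e] i3 by (rule Bochner_Integration.integrable_diff)
  qed
  also have "\<dots> \<le> (\<integral>\<^sup>+x. (\<integral>\<^sup>+u. ennreal (cmod (f x) * cmod (f (x + e * u) - f x) * std_normal_density u) \<partial>lborel) \<partial>lborel)"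
  proof (rule nn_integral_mono)
    fix x
    have "ennreal (cmod (LINT u|lborel. (cnj (f (x + e * u)) - cnj (f x)) * std_normal_density u)) \<le>
      (\<integral>\<^sup>+u. ennreal (cmod ((cnj (f (x + e * u)) - cnj (f x)) * std_normal_density u)) \<partial>lborel)"
      using Bochner_Integration.integrable_diff[OF int1 int2, of x x]
      by (intro integral_norm_bound_ennreal) (simp add: left_diff_distrib)
    also have "\<dots> = (\<integral>\<^sup>+u. ennreal (cmod (f (x + e * u) - f x) * std_normal_density u) \<partial>lborel)"
      by (simp add: norm_mult flip: complex_cnj_diff)
    finally have "ennreal (cmod (f x)) * ennreal (cmod (LINT u|lborel. (cnj (f (x + e * u)) - cnj (f x)) * std_normal_density u)) \<le>
      ennreal (cmod (f x)) * (\<integral>\<^sup>+u. ennreal (cmod (f (x + e * u) - f x) * std_normal_density u) \<partial>lborel)"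
      by (rule mult_left_mono) simp
    also have "\<dots> = (\<integral>\<^sup>+u. ennreal (cmod (f x)) * ennreal (cmod (f (x + e * u) - f x) * std_normal_density u) \<partial>lborel)"
      by (rule nn_integral_cmult[symmetric]) simp
    finally show "ennreal (cmod (f x * (LINT u|lborel. (cnj (f (x + e * u)) - cnj (f x)) * std_normal_density u))) \<le>
       (\<integral>\<^sup>+u. ennreal (cmod (f x) * cmod (f (x + e * u) - f x) * std_normal_density u) \<partial>lborel)"
      by (simp add: norm_mult ennreal_mult' mult.assoc)
  qed
  also have "\<dots> = (\<integral>\<^sup>+u. (\<integral>\<^sup>+x. ennreal (cmod (f x) * cmod (f (x + e * u) - f x) * std_normal_density u) \<partial>lborel) \<partial>lborel)"
    by (rule lborel_pair.Fubini'[symmetric]) measurable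
  also have "\<dots> = (\<integral>\<^sup>+u. ennreal (std_normal_density u * (LINT x|lborel. cmod (f x) * cmod (f (x + e * u) - f x))) \<partial>lborel)"
  proof (rule nn_integral_cong)
    fix u
    have "(\<integral>\<^sup>+x. ennreal (cmod (f x) * cmod (f (x + e * u) - f x) * std_normal_density u) \<partial>lborel) =
       ennreal (LINT x|lborel. cmod (f x) * cmod (f (x + e * u) - f x) * std_normal_density u)"
      using L2_translation_difference(3)[OF fm f2] by (intro nn_integral_eq_integral) auto
    then show "(\<integral>\<^sup>+x. ennreal (cmod (f x) * cmod (f (x + e * u) - f x) * std_normal_density u) \<partial>lborel) =
      ennreal (std_normal_density u * (LINT x|lborel. cmod (f x) * cmod (f (x + e * u) - f x)))"
      by (simp add: mult.commute)
  qed
  finally show ?thesis .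
qed

text \<open>As the width tends to zero, the regularised energy increases to the energy of the transform, while the
pairing with the averaged translates tends to the squared norm of \<open>f\<close>.\<close>

theorem Plancherel_L1_L2:
  fixes f :: "real \<Rightarrow> complex"
  assumes f: "integrable lborel f" and f2: "integrable lborel (\<lambda>x. (cmod (f x))\<^sup>2)"
  shows "(\<integral>\<^sup>+w. ennreal ((cmod (fourier_integral f w))\<^sup>2) \<partial>lborel) = ennreal (2 * pi * (LINT x|lborel. (cmod (f x))\<^sup>2))"
proof -
  have fm[measurable]: "f \<in> borel_measurable borel" using f by auto
  define S where "S = (LINT x|lborel. (cmod (f x))\<^sup>2)"
  have S: "S \<ge> 0" by (simp add: S_def)
  define e where "e = (\<lambda>k::nat. 1 / (real k + 1))"
  have e: "e k > 0" for k by (simp add: e_def add_nonneg_pos)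
  have e0: "e \<longlonglongrightarrow> 0" unfolding e_def
    using LIMSEQ_inverse_real_of_nat by (simp add: inverse_eq_divide add.commute)
  define J where "J = (\<lambda>k. LINT x|lborel. f x * (LINT u|lborel. cnj (f (x + e k * u)) * std_normal_density u))"
  define D where "D = (\<lambda>t. LINT x|lborel. cmod (f x) * cmod (f (x + t) - f x))"
  have D3: "D t \<le> 3 * S" for t
    unfolding D_def S_def by (rule L2_translation_difference(4)[OF fm f2])
  have [measurable]: "D \<in> borel_measurable borel" unfolding D_def by measurable
  have "(\<lambda>k. \<integral>\<^sup>+u. ennreal (std_normal_density u * D (e k * u)) \<partial>lborel) \<longlonglongrightarrow> (\<integral>\<^sup>+u. 0 \<partial>(lborel::real measure))"
  proof (rule nn_integral_dominated_convergence[where w="\<lambda>u. ennreal (std_normal_density u * (3 * S))"])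
    show "(\<integral>\<^sup>+u. ennreal (std_normal_density u * (3 * S)) \<partial>lborel) < \<infinity>"
      using S by (subst nn_integral_eq_integral) (auto simp: integrable_normal_density)
    show "AE u in lborel. (\<lambda>k. ennreal (std_normal_density u * D (e k * u))) \<longlonglongrightarrow> 0"
    proof (rule AE_I2)
      fix u :: real
      have "(\<lambda>k. e k * u) \<longlonglongrightarrow> 0" using e0 by (rule tendsto_mult_left_zero)
      then have "(\<lambda>k. std_normal_density u * D (e k * u)) \<longlonglongrightarrow> 0"
        unfolding D_def by (intro tendsto_mult_right_zero L2_translation_weakly_continuous f f2)
      then show "(\<lambda>k. ennreal (std_normal_density u * D (e k * u))) \<longlonglongrightarrow> 0"
        using tendsto_ennrealI ennreal_0 by metis
    qed
    show "AE u in lborel. ennreal (std_normal_density u * D (e j * u)) \<le> ennreal (std_normal_density u * (3 * S))" for j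
      using D3 by (auto intro!: AE_I2 ennreal_leI mult_left_mono)
  qed auto
  then have lim0: "(\<lambda>k. \<integral>\<^sup>+u. ennreal (std_normal_density u * D (e k * u)) \<partial>lborel) \<longlonglongrightarrow> 0" by simp
  have "(\<lambda>k. ennreal (cmod (J k - of_real S))) \<longlonglongrightarrow> 0"
  proof (rule tendsto_sandwich[OF _ _ tendsto_const lim0])
    show "\<forall>\<^sub>F k in sequentially. ennreal (cmod (J k - of_real S)) \<le> (\<integral>\<^sup>+u. ennreal (std_normal_density u * D (e k * u)) \<partial>lborel)"
      unfolding J_def S_def D_def using Gaussian_average_bound[OF f f2 e] by auto
  qed auto
  then have "(\<lambda>k. cmod (J k - of_real S)) \<longlonglongrightarrow> 0"
    by (simp add: tendsto_ennreal_iff flip: ennreal_0)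
  then have J: "J \<longlonglongrightarrow> of_real S" by (simp add: LIM_zero_iff tendsto_norm_zero_iff)
  define R where "R = (\<lambda>k. LINT w|lborel. exp (- (e k * w)\<^sup>2 / 2) * (cmod (fourier_integral f w))\<^sup>2)"
  have RJ: "complex_of_real (R k) = 2 * pi * J k" for k
    unfolding R_def J_def integral_complex_of_real[symmetric]
    by (rule Gaussian_regularised_Plancherel(1)[OF f e])
  have "(\<lambda>k. Re (2 * pi * J k)) \<longlonglongrightarrow> Re (complex_of_real (2 * pi) * complex_of_real S)"
    by (intro tendsto_intros J)
  moreover have "Re (2 * pi * J k) = R k" for k
    unfolding RJ[symmetric] by (rule Re_complex_of_real)
  ultimately have "R \<longlonglongrightarrow> Re (complex_of_real (2 * pi) * complex_of_real S)" by (simp only:)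
  then have R: "R \<longlonglongrightarrow> 2 * pi * S" by simp
  have nnR: "(\<integral>\<^sup>+w. ennreal (exp (- (e k * w)\<^sup>2 / 2) * (cmod (fourier_integral f w))\<^sup>2) \<partial>lborel) = ennreal (R k)" for k
    unfolding R_def by (rule nn_integral_eq_integral[OF Gaussian_regularised_Plancherel(2)[OF f e]]) auto
  have edec: "e (Suc k) \<le> e k" for k unfolding e_def by (intro divide_left_mono) auto
  have "(\<lambda>k. \<integral>\<^sup>+w. ennreal (exp (- (e k * w)\<^sup>2 / 2) * (cmod (fourier_integral f w))\<^sup>2) \<partial>lborel) \<longlonglongrightarrow>
    (\<integral>\<^sup>+w. ennreal ((cmod (fourier_integral f w))\<^sup>2) \<partial>lborel)"
  proof (rule nn_integral_LIMSEQ)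
    show "incseq (\<lambda>k w. ennreal (exp (- (e k * w)\<^sup>2 / 2) * (cmod (fourier_integral f w))\<^sup>2))"
    proof (rule incseq_SucI, rule le_funI)
      fix k w
      have "(e (Suc k) * w)\<^sup>2 \<le> (e k * w)\<^sup>2"
        unfolding power_mult_distrib using edec[of k] e[of "Suc k"]
        by (intro mult_right_mono power_mono) auto
      then show "ennreal (exp (- (e k * w)\<^sup>2 / 2) * (cmod (fourier_integral f w))\<^sup>2) \<le> ennreal (exp (- (e (Suc k) * w)\<^sup>2 / 2) * (cmod (fourier_integral f w))\<^sup>2)"
        by (intro ennreal_leI mult_right_mono) auto
    qed
    fix w
    have "(\<lambda>k. exp (- (e k * w)\<^sup>2 / 2) * (cmod (fourier_integral f w))\<^sup>2) \<longlonglongrightarrow> exp (- (0 * w)\<^sup>2 / 2) * (cmod (fourier_integral f w))\<^sup>2"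
      by (intro tendsto_intros e0) simp
    then show "(\<lambda>k. ennreal (exp (- (e k * w)\<^sup>2 / 2) * (cmod (fourier_integral f w))\<^sup>2)) \<longlonglongrightarrow> ennreal ((cmod (fourier_integral f w))\<^sup>2)"
      by (intro tendsto_ennrealI) simp
  qed measurable
  moreover have "(\<lambda>k. ennreal (R k)) \<longlonglongrightarrow> ennreal (2 * pi * S)" by (rule tendsto_ennrealI[OF R])
  ultimately show ?thesis unfolding nnR S_def[symmetric] by (rule LIMSEQ_unique)
qed


section \<open>The Fourier transform on \<open>L\<^sup>2\<close>\<close>

definition inverse_fourier :: "(real \<Rightarrow> complex) \<Rightarrow> real \<Rightarrow> complex" where
  "inverse_fourier g x = (LINT t|lborel. g t * exp (\<i> * complex_of_real x * complex_of_real t)) / (2 * pi)"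

lemma inverse_fourier_eq: "inverse_fourier g x = fourier_integral g (- x) / (2 * pi)"
  unfolding inverse_fourier_def fourier_integral_def by (simp add: ac_simps)

lemma inverse_fourier_measurable [measurable (raw)]:
  assumes [measurable]: "g \<in> borel_measurable borel" "h \<in> borel_measurable M"
  shows "(\<lambda>x. inverse_fourier g (h x)) \<in> borel_measurable M"
  unfolding inverse_fourier_eq by measurable

lemma L2_D:
  assumes "f \<in> L2"
  shows "f \<in> borel_measurable borel" "integrable lborel (\<lambda>x. (cmod (f x))\<^sup>2)"
  using assms by (auto simp: L2_def)

lemma L2_I:
  assumes "f \<in> borel_measurable borel" "integrable lborel (\<lambda>x. (cmod (f x))\<^sup>2)"
  shows "f \<in> L2"
  using assms by (auto simp: L2_def)

lemma L2_I_finite: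
  assumes [measurable]: "f \<in> borel_measurable borel" and fin: "(\<integral>\<^sup>+x. ennreal ((cmod (f x))\<^sup>2) \<partial>lborel) < \<infinity>"
  shows "f \<in> L2"
  using fin by (intro L2_I integrableI_bounded) auto

text \<open>The Cauchy--Schwarz inequality.\<close>

lemma L2_mult_bounds:
  assumes u: "u \<in> L2" and v: "v \<in> L2"
  shows "integrable lborel (\<lambda>x. cmod (u x) * cmod (v x))"
    and "(LINT x|lborel. cmod (u x) * cmod (v x)) \<le>
      sqrt (LINT x|lborel. (cmod (u x))\<^sup>2) * sqrt (LINT x|lborel. (cmod (v x))\<^sup>2)"
proof -
  note [measurable] = L2_D(1)[OF u] L2_D(1)[OF v]
  have le: "cmod (u x) * cmod (v x) \<le> (cmod (u x))\<^sup>2 + (cmod (v x))\<^sup>2" for x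
    using zero_le_power2[of "cmod (u x) - cmod (v x)"] by (simp add: power2_eq_square algebra_simps) (smt (verit) mult_nonneg_nonneg norm_ge_zero)
  show i: "integrable lborel (\<lambda>x. cmod (u x) * cmod (v x))"
    by (rule Bochner_Integration.integrable_bound[where f="\<lambda>x. (cmod (u x))\<^sup>2 + (cmod (v x))\<^sup>2"])
       (use L2_D(2)[OF u] L2_D(2)[OF v] order_trans[OF le abs_ge_self] in auto)
  have "(\<integral>\<^sup>+x. ennreal (cmod (u x)) * ennreal (cmod (v x)) \<partial>lborel)\<^sup>2 \<le>
    (\<integral>\<^sup>+x. (ennreal (cmod (u x)))\<^sup>2 \<partial>lborel) * (\<integral>\<^sup>+x. (ennreal (cmod (v x)))\<^sup>2 \<partial>lborel)"
    by (rule Cauchy_Schwarz_nn_integral) auto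
  moreover have "(\<integral>\<^sup>+x. (ennreal (cmod (u x)))\<^sup>2 \<partial>lborel) = ennreal (LINT x|lborel. (cmod (u x))\<^sup>2)"
    using nn_integral_eq_integral[OF L2_D(2)[OF u]] by (simp add: ennreal_power)
  moreover have "(\<integral>\<^sup>+x. (ennreal (cmod (v x)))\<^sup>2 \<partial>lborel) = ennreal (LINT x|lborel. (cmod (v x))\<^sup>2)"
    using nn_integral_eq_integral[OF L2_D(2)[OF v]] by (simp add: ennreal_power)
  moreover have "(\<integral>\<^sup>+x. ennreal (cmod (u x)) * ennreal (cmod (v x)) \<partial>lborel) = ennreal (LINT x|lborel. cmod (u x) * cmod (v x))"
    using nn_integral_eq_integral[OF i] by (simp add: ennreal_mult)
  ultimately have "(LINT x|lborel. cmod (u x) * cmod (v x))\<^sup>2 \<le> (LINT x|lborel. (cmod (u x))\<^sup>2) * (LINT x|lborel. (cmod (v x))\<^sup>2)"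
    by (simp add: ennreal_power ennreal_mult[symmetric])
  then show "(LINT x|lborel. cmod (u x) * cmod (v x)) \<le>
      sqrt (LINT x|lborel. (cmod (u x))\<^sup>2) * sqrt (LINT x|lborel. (cmod (v x))\<^sup>2)"
    unfolding real_sqrt_mult[symmetric] by (rule real_le_rsqrt)
qed

lemma integrable_L2_mult_cnj:
  assumes "u \<in> L2" and "v \<in> L2"
  shows "integrable lborel (\<lambda>x. u x * cnj (v x))"
  using L2_mult_bounds(1)[OF assms] L2_D(1)[OF assms(1)] L2_D(1)[OF assms(2)]
  by (rule_tac Bochner_Integration.integrable_bound) (auto simp: norm_mult)

lemma L2_diff:
  assumes u: "u \<in> L2" and v: "v \<in> L2"
  shows "(\<lambda>x. u x - v x) \<in> L2"
proof (rule L2_I)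
  note [measurable] = L2_D(1)[OF u] L2_D(1)[OF v]
  show "(\<lambda>x. u x - v x) \<in> borel_measurable borel" by simp
  have le: "(cmod (u x - v x))\<^sup>2 \<le> 2 * (cmod (u x))\<^sup>2 + 2 * (cmod (v x))\<^sup>2" for x
    by (rule cmod_diff_square_le)
  show "integrable lborel (\<lambda>x. (cmod (u x - v x))\<^sup>2)"
    by (rule Bochner_Integration.integrable_bound[where f="\<lambda>x. 2 * (cmod (u x))\<^sup>2 + 2 * (cmod (v x))\<^sup>2"])
       (use L2_D(2)[OF u] L2_D(2)[OF v] order_trans[OF le abs_ge_self] in auto)
qed

definition truncation :: "real \<Rightarrow> (real \<Rightarrow> complex) \<Rightarrow> real \<Rightarrow> complex" where
  "truncation R f x = (if x \<in> {-R..R} then f x else 0)"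

lemma truncation_L1_L2:
  assumes f: "f \<in> L2"
  shows "integrable lborel (truncation R f)" "truncation R f \<in> L2"
proof -
  note [measurable] = L2_D(1)[OF f]
  show "truncation R f \<in> L2"
  proof (rule L2_I)
    show "integrable lborel (\<lambda>x. (cmod (truncation R f x))\<^sup>2)"
      by (rule Bochner_Integration.integrable_bound[OF L2_D(2)[OF f]]) (auto simp: truncation_def)
  qed (simp add: truncation_def[abs_def])
  have le: "cmod (f x) \<le> 1 + (cmod (f x))\<^sup>2" for x
    using zero_le_power2[of "cmod (f x) - 1"] norm_ge_zero[of "f x"]
    unfolding power2_diff one_power2 mult_1_right by linarith
  have ind: "integrable lborel (indicator {-R..R} :: real \<Rightarrow> real)"
    by (rule integrable_real_indicator) (auto simp: emeasure_lborel_Icc_eq)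
  show "integrable lborel (truncation R f)"
  proof (rule Bochner_Integration.integrable_bound[where f="\<lambda>x. indicator {-R..R} x + (cmod (f x))\<^sup>2"])
    show "AE x in lborel. norm (truncation R f x) \<le> norm (indicator {- R..R} x + (cmod (f x))\<^sup>2)"
      using le by (auto simp: truncation_def indicator_def)
  qed (use L2_D(2)[OF f] ind in \<open>auto simp: truncation_def[abs_def] intro!: Bochner_Integration.integrable_add\<close>)
qed

lemma fourier_integral_L2:
  assumes "integrable lborel f" "f \<in> L2"
  shows "fourier_integral f \<in> L2"
    and "(LINT w|lborel. (cmod (fourier_integral f w))\<^sup>2) = 2 * pi * (LINT x|lborel. (cmod (f x))\<^sup>2)"
proof -
  note [measurable] = L2_D(1)[OF assms(2)]
  show *: "fourier_integral f \<in> L2"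
    by (rule L2_I_finite) (use Plancherel_L1_L2[OF assms(1) L2_D(2)[OF assms(2)]] in \<open>auto intro: fourier_integral_measurable\<close>)
  show "(LINT w|lborel. (cmod (fourier_integral f w))\<^sup>2) = 2 * pi * (LINT x|lborel. (cmod (f x))\<^sup>2)"
    using Plancherel_L1_L2[OF assms(1) L2_D(2)[OF assms(2)]] nn_integral_eq_integral[OF L2_D(2)[OF *]]
    by simp
qed

lemma inverse_fourier_L2:
  assumes g: "integrable lborel g" "g \<in> L2"
  shows "inverse_fourier g \<in> L2"
    and "2 * pi * (LINT x|lborel. (cmod (inverse_fourier g x))\<^sup>2) = (LINT w|lborel. (cmod (g w))\<^sup>2)"
proof -
  note [measurable] = L2_D(1)[OF g(2)]
  note F = fourier_integral_L2[OF g]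
  have eq: "(cmod (inverse_fourier g x))\<^sup>2 = (cmod (fourier_integral g (0 + (-1) * x)))\<^sup>2 / (2 * pi)\<^sup>2" for x
    by (simp add: inverse_fourier_eq norm_divide power_divide norm_mult)
  show "inverse_fourier g \<in> L2"
  proof (rule L2_I)
    show "integrable lborel (\<lambda>x. (cmod (inverse_fourier g x))\<^sup>2)"
      unfolding eq by (intro integrable_divide_zero impI lborel_integrable_real_affine[where f="\<lambda>x. (cmod (fourier_integral g x))\<^sup>2"] L2_D F) simp
  qed (auto intro: inverse_fourier_measurable)
  have "(LINT x|lborel. (cmod (inverse_fourier g x))\<^sup>2) = (LINT x|lborel. (cmod (fourier_integral g (0 + (-1) * x)))\<^sup>2) / (2 * pi)\<^sup>2"
    unfolding eq by (rule integral_divide_zero)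
  also have "(LINT x|lborel. (cmod (fourier_integral g (0 + (-1) * x)))\<^sup>2) = (LINT x|lborel. (cmod (fourier_integral g x))\<^sup>2)"
    using lborel_integral_real_affine[of "-1" "\<lambda>x. (cmod (fourier_integral g x))\<^sup>2" 0] by simp
  finally show "2 * pi * (LINT x|lborel. (cmod (inverse_fourier g x))\<^sup>2) = (LINT w|lborel. (cmod (g w))\<^sup>2)"
    unfolding F by (simp add: power2_eq_square)
qed

text \<open>The transform and its inverse are adjoint to each other, by Fubini's theorem.\<close>

lemma fourier_integral_pairing:
  assumes f: "integrable lborel f" and g: "integrable lborel g"
  shows "(LINT x|lborel. f x * cnj (inverse_fourier g x)) =
     (LINT t|lborel. fourier_integral f t * cnj (g t)) / (2 * pi)"
proof -
  have cg: "integrable lborel (\<lambda>t. cnj (g t))" using g by simp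
  have c: "cnj (inverse_fourier g x) = (LINT t|lborel. cnj (g t) * exp (- \<i> * of_real x * of_real t)) / (2 * pi)" for x
    unfolding inverse_fourier_def complex_cnj_divide
    by (subst Bochner_Integration.integral_cnj[symmetric]) (simp add: exp_cnj)
  have "(LINT x|lborel. f x * cnj (inverse_fourier g x)) = (LINT x|lborel. f x * (LINT t|lborel. cnj (g t) * exp (- \<i> * of_real x * of_real t)) / (2 * pi))"
    unfolding c by simp
  also have "\<dots> = (LINT x|lborel. f x * (LINT t|lborel. cnj (g t) * exp (- \<i> * of_real x * of_real t))) / (2 * pi)"
    by (rule integral_divide_zero)
  also have "(LINT x|lborel. f x * (LINT t|lborel. cnj (g t) * exp (- \<i> * of_real x * of_real t))) =
    (LINT t|lborel. cnj (g t) * (LINT x|lborel. f x * exp (- \<i> * of_real x * of_real t)))"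
    by (rule integral_swap_bounded_kernel(2)[OF f cg, where C=1]) auto
  finally show ?thesis unfolding fourier_integral_def by (simp add: mult.commute)
qed


lemma has_L2_fourier_truncation:
  "has_L2_fourier f g \<longleftrightarrow> f \<in> L2 \<and> g \<in> L2 \<and>
     ((\<lambda>R. \<integral>\<^sup>+ w. ennreal ((cmod (fourier_integral (truncation R f) w - g w))\<^sup>2) \<partial>lborel) \<longlongrightarrow> 0) at_top"
  unfolding has_L2_fourier_def truncation_def[abs_def] ..

lemma has_L2_fourier_real_limit:
  assumes f: "f \<in> L2" and g: "g \<in> L2"
  shows "((\<lambda>R. \<integral>\<^sup>+ w. ennreal ((cmod (fourier_integral (truncation R f) w - g w))\<^sup>2) \<partial>lborel) \<longlongrightarrow> 0) F
    \<longleftrightarrow> ((\<lambda>R. LINT w|lborel. (cmod (fourier_integral (truncation R f) w - g w))\<^sup>2) \<longlongrightarrow> 0) F"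
proof -
  have "(\<integral>\<^sup>+ w. ennreal ((cmod (fourier_integral (truncation R f) w - g w))\<^sup>2) \<partial>lborel) =
    ennreal (LINT w|lborel. (cmod (fourier_integral (truncation R f) w - g w))\<^sup>2)" for R
    by (intro nn_integral_eq_integral L2_D L2_diff fourier_integral_L2(1) truncation_L1_L2 f g) simp
  then show ?thesis by (simp add: tendsto_ennreal_iff flip: ennreal_0)
qed

lemma truncation_tendsto:
  assumes f: "f \<in> L2"
  shows "((\<lambda>R. LINT x|lborel. (cmod (truncation R f x))\<^sup>2) \<longlongrightarrow> (LINT x|lborel. (cmod (f x))\<^sup>2)) at_top"
proof (rule integral_dominated_convergence_at_top[where w="\<lambda>x. (cmod (f x))\<^sup>2"])
  note [measurable] = L2_D(1)[OF f]
  show "AE x in lborel. ((\<lambda>R. (cmod (truncation R f x))\<^sup>2) \<longlongrightarrow> (cmod (f x))\<^sup>2) at_top"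
  proof (intro AE_I2 tendsto_eventually)
    fix x
    show "\<forall>\<^sub>F R in at_top. (cmod (truncation R f x))\<^sup>2 = (cmod (f x))\<^sup>2"
      using eventually_ge_at_top[of "\<bar>x\<bar>"] by eventually_elim (auto simp: truncation_def)
  qed
  show "(\<lambda>x. (cmod (truncation R f x))\<^sup>2) \<in> borel_measurable lborel" for R
    by (simp add: truncation_def[abs_def])
  show "\<forall>\<^sub>F R in at_top. AE x in lborel. norm ((cmod (truncation R f x))\<^sup>2) \<le> (cmod (f x))\<^sup>2"
    by (intro always_eventually allI AE_I2) (simp add: truncation_def)
qed (use L2_D[OF f] in auto)

lemma L2_norm_tendsto:
  fixes u :: "real \<Rightarrow> real \<Rightarrow> complex"
  assumes u: "\<And>R. u R \<in> L2" and g: "g \<in> L2"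
    and lim: "((\<lambda>R. LINT w|lborel. (cmod (u R w - g w))\<^sup>2) \<longlongrightarrow> 0) F"
  shows "((\<lambda>R. LINT w|lborel. (cmod (u R w))\<^sup>2) \<longlongrightarrow> (LINT w|lborel. (cmod (g w))\<^sup>2)) F"
proof (rule LIM_zero_cancel, rule Lim_null_comparison)
  define E where "E = (\<lambda>R. LINT w|lborel. (cmod (u R w - g w))\<^sup>2)"
  define N where "N = sqrt (LINT w|lborel. (cmod (g w))\<^sup>2)"
  show "\<forall>\<^sub>F R in F. norm ((LINT w|lborel. (cmod (u R w))\<^sup>2) - (LINT w|lborel. (cmod (g w))\<^sup>2)) \<le> E R + 2 * (sqrt (E R) * N)"
  proof (intro always_eventually allI)
    fix R
    note d = L2_diff[OF u[of R] g]
    have le: "norm ((cmod (u R w))\<^sup>2 - (cmod (g w))\<^sup>2) \<le> (cmod (u R w - g w))\<^sup>2 + 2 * (cmod (u R w - g w) * cmod (g w))" for w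
    proof -
      define a b c where "a = cmod (u R w)" and "b = cmod (g w)" and "c = cmod (u R w - g w)"
      have abc: "\<bar>a - b\<bar> \<le> c" "0 \<le> a" "0 \<le> b" "0 \<le> c" unfolding a_def b_def c_def by (auto intro: norm_triangle_ineq3)
      have "norm (a\<^sup>2 - b\<^sup>2) = \<bar>a - b\<bar> * (a + b)" using abc by (simp add: power2_eq_square square_diff_square_factored abs_mult mult.commute)
      also have "\<dots> \<le> c * (c + 2 * b)" using abc by (intro mult_mono) auto
      finally show ?thesis unfolding a_def b_def c_def by (simp add: power2_eq_square algebra_simps)
    qed
    have "norm ((LINT w|lborel. (cmod (u R w))\<^sup>2) - (LINT w|lborel. (cmod (g w))\<^sup>2)) = norm (LINT w|lborel. (cmod (u R w))\<^sup>2 - (cmod (g w))\<^sup>2)"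
      using L2_D(2)[OF u[of R]] L2_D(2)[OF g] by simp
    also have "\<dots> \<le> (LINT w|lborel. norm ((cmod (u R w))\<^sup>2 - (cmod (g w))\<^sup>2))" by (rule integral_norm_bound)
    also have "\<dots> \<le> (LINT w|lborel. (cmod (u R w - g w))\<^sup>2 + 2 * (cmod (u R w - g w) * cmod (g w)))"
      using L2_D(2)[OF u[of R]] L2_D(2)[OF g] L2_D(2)[OF d] L2_mult_bounds(1)[OF d g] le
      by (intro integral_mono) auto
    also have "\<dots> = E R + 2 * (LINT w|lborel. cmod (u R w - g w) * cmod (g w))"
      unfolding E_def using L2_D(2)[OF d] L2_mult_bounds(1)[OF d g] by simp
    also have "\<dots> \<le> E R + 2 * (sqrt (E R) * N)"
      unfolding E_def N_def using L2_mult_bounds(2)[OF d g] by simp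
    finally show "norm ((LINT w|lborel. (cmod (u R w))\<^sup>2) - (LINT w|lborel. (cmod (g w))\<^sup>2)) \<le> E R + 2 * (sqrt (E R) * N)" .
  qed
  have "((\<lambda>R. E R + 2 * (sqrt (E R) * N)) \<longlongrightarrow> 0 + 2 * (sqrt 0 * N)) F"
    unfolding E_def by (intro tendsto_intros lim)
  then show "((\<lambda>R. E R + 2 * (sqrt (E R) * N)) \<longlongrightarrow> 0) F" by simp
qed

lemma L2_pairing_tendsto:
  fixes u :: "real \<Rightarrow> real \<Rightarrow> complex"
  assumes u: "\<And>R. u R \<in> L2" and g: "g \<in> L2" and v: "v \<in> L2"
    and lim: "((\<lambda>R. LINT w|lborel. (cmod (u R w - g w))\<^sup>2) \<longlongrightarrow> 0) F"
  shows "((\<lambda>R. LINT w|lborel. u R w * cnj (v w)) \<longlongrightarrow> (LINT w|lborel. g w * cnj (v w))) F"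
proof (rule LIM_zero_cancel, rule Lim_null_comparison)
  define E where "E = (\<lambda>R. LINT w|lborel. (cmod (u R w - g w))\<^sup>2)"
  define N where "N = sqrt (LINT w|lborel. (cmod (v w))\<^sup>2)"
  have int: "integrable lborel (\<lambda>w. h w * cnj (v w))" if "h \<in> L2" for h
    by (rule integrable_L2_mult_cnj[OF that v])
  show "\<forall>\<^sub>F R in F. norm ((LINT w|lborel. u R w * cnj (v w)) - (LINT w|lborel. g w * cnj (v w))) \<le> sqrt (E R) * N"
  proof (intro always_eventually allI)
    fix R
    note d = L2_diff[OF u[of R] g]
    have "norm ((LINT w|lborel. u R w * cnj (v w)) - (LINT w|lborel. g w * cnj (v w))) = norm (LINT w|lborel. (u R w - g w) * cnj (v w))"
      using int[OF u[of R]] int[OF g] by (simp add: left_diff_distrib)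
    also have "\<dots> \<le> (LINT w|lborel. norm ((u R w - g w) * cnj (v w)))" by (rule integral_norm_bound)
    also have "\<dots> = (LINT w|lborel. cmod (u R w - g w) * cmod (v w))" by (simp add: norm_mult)
    also have "\<dots> \<le> sqrt (E R) * N" unfolding E_def N_def by (rule L2_mult_bounds(2)[OF d v])
    finally show "norm ((LINT w|lborel. u R w * cnj (v w)) - (LINT w|lborel. g w * cnj (v w))) \<le> sqrt (E R) * N" .
  qed
  have "((\<lambda>R. sqrt (E R) * N) \<longlongrightarrow> sqrt 0 * N) F"
    unfolding E_def by (intro tendsto_intros lim)
  then show "((\<lambda>R. sqrt (E R) * N) \<longlongrightarrow> 0) F" by simp
qed

theorem Plancherel:
  assumes "has_L2_fourier f g"
  shows "(LINT w|lborel. (cmod (g w))\<^sup>2) = 2 * pi * (LINT x|lborel. (cmod (f x))\<^sup>2)"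
proof (rule tendsto_unique)
  have f: "f \<in> L2" and g: "g \<in> L2" using assms by (auto simp: has_L2_fourier_def)
  have lim: "((\<lambda>R. LINT w|lborel. (cmod (fourier_integral (truncation R f) w - g w))\<^sup>2) \<longlongrightarrow> 0) at_top"
    using assms has_L2_fourier_real_limit[OF f g] unfolding has_L2_fourier_truncation by simp
  show "((\<lambda>R. LINT w|lborel. (cmod (fourier_integral (truncation R f) w))\<^sup>2) \<longlongrightarrow> (LINT w|lborel. (cmod (g w))\<^sup>2)) at_top"
    by (rule L2_norm_tendsto[OF _ g lim]) (intro fourier_integral_L2(1) truncation_L1_L2 f)
  show "((\<lambda>R. LINT w|lborel. (cmod (fourier_integral (truncation R f) w))\<^sup>2) \<longlongrightarrow> 2 * pi * (LINT x|lborel. (cmod (f x))\<^sup>2)) at_top"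
    unfolding fourier_integral_L2(2)[OF truncation_L1_L2[OF f]] by (intro tendsto_intros truncation_tendsto f)
qed simp

text \<open>Parseval's identity against a function whose transform is integrable.\<close>

lemma has_L2_fourier_pairing:
  assumes fg: "has_L2_fourier f g" and h: "integrable lborel h" "h \<in> L2"
  shows "(LINT x|lborel. f x * cnj (inverse_fourier h x)) = (LINT w|lborel. g w * cnj (h w)) / (2 * pi)"
proof (rule tendsto_unique)
  have f: "f \<in> L2" and g: "g \<in> L2" using fg by (auto simp: has_L2_fourier_def)
  note [measurable] = L2_D(1)[OF f] L2_D(1)[OF h(2)]
  have lim: "((\<lambda>R. LINT w|lborel. (cmod (fourier_integral (truncation R f) w - g w))\<^sup>2) \<longlongrightarrow> 0) at_top"
    using fg has_L2_fourier_real_limit[OF f g] unfolding has_L2_fourier_truncation by simp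
  have "((\<lambda>R. LINT w|lborel. fourier_integral (truncation R f) w * cnj (h w)) \<longlongrightarrow> (LINT w|lborel. g w * cnj (h w))) at_top"
    by (rule L2_pairing_tendsto[OF _ g h(2) lim]) (intro fourier_integral_L2(1) truncation_L1_L2 f)
  then show "((\<lambda>R. LINT x|lborel. truncation R f x * cnj (inverse_fourier h x)) \<longlongrightarrow> (LINT w|lborel. g w * cnj (h w)) / (2 * pi)) at_top"
    unfolding fourier_integral_pairing[OF truncation_L1_L2(1)[OF f] h(1)] by (intro tendsto_intros) auto
  show "((\<lambda>R. LINT x|lborel. truncation R f x * cnj (inverse_fourier h x)) \<longlongrightarrow> (LINT x|lborel. f x * cnj (inverse_fourier h x))) at_top"
  proof (rule integral_dominated_convergence_at_top[where w="\<lambda>x. cmod (f x) * cmod (inverse_fourier h x)"])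
    show "AE x in lborel. ((\<lambda>R. truncation R f x * cnj (inverse_fourier h x)) \<longlongrightarrow> f x * cnj (inverse_fourier h x)) at_top"
    proof (intro AE_I2 tendsto_eventually)
      fix x
      show "\<forall>\<^sub>F R in at_top. truncation R f x * cnj (inverse_fourier h x) = f x * cnj (inverse_fourier h x)"
        using eventually_ge_at_top[of "\<bar>x\<bar>"] by eventually_elim (auto simp: truncation_def)
    qed
    show "(\<lambda>x. truncation R f x * cnj (inverse_fourier h x)) \<in> borel_measurable lborel" for R
      unfolding truncation_def[abs_def] by measurable
    show "\<forall>\<^sub>F R in at_top. AE x in lborel. norm (truncation R f x * cnj (inverse_fourier h x)) \<le> cmod (f x) * cmod (inverse_fourier h x)"
      by (intro always_eventually allI AE_I2) (simp add: truncation_def norm_mult)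
    show "integrable lborel (\<lambda>x. cmod (f x) * cmod (inverse_fourier h x))"
      by (intro L2_mult_bounds(1) f inverse_fourier_L2 h)
  qed measurable
qed simp

text \<open>Let \<open>f\<close> be the inverse transform of \<open>h\<close> and \<open>u\<close> its truncation. By duality the mixed term in the
expansion of the squared distance of the transform of \<open>u\<close> from \<open>h\<close> is \<open>2 * pi\<close> times the squared norm
of \<open>u\<close>. Hence that squared distance equals \<open>2 * pi\<close> times the mass of \<open>\<bar>f\<bar>\<^sup>2\<close> cut off by the
truncation, which vanishes in the limit.\<close>

lemma has_L2_fourier_inverse:
  assumes h: "integrable lborel h" "h \<in> L2"
  shows "has_L2_fourier (inverse_fourier h) h"
proof -
  define f where "f = inverse_fourier h"
  have f: "f \<in> L2" unfolding f_def by (rule inverse_fourier_L2[OF h])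
  have "(LINT w|lborel. (cmod (fourier_integral (truncation R f) w - h w))\<^sup>2) =
    2 * pi * (LINT x|lborel. (cmod (f x))\<^sup>2) - 2 * pi * (LINT x|lborel. (cmod (truncation R f x))\<^sup>2)" for R
  proof -
    define u where "u = truncation R f"
    have u: "integrable lborel u" "u \<in> L2" unfolding u_def by (rule truncation_L1_L2[OF f])+
    define U where "U = fourier_integral u"
    have U: "U \<in> L2" "(LINT w|lborel. (cmod (U w))\<^sup>2) = 2 * pi * (LINT x|lborel. (cmod (u x))\<^sup>2)"
      unfolding U_def by (rule fourier_integral_L2[OF u])+
    have Uh: "integrable lborel (\<lambda>w. U w * cnj (h w))"
      by (rule integrable_L2_mult_cnj[OF U(1) h(2)])
    have "u x * cnj (f x) = complex_of_real ((cmod (u x))\<^sup>2)" for x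
      unfolding complex_norm_square by (simp add: u_def truncation_def)
    then have "(LINT x|lborel. u x * cnj (f x)) = complex_of_real (LINT x|lborel. (cmod (u x))\<^sup>2)"
      by (simp only: integral_complex_of_real)
    then have "(LINT w|lborel. U w * cnj (h w)) = complex_of_real (2 * pi * (LINT x|lborel. (cmod (u x))\<^sup>2))"
      using fourier_integral_pairing[OF u(1) h(1)] unfolding f_def U_def by (simp add: field_simps)
    then have re: "(LINT w|lborel. Re (U w * cnj (h w))) = 2 * pi * (LINT x|lborel. (cmod (u x))\<^sup>2)"
      using integral_Re[OF Uh] by simp
    define V where "V = (\<lambda>w. Re (U w * cnj (h w)))"
    have V: "integrable lborel V" unfolding V_def by (rule integrable_Re[OF Uh])
    have "(cmod (U w - h w))\<^sup>2 = (cmod (U w))\<^sup>2 - 2 * V w + (cmod (h w))\<^sup>2" for w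
      unfolding cmod_power2 V_def by (simp add: power2_eq_square algebra_simps)
    then have "(LINT w|lborel. (cmod (U w - h w))\<^sup>2) = (LINT w|lborel. (cmod (U w))\<^sup>2) - 2 * (LINT w|lborel. V w) + (LINT w|lborel. (cmod (h w))\<^sup>2)"
      using L2_D(2)[OF U(1)] L2_D(2)[OF h(2)] V by simp
    then show ?thesis
      unfolding V_def re U(2) f_def inverse_fourier_L2(2)[OF h] by (simp add: U_def u_def f_def)
  qed
  moreover have "((\<lambda>R. 2 * pi * (LINT x|lborel. (cmod (f x))\<^sup>2) - 2 * pi * (LINT x|lborel. (cmod (truncation R f x))\<^sup>2)) \<longlongrightarrow>
     2 * pi * (LINT x|lborel. (cmod (f x))\<^sup>2) - 2 * pi * (LINT x|lborel. (cmod (f x))\<^sup>2)) at_top"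
    by (intro tendsto_intros truncation_tendsto f)
  ultimately have "((\<lambda>R. LINT w|lborel. (cmod (fourier_integral (truncation R f) w - h w))\<^sup>2) \<longlongrightarrow> 0) at_top"
    by simp
  then show ?thesis
    using has_L2_fourier_real_limit[OF f h(2)] f h(2) unfolding has_L2_fourier_truncation f_def by simp
qed

lemma has_L2_fourier_diff:
  assumes 1: "has_L2_fourier f1 g1" and 2: "has_L2_fourier f2 g2"
  shows "has_L2_fourier (\<lambda>x. f1 x - f2 x) (\<lambda>x. g1 x - g2 x)"
proof -
  have f: "f1 \<in> L2" "f2 \<in> L2" and g: "g1 \<in> L2" "g2 \<in> L2" using assms by (auto simp: has_L2_fourier_def)
  note fd = L2_diff[OF f] and gd = L2_diff[OF g]
  define E1 where "E1 = (\<lambda>R. LINT w|lborel. (cmod (fourier_integral (truncation R f1) w - g1 w))\<^sup>2)"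
  define E2 where "E2 = (\<lambda>R. LINT w|lborel. (cmod (fourier_integral (truncation R f2) w - g2 w))\<^sup>2)"
  have lim: "(E1 \<longlongrightarrow> 0) at_top" "(E2 \<longlongrightarrow> 0) at_top"
    unfolding E1_def E2_def
    using assms has_L2_fourier_real_limit[OF f(1) g(1)] has_L2_fourier_real_limit[OF f(2) g(2)] unfolding has_L2_fourier_truncation by auto
  have "((\<lambda>R. LINT w|lborel. (cmod (fourier_integral (truncation R (\<lambda>x. f1 x - f2 x)) w - (g1 w - g2 w)))\<^sup>2) \<longlongrightarrow> 0) at_top"
  proof (rule Lim_null_comparison)
    show "\<forall>\<^sub>F R in at_top. norm (LINT w|lborel. (cmod (fourier_integral (truncation R (\<lambda>x. f1 x - f2 x)) w - (g1 w - g2 w)))\<^sup>2) \<le> 2 * E1 R + 2 * E2 R"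
    proof (intro always_eventually allI)
      fix R
      define a where "a = (\<lambda>w. fourier_integral (truncation R f1) w - g1 w)"
      define b where "b = (\<lambda>w. fourier_integral (truncation R f2) w - g2 w)"
      have a: "a \<in> L2" unfolding a_def by (intro L2_diff fourier_integral_L2(1) truncation_L1_L2 f g)
      have b: "b \<in> L2" unfolding b_def by (intro L2_diff fourier_integral_L2(1) truncation_L1_L2 f g)
      have i: "integrable lborel (\<lambda>x. truncation R f x * exp (- \<i> * complex_of_real x * complex_of_real w))" if "f \<in> L2" for f w
        by (rule Bochner_Integration.integrable_bound[OF truncation_L1_L2(1)[OF that, of R]])
           (use L2_D(1)[OF truncation_L1_L2(2)[OF that, of R]] in \<open>auto simp: norm_mult\<close>)
      have "truncation R (\<lambda>x. f1 x - f2 x) x = truncation R f1 x - truncation R f2 x" for x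
        by (simp add: truncation_def)
      then have "fourier_integral (truncation R (\<lambda>x. f1 x - f2 x)) w = fourier_integral (truncation R f1) w - fourier_integral (truncation R f2) w" for w
        unfolding fourier_integral_def using Bochner_Integration.integral_diff[OF i[OF f(1)] i[OF f(2)], of w w] by (simp add: left_diff_distrib)
      then have eq: "fourier_integral (truncation R (\<lambda>x. f1 x - f2 x)) w - (g1 w - g2 w) = a w - b w" for w
        by (simp add: a_def b_def)
      have le: "(cmod (a w - b w))\<^sup>2 \<le> 2 * (cmod (a w))\<^sup>2 + 2 * (cmod (b w))\<^sup>2" for w
        by (rule cmod_diff_square_le)
      have "(LINT w|lborel. (cmod (a w - b w))\<^sup>2) \<le> (LINT w|lborel. 2 * (cmod (a w))\<^sup>2 + 2 * (cmod (b w))\<^sup>2)"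
        using L2_D(2)[OF a] L2_D(2)[OF b] L2_D(2)[OF L2_diff[OF a b]] le by (intro integral_mono) auto
      also have "\<dots> = 2 * E1 R + 2 * E2 R"
        using L2_D(2)[OF a] L2_D(2)[OF b] by (simp add: E1_def E2_def a_def b_def)
      finally show "norm (LINT w|lborel. (cmod (fourier_integral (truncation R (\<lambda>x. f1 x - f2 x)) w - (g1 w - g2 w)))\<^sup>2) \<le> 2 * E1 R + 2 * E2 R"
        unfolding eq by simp
    qed
    have "((\<lambda>R. 2 * E1 R + 2 * E2 R) \<longlongrightarrow> 2 * 0 + 2 * 0) at_top" by (intro tendsto_intros lim)
    then show "((\<lambda>R. 2 * E1 R + 2 * E2 R) \<longlongrightarrow> 0) at_top" by simp
  qed
  then show ?thesis
    using has_L2_fourier_real_limit[OF fd gd] fd gd unfolding has_L2_fourier_truncation by simp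
qed

text \<open>The difference has transform zero, hence norm zero by Plancherel's formula.\<close>

lemma has_L2_fourier_unique:
  assumes 1: "has_L2_fourier f1 g" and 2: "has_L2_fourier f2 g"
  shows "AE x in lborel. f1 x = f2 x"
proof -
  note d = has_L2_fourier_diff[OF 1 2]
  have L: "(\<lambda>x. f1 x - f2 x) \<in> L2" using d by (simp add: has_L2_fourier_def)
  have "(LINT x|lborel. (cmod (f1 x - f2 x))\<^sup>2) = 0"
    using Plancherel[OF d] by simp
  then have "AE x in lborel. (cmod (f1 x - f2 x))\<^sup>2 = 0"
    by (subst (asm) integral_nonneg_eq_0_iff_AE[OF L2_D(2)[OF L]]) auto
  then show ?thesis by simp
qed

section \<open>Spectral integrals on the half plane and their energy\<close>

lemma power_div_fact_le_exp:
  fixes x :: real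
  assumes "x \<ge> 0"
  shows "x ^ n / fact n \<le> exp x"
proof -
  have "(\<Sum>n\<in>{n}. x ^ n /\<^sub>R fact n) \<le> (\<Sum>n. x ^ n /\<^sub>R fact n)"
    using assms by (intro sum_le_suminf summable_exp_generic) auto
  then show ?thesis by (simp add: exp_def divide_inverse mult.commute)
qed

lemma integrable_power_mult_exp:
  fixes b :: real
  assumes b: "b > 0"
  shows "integrable lborel (\<lambda>w. if w > 0 then w ^ n * exp (- (b * w)) else 0)"
proof -
  have "integrable lborel (erlang_density n b)"
    using nn_integral_erlang_ith_moment[OF b, of n 0] b
    by (intro integrableI_nonneg) auto
  then have "integrable lborel (\<lambda>w. fact n / b ^ Suc n * erlang_density n b w)" by simp
  then show ?thesis
  proof (rule Bochner_Integration.integrable_bound)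
    show "AE w in lborel. norm (if w > 0 then w ^ n * exp (- (b * w)) else 0) \<le> norm (fact n / b ^ Suc n * erlang_density n b w)"
      using b by (auto simp: erlang_density_def intro!: AE_I2)
  qed measurable
qed

text \<open>The rate \<open>1 / 2\<close> leaves room for polynomial factors next to \<open>exp (- u)\<close>.\<close>

definition decaying :: "(real \<Rightarrow> real) \<Rightarrow> bool" where
  "decaying m \<longleftrightarrow> m \<in> borel_measurable borel \<and> (\<exists>C. \<forall>u\<ge>0. \<bar>m u\<bar> \<le> C * exp (- u / 2))"

lemma decaying_measurable: "decaying m \<Longrightarrow> m \<in> borel_measurable borel"
  by (simp add: decaying_def)

lemma decaying_bound:
  assumes "decaying m"
  obtains C where "C \<ge> 0" "\<And>u. u \<ge> 0 \<Longrightarrow> \<bar>m u\<bar> \<le> C * exp (- u / 2)"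
proof -
  obtain C where C: "\<And>u. u \<ge> 0 \<Longrightarrow> \<bar>m u\<bar> \<le> C * exp (- u / 2)"
    using assms by (auto simp: decaying_def)
  show thesis
    by (rule that[of "\<bar>C\<bar>"]) (auto intro!: order_trans[OF C] mult_right_mono)
qed

text \<open>The common majorant of the integrands below for all \<open>s \<ge> b\<close>.\<close>

definition envelope :: "real \<Rightarrow> nat \<Rightarrow> real \<Rightarrow> real" where
  "envelope b k w = (if w > 0 then sqrt w * w ^ k * exp (- (b * w / 2)) else 0)"

lemma envelope_measurable [measurable]: "envelope b k \<in> borel_measurable borel"
  unfolding envelope_def[abs_def] by measurable

lemma envelope_nonneg: "envelope b k w \<ge> 0" by (simp add: envelope_def)

lemma envelope_square: "(envelope b k w)\<^sup>2 = (if w > 0 then w ^ (2 * k + 1) * exp (- (b * w)) else 0)"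
proof -
  have "(exp (- (b * w / 2)))\<^sup>2 = exp (- (b * w))"
    by (simp add: power2_eq_square exp_add[symmetric])
  then show ?thesis
    by (simp add: envelope_def power_mult_distrib power_mult[symmetric] power_add mult.commute)
qed

lemma envelope_mult:
  assumes g: "g \<in> L2" and b: "b > 0"
  shows "integrable lborel (\<lambda>w. envelope b k w * cmod (g w))"
    and "integrable lborel (\<lambda>w. (envelope b k w * cmod (g w))\<^sup>2)"
proof -
  note [measurable] = L2_D(1)[OF g]
  have "integrable lborel (\<lambda>w. (envelope b k w)\<^sup>2)"
    unfolding envelope_square by (rule integrable_power_mult_exp[OF b])
  then have "(\<lambda>w. complex_of_real (envelope b k w)) \<in> L2"
    by (intro L2_I) auto
  from L2_mult_bounds(1)[OF this g]
  show "integrable lborel (\<lambda>w. envelope b k w * cmod (g w))"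
    by (simp add: envelope_nonneg)
  define N where "N = 2 * k + 1"
  have le: "(envelope b k w)\<^sup>2 \<le> fact N / b ^ N" for w
  proof (cases "w > 0")
    case True
    have "(b * w) ^ N / fact N \<le> exp (b * w)"
      using b True by (intro power_div_fact_le_exp) simp
    then have "w ^ N \<le> fact N / b ^ N * exp (b * w)"
      using b by (simp add: power_mult_distrib field_simps)
    then show ?thesis using True unfolding envelope_square N_def[symmetric] by (simp add: exp_minus field_simps)
  qed (use b in \<open>simp add: envelope_square\<close>)
  have "integrable lborel (\<lambda>w. fact N / b ^ N * (cmod (g w))\<^sup>2)"
    using L2_D(2)[OF g] by simp
  moreover have "(envelope b k w * cmod (g w))\<^sup>2 \<le> fact N / b ^ N * (cmod (g w))\<^sup>2" for w
    unfolding power_mult_distrib by (intro mult_right_mono le) simp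
  ultimately show "integrable lborel (\<lambda>w. (envelope b k w * cmod (g w))\<^sup>2)"
    by (rule_tac Bochner_Integration.integrable_bound) (use b in auto)
qed

text \<open>Differentiating in \<open>x\<close> or in \<open>s\<close> brings down a factor \<open>w\<close>; the index \<open>k\<close> counts these factors, so that
the family is closed under both derivatives. The function \<open>G\<close> of the introduction is the \<open>wave\<close> with
\<open>k = 0\<close>.\<close>

definition spectrum :: "(real \<Rightarrow> complex) \<Rightarrow> (real \<Rightarrow> real) \<Rightarrow> nat \<Rightarrow> real \<Rightarrow> real \<Rightarrow> complex" where
  "spectrum g m k s w = (if w > 0 then complex_of_real (sqrt w * w ^ k * m (s * w)) * g w else 0)"

definition wave :: "(real \<Rightarrow> complex) \<Rightarrow> (real \<Rightarrow> real) \<Rightarrow> nat \<Rightarrow> real \<Rightarrow> real \<Rightarrow> complex" where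
  "wave g m k x s = (LINT w|lborel. spectrum g m k s w * exp (\<i> * complex_of_real x * complex_of_real w))"

lemma spectrum_measurable [measurable (raw)]:
  assumes "decaying m" and g: "g \<in> L2" and [measurable]: "u \<in> borel_measurable M" "v \<in> borel_measurable M"
  shows "(\<lambda>p. spectrum g m k (u p) (v p)) \<in> borel_measurable M"
proof -
  note [measurable] = decaying_measurable[OF assms(1)] L2_D(1)[OF g]
  show ?thesis unfolding spectrum_def by measurable
qed

lemma wave_measurable [measurable (raw)]:
  assumes m: "decaying m" and g: "g \<in> L2" and [measurable]: "u \<in> borel_measurable M" "v \<in> borel_measurable M"
  shows "(\<lambda>p. wave g m k (u p) (v p)) \<in> borel_measurable M"
proof -
  have [measurable]: "(\<lambda>p. spectrum g m k (v (fst p)) (snd p)) \<in> borel_measurable (M \<Otimes>\<^sub>M lborel)"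
    by (intro spectrum_measurable m g) auto
  show ?thesis unfolding wave_def
    by (rule lborel.borel_measurable_lebesgue_integral) (simp add: case_prod_beta)
qed

lemma spectrum_bound:
  assumes "decaying m"
  obtains C where "C \<ge> 0" "\<And>g k s b w. b > 0 \<Longrightarrow> b \<le> s \<Longrightarrow> cmod (spectrum g m k s w) \<le> C * (envelope b k w * cmod (g w))"
proof -
  obtain C where C: "C \<ge> 0" "\<And>u. u \<ge> 0 \<Longrightarrow> \<bar>m u\<bar> \<le> C * exp (- u / 2)"
    using decaying_bound[OF assms] by blast
  show thesis
  proof (rule that[OF C(1)])
    fix g :: "real \<Rightarrow> complex" and k s b w assume b: "(b::real) > 0" "b \<le> s"
    show "cmod (spectrum g m k s w) \<le> C * (envelope b k w * cmod (g w))"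
    proof (cases "w > 0")
      case True
      have "\<bar>m (s * w)\<bar> \<le> C * exp (- (s * w) / 2)" using C(2)[of "s * w"] b True by simp
      also have "\<dots> \<le> C * exp (- (b * w / 2))" using b True C(1) by (intro mult_left_mono) auto
      finally have "sqrt w * w ^ k * \<bar>m (s * w)\<bar> * cmod (g w) \<le> sqrt w * w ^ k * (C * exp (- (b * w / 2))) * cmod (g w)"
        using True by (intro mult_right_mono mult_left_mono) auto
      then show ?thesis using True by (simp add: spectrum_def envelope_def norm_mult abs_mult norm_power ac_simps)
    qed (simp add: spectrum_def envelope_def)
  qed
qed

lemma spectrum_L1_L2:
  assumes m: "decaying m" and g: "g \<in> L2" and s: "s > 0"
  shows "integrable lborel (spectrum g m k s)" "spectrum g m k s \<in> L2"
proof -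
  obtain C where C: "C \<ge> 0" "\<And>g k s b w. b > 0 \<Longrightarrow> b \<le> s \<Longrightarrow> cmod (spectrum g m k s w) \<le> C * (envelope b k w * cmod (g w))"
    using spectrum_bound[OF m] by blast
  have meas: "spectrum g m k s \<in> borel_measurable borel"
    by (intro spectrum_measurable m g) auto
  have le: "cmod (spectrum g m k s w) \<le> C * (envelope s k w * cmod (g w))" for w using C(2) s by simp
  have i1: "integrable lborel (\<lambda>w. C * (envelope s k w * cmod (g w)))"
    using envelope_mult(1)[OF g s] by simp
  have i2: "integrable lborel (\<lambda>w. C\<^sup>2 * (envelope s k w * cmod (g w))\<^sup>2)"
    using envelope_mult(2)[OF g s] by simp
  show "integrable lborel (spectrum g m k s)"
    by (rule Bochner_Integration.integrable_bound[OF i1]) (use le meas order_trans[OF _ abs_ge_self] in auto)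
  show "spectrum g m k s \<in> L2"
  proof (rule L2_I[OF meas])
    show "integrable lborel (\<lambda>x. (cmod (spectrum g m k s x))\<^sup>2)"
    proof (rule Bochner_Integration.integrable_bound[OF i2])
      show "AE x in lborel. norm ((cmod (spectrum g m k s x))\<^sup>2) \<le> norm (C\<^sup>2 * (envelope s k x * cmod (g x))\<^sup>2)"
        using power_mono[OF le norm_ge_zero, of _ 2] by (auto simp: power_mult_distrib)
    qed (use meas in auto)
  qed
qed

lemma nn_integral_wave:
  assumes m: "decaying m" and g: "g \<in> L2" and s: "s > 0"
  shows "(\<integral>\<^sup>+x. ennreal ((cmod (wave g m k x s))\<^sup>2) \<partial>lborel) =
     ennreal (2 * pi) * (\<integral>\<^sup>+w. ennreal ((cmod (spectrum g m k s w))\<^sup>2) \<partial>lborel)"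
proof -
  note L = spectrum_L1_L2[OF m g s]
  have eq: "wave g m k x s = 2 * pi * inverse_fourier (spectrum g m k s) x" for x
    by (simp add: wave_def inverse_fourier_def)
  have sq: "(cmod (wave g m k x s))\<^sup>2 = (2 * pi)\<^sup>2 * (cmod (inverse_fourier (spectrum g m k s) x))\<^sup>2" for x
    unfolding eq by (simp add: norm_mult power_mult_distrib)
  note I = inverse_fourier_L2[OF L]
  have "(\<integral>\<^sup>+x. ennreal ((cmod (wave g m k x s))\<^sup>2) \<partial>lborel) = ennreal (LINT x|lborel. (2 * pi)\<^sup>2 * (cmod (inverse_fourier (spectrum g m k s) x))\<^sup>2)"
    unfolding sq using L2_D(2)[OF I(1)] by (intro nn_integral_eq_integral) auto
  also have "(LINT x|lborel. (2 * pi)\<^sup>2 * (cmod (inverse_fourier (spectrum g m k s) x))\<^sup>2) = (2 * pi)\<^sup>2 * (LINT x|lborel. (cmod (inverse_fourier (spectrum g m k s) x))\<^sup>2)"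
    by (rule integral_mult_right_zero)
  also have "\<dots> = 2 * pi * (2 * pi * (LINT x|lborel. (cmod (inverse_fourier (spectrum g m k s) x))\<^sup>2))"
    by (simp add: power2_eq_square)
  also have "ennreal \<dots> = ennreal (2 * pi) * ennreal (LINT w|lborel. (cmod (spectrum g m k s w))\<^sup>2)"
    unfolding I(2) by (simp add: ennreal_mult)
  also have "ennreal (LINT w|lborel. (cmod (spectrum g m k s w))\<^sup>2) = (\<integral>\<^sup>+w. ennreal ((cmod (spectrum g m k s w))\<^sup>2) \<partial>lborel)"
    by (rule nn_integral_eq_integral[symmetric]) (use L2_D(2)[OF L(2)] in auto)
  finally show ?thesis .
qed

text \<open>The admissibility constant \<open>\<integral> \<bar>q u\<bar>\<^sup>2 du / u\<close> of a wavelet with Fourier transform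
\<open>q u = sqrt u * u ^ k * m u\<close> on the positive half line.\<close>

definition admissibility :: "(real \<Rightarrow> real) \<Rightarrow> nat \<Rightarrow> real" where
  "admissibility m k = (LINT u|lborel. (if u > 0 then u ^ (2 * k) * (m u)\<^sup>2 else 0))"

lemma nn_integral_admissibility:
  assumes m: "decaying m"
  shows "(\<integral>\<^sup>+u. ennreal (if u > 0 then u ^ (2 * k) * (m u)\<^sup>2 else 0) \<partial>lborel) = ennreal (admissibility m k)"
proof -
  note [measurable] = decaying_measurable[OF m]
  obtain C where C: "C \<ge> 0" "\<And>u. u \<ge> 0 \<Longrightarrow> \<bar>m u\<bar> \<le> C * exp (- u / 2)"
    using decaying_bound[OF m] by blast
  have "integrable lborel (\<lambda>u. C\<^sup>2 * (if u > 0 then u ^ (2 * k) * exp (- (1 * u)) else 0))"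
    using integrable_power_mult_exp[of 1 "2 * k"] by simp
  then have "integrable lborel (\<lambda>u. if u > 0 then u ^ (2 * k) * (m u)\<^sup>2 else 0)"
  proof (rule Bochner_Integration.integrable_bound)
    show "AE u in lborel. norm (if u > 0 then u ^ (2 * k) * (m u)\<^sup>2 else 0) \<le> norm (C\<^sup>2 * (if u > 0 then u ^ (2 * k) * exp (- (1 * u)) else 0))"
    proof (rule AE_I2)
      fix u :: real
      show "norm (if u > 0 then u ^ (2 * k) * (m u)\<^sup>2 else 0) \<le> norm (C\<^sup>2 * (if u > 0 then u ^ (2 * k) * exp (- (1 * u)) else 0))"
      proof (cases "u > 0")
        case True
        have "(m u)\<^sup>2 \<le> (C * exp (- u / 2))\<^sup>2"
          using C(2)[of u] True by (metis abs_ge_zero less_imp_le power2_abs power_mono)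
        also have "\<dots> = C\<^sup>2 * exp (- u)"
          by (simp add: power_mult_distrib power2_eq_square exp_add[symmetric])
        finally have "u ^ (2 * k) * (m u)\<^sup>2 \<le> u ^ (2 * k) * (C\<^sup>2 * exp (- u))"
          using True by (intro mult_left_mono) auto
        then show ?thesis using True by (simp add: abs_mult power_abs mult.left_commute)
      qed simp
    qed
  qed measurable
  then show ?thesis unfolding admissibility_def by (intro nn_integral_eq_integral) auto
qed

text \<open>For fixed \<open>s\<close>, Plancherel's formula turns the integral over \<open>x\<close> into one over the frequency \<open>w\<close>. In the
integral over \<open>s\<close>, the substitution \<open>u = s * w\<close> removes the dependence on \<open>w\<close>, because the weight
\<open>s ^ (2 * k)\<close> matches the powers of \<open>w\<close>.\<close>

theorem wave_energy:
  assumes m: "decaying m" and g: "g \<in> L2"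
  shows "(\<integral>\<^sup>+s. (if s > 0 then ennreal (s ^ (2 * k)) * (\<integral>\<^sup>+x. ennreal ((cmod (wave g m k x s))\<^sup>2) \<partial>lborel) else 0) \<partial>lborel) =
    ennreal (2 * pi * admissibility m k) * (\<integral>\<^sup>+w. (if w > 0 then ennreal ((cmod (g w))\<^sup>2) else 0) \<partial>lborel)"
proof -
  note [measurable] = decaying_measurable[OF m] L2_D(1)[OF g]
  define q where "q = (\<lambda>s w. if s > 0 \<and> w > 0 then ennreal (w * ((s * w) ^ (2 * k) * (m (s * w))\<^sup>2)) * ennreal ((cmod (g w))\<^sup>2) else 0)"
  have [measurable]: "case_prod q \<in> borel_measurable (lborel \<Otimes>\<^sub>M lborel)"
    unfolding q_def by measurable
  have 1: "(if s > 0 then ennreal (s ^ (2 * k)) * (\<integral>\<^sup>+x. ennreal ((cmod (wave g m k x s))\<^sup>2) \<partial>lborel) else 0) =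
     ennreal (2 * pi) * (\<integral>\<^sup>+w. q s w \<partial>lborel)" for s
  proof (cases "s > 0")
    case True
    have *: "ennreal (s ^ (2 * k)) * ennreal ((cmod (spectrum g m k s w))\<^sup>2) = q s w" for w
    proof (cases "w > 0")
      case w: True
      have "(cmod (spectrum g m k s w))\<^sup>2 = w * w ^ (2 * k) * (m (s * w))\<^sup>2 * (cmod (g w))\<^sup>2"
        using w by (simp add: spectrum_def norm_mult power_mult_distrib norm_power power_mult[symmetric] mult.commute[of k])
      then show ?thesis using True w
        by (simp add: q_def ennreal_mult'[symmetric] power_mult_distrib ac_simps)
    qed (simp add: q_def spectrum_def)
    have [measurable]: "(\<lambda>w. spectrum g m k s w) \<in> borel_measurable lborel"
      by (intro spectrum_measurable m g) auto
    have "ennreal (s ^ (2 * k)) * (\<integral>\<^sup>+w. ennreal ((cmod (spectrum g m k s w))\<^sup>2) \<partial>lborel) = (\<integral>\<^sup>+w. q s w \<partial>lborel)"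
      unfolding *[symmetric] by (rule nn_integral_cmult[symmetric]) measurable
    then show ?thesis using True nn_integral_wave[OF m g True, of k] by (simp add: mult.left_commute)
  next
    case False
    then show ?thesis by (simp add: q_def)
  qed
  have 2: "(\<integral>\<^sup>+s. q s w \<partial>lborel) = ennreal (admissibility m k) * (if w > 0 then ennreal ((cmod (g w))\<^sup>2) else 0)" for w
  proof (cases "w > 0")
    case True
    have "(\<integral>\<^sup>+s. q s w \<partial>lborel) = (\<integral>\<^sup>+s. (ennreal \<bar>w\<bar> * ennreal (if 0 + w * s > 0 then (0 + w * s) ^ (2 * k) * (m (0 + w * s))\<^sup>2 else 0)) * ennreal ((cmod (g w))\<^sup>2) \<partial>lborel)"
      using True by (intro nn_integral_cong) (auto simp: q_def zero_less_mult_iff ennreal_mult'[symmetric] mult.commute)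
    also have "\<dots> = ennreal \<bar>w\<bar> * (\<integral>\<^sup>+s. ennreal (if 0 + w * s > 0 then (0 + w * s) ^ (2 * k) * (m (0 + w * s))\<^sup>2 else 0) \<partial>lborel) * ennreal ((cmod (g w))\<^sup>2)"
      by (subst nn_integral_multc) (auto simp: nn_integral_cmult)
    also have "ennreal \<bar>w\<bar> * (\<integral>\<^sup>+s. ennreal (if 0 + w * s > 0 then (0 + w * s) ^ (2 * k) * (m (0 + w * s))\<^sup>2 else 0) \<partial>lborel) = ennreal (admissibility m k)"
      unfolding nn_integral_admissibility[OF m, symmetric] using True
      by (intro nn_integral_real_affine[symmetric]) auto
    finally show ?thesis using True by simp
  qed (simp add: q_def)
  have "(\<integral>\<^sup>+s. ennreal (2 * pi) * (\<integral>\<^sup>+w. q s w \<partial>lborel) \<partial>lborel) = ennreal (2 * pi) * (\<integral>\<^sup>+s. \<integral>\<^sup>+w. q s w \<partial>lborel \<partial>lborel)"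
    by (rule nn_integral_cmult) measurable
  also have "(\<integral>\<^sup>+s. \<integral>\<^sup>+w. q s w \<partial>lborel \<partial>lborel) = (\<integral>\<^sup>+w. \<integral>\<^sup>+s. q s w \<partial>lborel \<partial>lborel)"
    by (rule lborel_pair.Fubini'[symmetric]) measurable
  also have "\<dots> = ennreal (admissibility m k) * (\<integral>\<^sup>+w. (if w > 0 then ennreal ((cmod (g w))\<^sup>2) else 0) \<partial>lborel)"
    unfolding 2 by (rule nn_integral_cmult) measurable
  also have "ennreal (2 * pi) * (ennreal (admissibility m k) * (\<integral>\<^sup>+w. (if w > 0 then ennreal ((cmod (g w))\<^sup>2) else 0) \<partial>lborel)) =
     ennreal (2 * pi * admissibility m k) * (\<integral>\<^sup>+w. (if w > 0 then ennreal ((cmod (g w))\<^sup>2) else 0) \<partial>lborel)"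
    by (simp add: ennreal_mult' mult.assoc)
  finally show ?thesis unfolding 1 .
qed

section \<open>Increments of spectral integrals\<close>

text \<open>Differentiation under the integral sign in integrated form: the increment is the integral of the
derivative by Fubini's theorem, and is then estimated by the Cauchy--Schwarz inequality.\<close>

lemma integral_increment_bound:
  fixes \<phi> \<psi> :: "real \<Rightarrow> real \<Rightarrow> complex"
  assumes le: "t0 \<le> t1"
    and deriv: "\<And>t w. t \<in> {t0..t1} \<Longrightarrow> ((\<lambda>t. \<phi> t w) has_vector_derivative \<psi> t w) (at t within {t0..t1})"
    and cont: "\<And>w. continuous_on {t0..t1} (\<lambda>t. \<psi> t w)"
    and bound: "\<And>t w. t \<in> {t0..t1} \<Longrightarrow> cmod (\<psi> t w) \<le> H w" and H: "integrable lborel H"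
    and meas[measurable]: "(\<lambda>(t, w). \<psi> t w) \<in> borel_measurable (borel \<Otimes>\<^sub>M borel)"
    and int: "integrable lborel (\<phi> t0)" "integrable lborel (\<phi> t1)"
  shows "ennreal ((cmod ((LINT w|lborel. \<phi> t1 w) - (LINT w|lborel. \<phi> t0 w)))\<^sup>2) \<le>
    ennreal (t1 - t0) * (\<integral>\<^sup>+t. indicator {t0..t1} t * ennreal ((cmod (LINT w|lborel. \<psi> t w))\<^sup>2) \<partial>lborel)"
proof -
  define q where "q = (\<lambda>t w. indicator {t0..t1} t *\<^sub>R \<psi> t w)"
  define G where "G = (\<lambda>t. LINT w|lborel. q t w)"
  have G: "G t = indicator {t0..t1} t *\<^sub>R (LINT w|lborel. \<psi> t w)" for t
    by (simp add: G_def q_def)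
  have qm[measurable]: "(\<lambda>(t, w). q t w) \<in> borel_measurable (lborel \<Otimes>\<^sub>M lborel)"
    unfolding q_def by measurable
  have ind: "integrable lborel (indicator {t0..t1} :: real \<Rightarrow> real)"
    by (rule integrable_real_indicator) (auto simp: emeasure_lborel_Icc_eq)
  have iq: "integrable (lborel \<Otimes>\<^sub>M lborel) (\<lambda>(t, w). q t w)"
  proof (rule Bochner_Integration.integrable_bound[where f="\<lambda>(t, w). indicator {t0..t1} t * H w"])
    show "integrable (lborel \<Otimes>\<^sub>M lborel) (\<lambda>(t, w). indicator {t0..t1} t * H w)"
      by (rule lborel_pair.Fubini_integrable) (use H ind in \<open>auto simp: abs_mult\<close>)
    show "AE p in lborel \<Otimes>\<^sub>M lborel. norm (case p of (t, w) \<Rightarrow> q t w) \<le> norm (case p of (t, w) \<Rightarrow> indicator {t0..t1} t * H w)"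
    proof (rule AE_I2, clarify)
      fix t w
      show "norm (q t w) \<le> norm (indicator {t0..t1} t * H w)"
        using bound[of t w] by (cases "t \<in> {t0..t1}") (auto simp: q_def)
    qed
  qed measurable
  have "(LINT w|lborel. \<phi> t1 w) - (LINT w|lborel. \<phi> t0 w) = (LINT w|lborel. \<phi> t1 w - \<phi> t0 w)"
    using int by simp
  also have "\<dots> = (LINT w|lborel. LINT t|lborel. q t w)"
    unfolding q_def by (intro Bochner_Integration.integral_cong refl integral_FTC_atLeastAtMost[symmetric] le deriv cont) auto
  also have "\<dots> = (LINT t|lborel. G t)"
    unfolding G_def by (rule lborel_pair.Fubini_integral[OF iq])
  finally have eq: "(LINT w|lborel. \<phi> t1 w) - (LINT w|lborel. \<phi> t0 w) = (LINT t|lborel. G t)" .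
  have Gi: "integrable lborel G" unfolding G_def using lborel_pair.integrable_fst'[OF iq] by simp
  then have [measurable]: "G \<in> borel_measurable borel" by auto
  have "ennreal (cmod (LINT t|lborel. G t)) \<le> (\<integral>\<^sup>+t. ennreal (cmod (G t)) \<partial>lborel)"
    by (rule integral_norm_bound_ennreal[OF Gi])
  also have "\<dots> = (\<integral>\<^sup>+t. indicator {t0..t1} t * ennreal (cmod (G t)) \<partial>lborel)"
    by (intro nn_integral_cong) (auto simp: G indicator_def)
  finally have "(ennreal (cmod (LINT t|lborel. G t)))\<^sup>2 \<le> (\<integral>\<^sup>+t. indicator {t0..t1} t * ennreal (cmod (G t)) \<partial>lborel)\<^sup>2"
    by (intro power_mono) auto
  also have "\<dots> \<le> (\<integral>\<^sup>+t. (indicator {t0..t1} t)\<^sup>2 \<partial>lborel) * (\<integral>\<^sup>+t. (ennreal (cmod (G t)))\<^sup>2 \<partial>lborel)"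
    by (rule Cauchy_Schwarz_nn_integral) auto
  also have "(\<integral>\<^sup>+t. (indicator {t0..t1} t)\<^sup>2 \<partial>lborel) = (\<integral>\<^sup>+t. indicator {t0..t1} t \<partial>lborel)"
    by (intro nn_integral_cong) (auto simp: indicator_def)
  also have "\<dots> = ennreal (t1 - t0)" using le by simp
  also have "(\<integral>\<^sup>+t. (ennreal (cmod (G t)))\<^sup>2 \<partial>lborel) = (\<integral>\<^sup>+t. indicator {t0..t1} t * ennreal ((cmod (LINT w|lborel. \<psi> t w))\<^sup>2) \<partial>lborel)"
    by (intro nn_integral_cong) (auto simp: G indicator_def ennreal_power)
  finally show ?thesis unfolding eq by (simp add: ennreal_power)
qed

lemma increment_bound_mono:
  fixes V :: "real \<Rightarrow> ennreal"
  assumes "x \<le> y" "x \<in> {a..<a+l}" "y \<in> {a..<a+l}"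
    and "c \<le> ennreal (y - x) * (\<integral>\<^sup>+t. indicator {x..y} t * V t \<partial>lborel)"
  shows "c \<le> ennreal l * (\<integral>\<^sup>+t. indicator {a..<a+l} t * V t \<partial>lborel)"
proof (rule order_trans[OF assms(4)], rule mult_mono)
  show "ennreal (y - x) \<le> ennreal l" using assms(2,3) by (intro ennreal_leI) auto
  show "(\<integral>\<^sup>+t. indicator {x..y} t * V t \<partial>lborel) \<le> (\<integral>\<^sup>+t. indicator {a..<a+l} t * V t \<partial>lborel)"
  proof (rule nn_integral_mono)
    fix t
    have "indicator {x..y} t \<le> (indicator {a..<a+l} t :: ennreal)"
      using assms(2,3) by (auto simp: indicator_def)
    then show "indicator {x..y} t * V t \<le> indicator {a..<a+l} t * V t"
      by (rule mult_right_mono) simp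
  qed
qed simp_all

lemma wave_integrand_integrable:
  assumes "decaying m" "g \<in> L2" "s > 0"
  shows "integrable lborel (\<lambda>w. spectrum g m k s w * exp (\<i> * complex_of_real x * complex_of_real w))"
proof (rule Bochner_Integration.integrable_bound[OF spectrum_L1_L2(1)[OF assms, of k]])
  have [measurable]: "(\<lambda>w. spectrum g m k s w) \<in> borel_measurable lborel"
    by (intro spectrum_measurable assms) auto
  show "(\<lambda>w. spectrum g m k s w * exp (\<i> * complex_of_real x * complex_of_real w)) \<in> borel_measurable lborel"
    by measurable
qed (simp add: norm_mult)

lemma wave_increment_x:
  assumes m: "decaying m" and g: "g \<in> L2" and s: "s > 0" and x: "x \<in> {a..<a+l}" "y \<in> {a..<a+l}"
  shows "ennreal ((cmod (wave g m k x s - wave g m k y s))\<^sup>2) \<le>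
    ennreal l * (\<integral>\<^sup>+t. indicator {a..<a+l} t * ennreal ((cmod (wave g m (Suc k) t s))\<^sup>2) \<partial>lborel)"
  using x
proof (induction x y rule: linorder_wlog)
  case (le x y)
  show ?case
  proof (rule increment_bound_mono[OF le])
    have [measurable]: "(\<lambda>p. spectrum g m k s (snd p)) \<in> borel_measurable (borel \<Otimes>\<^sub>M borel)" for k
      by (intro spectrum_measurable m g) auto
    have wave': "(LINT w|lborel. \<i> * (spectrum g m (Suc k) s w * exp (\<i> * complex_of_real t * complex_of_real w))) = \<i> * wave g m (Suc k) t s" for t
      unfolding wave_def by (rule integral_mult_right_zero)
    have "ennreal ((cmod (wave g m k y s - wave g m k x s))\<^sup>2) \<le> ennreal (y - x) * (\<integral>\<^sup>+t. indicator {x..y} t *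
       ennreal ((cmod (LINT w|lborel. \<i> * (spectrum g m (Suc k) s w * exp (\<i> * complex_of_real t * complex_of_real w))))\<^sup>2) \<partial>lborel)"
      unfolding wave_def
    proof (rule integral_increment_bound[OF le(1), where H="\<lambda>w. cmod (spectrum g m (Suc k) s w)"])
      fix t w assume "t \<in> {x..y}"
      have sp: "spectrum g m (Suc k) s w = of_real w * spectrum g m k s w"
        by (simp add: spectrum_def)
      have "((\<lambda>t. exp (of_real t * (\<i> * of_real w))) has_vector_derivative exp (of_real t * (\<i> * of_real w)) * (\<i> * of_real w)) (at t within {x..y})"
        using exp_scaleR_has_vector_derivative_right[of "\<i> * of_real w" t "{x..y}"] by (simp add: scaleR_conv_of_real)
      from has_vector_derivative_mult_right[OF this, of "spectrum g m k s w"]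
      show "((\<lambda>t. spectrum g m k s w * exp (\<i> * complex_of_real t * complex_of_real w)) has_vector_derivative
          \<i> * (spectrum g m (Suc k) s w * exp (\<i> * complex_of_real t * complex_of_real w))) (at t within {x..y})"
        unfolding sp by (simp add: ac_simps)
    next
      show "integrable lborel (\<lambda>w. cmod (spectrum g m (Suc k) s w))"
        using spectrum_L1_L2(1)[OF m g s] by simp
      show "(\<lambda>(t, w). \<i> * (spectrum g m (Suc k) s w * exp (\<i> * complex_of_real t * complex_of_real w))) \<in> borel_measurable (borel \<Otimes>\<^sub>M borel)"
        unfolding case_prod_beta by measurable
    qed (auto intro!: continuous_intros wave_integrand_integrable m g s simp: norm_mult)
    then show "ennreal ((cmod (wave g m k x s - wave g m k y s))\<^sup>2) \<le> ennreal (y - x) * (\<integral>\<^sup>+t. indicator {x..y} t *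
       ennreal ((cmod (wave g m (Suc k) t s))\<^sup>2) \<partial>lborel)"
      unfolding wave' by (simp add: norm_mult norm_minus_commute)
  qed
next
  case (sym y x)
  then show ?case by (simp add: norm_minus_commute)
qed

lemma wave_increment_s:
  assumes m: "decaying m" and m': "decaying m'" and g: "g \<in> L2" and b: "b > 0"
    and deriv: "\<And>u. u > 0 \<Longrightarrow> (m has_real_derivative m' u) (at u)" and cont: "continuous_on {0<..} m'"
    and s: "s \<in> {b..<b+l}" "s' \<in> {b..<b+l}"
  shows "ennreal ((cmod (wave g m k x s - wave g m k x s'))\<^sup>2) \<le>
    ennreal l * (\<integral>\<^sup>+t. indicator {b..<b+l} t * ennreal ((cmod (wave g m' (Suc k) x t))\<^sup>2) \<partial>lborel)"
  using s
proof (induction s s' rule: linorder_wlog)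
  case (le s s')
  obtain C where C: "C \<ge> 0" "\<And>g k s b w. b > 0 \<Longrightarrow> b \<le> s \<Longrightarrow> cmod (spectrum g m' k s w) \<le> C * (envelope b k w * cmod (g w))"
    using spectrum_bound[OF m'] by blast
  show ?case
  proof (rule increment_bound_mono[OF le])
    have [measurable]: "(\<lambda>p. spectrum g m' k (fst p) (snd p)) \<in> borel_measurable (borel \<Otimes>\<^sub>M borel)" for k
      by (intro spectrum_measurable m' g) auto
    have "ennreal ((cmod (wave g m k x s' - wave g m k x s))\<^sup>2) \<le> ennreal (s' - s) * (\<integral>\<^sup>+t. indicator {s..s'} t *
       ennreal ((cmod (wave g m' (Suc k) x t))\<^sup>2) \<partial>lborel)"
      unfolding wave_def
    proof (rule integral_increment_bound[OF le(1), where H="\<lambda>w. C * (envelope b (Suc k) w * cmod (g w))"])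
      fix t w assume t: "t \<in> {s..s'}"
      show "((\<lambda>t. spectrum g m k t w * exp (\<i> * complex_of_real x * complex_of_real w)) has_vector_derivative
           spectrum g m' (Suc k) t w * exp (\<i> * complex_of_real x * complex_of_real w)) (at t within {s..s'})"
      proof (cases "w > 0")
        case True
        have tw: "t * w > 0" using t le b True by simp
        have "((\<lambda>t. m (t * w)) has_real_derivative m' (t * w) * w) (at t)"
          by (rule DERIV_chain2[where f=m and g="\<lambda>t. t * w", OF deriv[OF tw]]) (auto intro!: derivative_eq_intros)
        then have "((\<lambda>t. m (t * w)) has_vector_derivative m' (t * w) * w) (at t within {s..s'})"
          by (auto simp: has_real_derivative_iff_has_vector_derivative intro: has_vector_derivative_at_within)
        then have "((\<lambda>t. complex_of_real (m (t * w))) has_vector_derivative complex_of_real (m' (t * w) * w)) (at t within {s..s'})"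
          by (rule bounded_linear.has_vector_derivative[OF bounded_linear_of_real])
        from has_vector_derivative_mult_right[OF this, of "complex_of_real (sqrt w * w ^ k) * g w * exp (\<i> * complex_of_real x * complex_of_real w)"]
        show ?thesis using True by (simp add: spectrum_def ac_simps)
      qed (simp add: spectrum_def)
      show "cmod (spectrum g m' (Suc k) t w * exp (\<i> * complex_of_real x * complex_of_real w)) \<le> C * (envelope b (Suc k) w * cmod (g w))"
        using C(2)[of b t g "Suc k" w] b t le by (simp add: norm_mult)
    next
      fix w
      show "continuous_on {s..s'} (\<lambda>t. spectrum g m' (Suc k) t w * exp (\<i> * complex_of_real x * complex_of_real w))"
      proof (cases "w > 0")
        case True
        have "continuous_on {s..s'} (\<lambda>t. m' (t * w))"
          by (rule continuous_on_compose2[OF cont]) (use True b le in \<open>auto intro!: continuous_intros\<close>)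
        then show ?thesis using True by (auto simp: spectrum_def intro!: continuous_intros)
      qed (simp add: spectrum_def)
    next
      show "integrable lborel (\<lambda>w. C * (envelope b (Suc k) w * cmod (g w)))"
        using envelope_mult(1)[OF g b] by simp
      show "(\<lambda>(t, w). spectrum g m' (Suc k) t w * exp (\<i> * complex_of_real x * complex_of_real w)) \<in> borel_measurable (borel \<Otimes>\<^sub>M borel)"
        unfolding case_prod_beta by measurable
    qed (use le b in \<open>auto intro!: wave_integrand_integrable m g\<close>)
    then show "ennreal ((cmod (wave g m k x s - wave g m k x s'))\<^sup>2) \<le> ennreal (s' - s) * (\<integral>\<^sup>+t. indicator {s..s'} t *
       ennreal ((cmod (wave g m' (Suc k) x t))\<^sup>2) \<partial>lborel)"
      by (simp add: norm_minus_commute)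
  qed
next
  case (sym s s')
  then show ?case by (simp add: norm_minus_commute)
qed

section \<open>The wavelet coefficients as spectral integrals\<close>

definition poly_exp :: "real poly \<Rightarrow> real \<Rightarrow> real" where
  "poly_exp p u = poly p u * exp (- u)"

lemma decaying_poly_exp: "decaying (poly_exp p)"
proof -
  have pow: "u ^ i \<le> fact i * 2 ^ i * exp (u / 2)" if "u \<ge> 0" for u :: real and i
  proof -
    have "(u / 2) ^ i / fact i \<le> exp (u / 2)" using that by (intro power_div_fact_le_exp) simp
    then have "u ^ i / (2 ^ i * fact i) \<le> exp (u / 2)" by (simp only: power_divide divide_divide_eq_left)
    moreover have "(0::real) < 2 ^ i * fact i" by simp
    ultimately have "u ^ i \<le> exp (u / 2) * (2 ^ i * fact i)" by (simp only: pos_divide_le_eq)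
    then show ?thesis by (simp only: ac_simps)
  qed
  define C where "C = (\<Sum>i\<le>degree p. \<bar>coeff p i\<bar> * (fact i * 2 ^ i))"
  have "\<bar>poly_exp p u\<bar> \<le> C * exp (- u / 2)" if u: "u \<ge> 0" for u
  proof -
    have "\<bar>poly p u\<bar> \<le> (\<Sum>i\<le>degree p. \<bar>coeff p i * u ^ i\<bar>)" unfolding poly_altdef by (rule sum_abs)
    also have "\<dots> \<le> (\<Sum>i\<le>degree p. \<bar>coeff p i\<bar> * (fact i * 2 ^ i * exp (u / 2)))"
    proof (rule sum_mono)
      fix i
      have "\<bar>coeff p i * u ^ i\<bar> = \<bar>coeff p i\<bar> * u ^ i" using u by (simp add: abs_mult)
      also have "\<dots> \<le> \<bar>coeff p i\<bar> * (fact i * 2 ^ i * exp (u / 2))"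
        by (rule mult_left_mono[OF pow[OF u]]) simp
      finally show "\<bar>coeff p i * u ^ i\<bar> \<le> \<bar>coeff p i\<bar> * (fact i * 2 ^ i * exp (u / 2))" .
    qed
    also have "\<dots> = C * exp (u / 2)" unfolding C_def sum_distrib_right by (simp only: mult.assoc)
    finally have "\<bar>poly p u\<bar> * exp (- u) \<le> C * exp (u / 2) * exp (- u)" by (rule mult_right_mono) simp
    also have "\<dots> = C * (exp (u / 2) * exp (- u))" by (rule mult.assoc)
    also have "exp (u / 2) * exp (- u) = exp (- u / 2)" by (subst exp_add[symmetric]) simp
    finally show ?thesis by (simp add: poly_exp_def abs_mult)
  qed
  moreover have "poly_exp p \<in> borel_measurable borel"
    unfolding poly_exp_def[abs_def] by (intro borel_measurable_continuous_onI continuous_intros)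
  ultimately show ?thesis unfolding decaying_def by blast
qed

lemma poly_exp_derivative: "(poly_exp p has_real_derivative poly_exp (pderiv p - p) u) (at u)"
  unfolding poly_exp_def[abs_def] by (auto intro!: derivative_eq_intros simp: algebra_simps)

lemma continuous_on_poly_exp: "continuous_on A (poly_exp p)"
  unfolding poly_exp_def[abs_def] by (intro continuous_intros)

text \<open>A nonzero polynomial has finitely many roots, hence does not vanish almost everywhere.\<close>

lemma admissibility_poly_exp_pos:
  assumes p: "p \<noteq> 0"
  shows "admissibility (poly_exp p) 0 > 0"
proof (rule ccontr)
  assume "\<not> ?thesis"
  then have z: "(\<integral>\<^sup>+u. ennreal (if u > 0 then u ^ (2 * 0) * (poly_exp p u)\<^sup>2 else 0) \<partial>lborel) = 0"
    unfolding nn_integral_admissibility[OF decaying_poly_exp] by (simp add: ennreal_neg)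
  have [measurable]: "poly_exp p \<in> borel_measurable borel" by (rule decaying_measurable[OF decaying_poly_exp])
  have "AE u in lborel. ennreal (if u > 0 then u ^ (2 * 0) * (poly_exp p u)\<^sup>2 else 0) = 0"
    using z by (subst (asm) nn_integral_0_iff_AE) auto
  then have ae: "AE u in lborel. u > 0 \<longrightarrow> poly p u = 0"
    by eventually_elim (auto simp: poly_exp_def split: if_splits)
  have "finite {u. poly p u = 0}" by (rule poly_roots_finite[OF p])
  then have "{u. poly p u = 0} \<in> null_sets lborel" by (rule finite_imp_null_set_lborel)
  then have "AE u in lborel. poly p u \<noteq> 0" by (auto dest: AE_not_in)
  with ae have "AE u in lborel. u \<notin> {0<..<1::real}" by eventually_elim auto
  then have "emeasure lborel {0<..<1::real} = 0"
    by (subst (asm) AE_iff_measurable[of "{0<..<1::real}"]) auto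
  then show False by simp
qed

text \<open>The coefficients of \<open>laguerre n (2 * u)\<close> as a polynomial in \<open>u\<close>.\<close>

definition wavelet_poly :: "nat \<Rightarrow> real poly" where
  "wavelet_poly n = (\<Sum>k\<le>n. monom ((-1) ^ k * real (n choose k) * 2 ^ k / fact k) k)"

lemma poly_wavelet_poly: "poly (wavelet_poly n) u = laguerre n (2 * u)"
  unfolding wavelet_poly_def laguerre_def poly_sum poly_monom
  by (intro sum.cong) (auto simp: power_mult_distrib)

lemma wavelet_poly_nonzero: "wavelet_poly n \<noteq> 0"
proof -
  have "poly (wavelet_poly n) 0 = 1"
    unfolding poly_wavelet_poly laguerre_def
    by (subst sum.remove[of _ 0]) (auto intro!: sum.neutral)
  then show ?thesis by auto
qed

lemma Phi_hat_eq: "Phi_hat n t = (if t > 0 then complex_of_real (sqrt t * poly_exp (wavelet_poly n) t) else 0)"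
  by (simp add: Phi_hat_def laguerre_fun_def poly_exp_def poly_wavelet_poly powr_half_sqrt ac_simps)

lemma Phi_hat_L1_L2: "integrable lborel (Phi_hat n)" "Phi_hat n \<in> L2"
proof -
  define m where "m = poly_exp (wavelet_poly n)"
  have m: "decaying m" unfolding m_def by (rule decaying_poly_exp)
  note [measurable] = decaying_measurable[OF m]
  obtain C where C: "C \<ge> 0" "\<And>u. u \<ge> 0 \<Longrightarrow> \<bar>m u\<bar> \<le> C * exp (- u / 2)"
    using decaying_bound[OF m] by blast
  have eq: "Phi_hat n t = (if t > 0 then complex_of_real (sqrt t * m t) else 0)" for t
    by (simp add: Phi_hat_eq m_def)
  have meas[measurable]: "Phi_hat n \<in> borel_measurable borel"
    unfolding eq[abs_def] by measurable
  have i1: "integrable lborel (\<lambda>t. C * ((if t > 0 then t ^ 0 * exp (- (1/2 * t)) else 0) + (if t > 0 then t ^ 1 * exp (- (1/2 * t)) else 0)))"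
    using integrable_power_mult_exp[of "1/2" 0] integrable_power_mult_exp[of "1/2" 1] by simp
  have i2: "integrable lborel (\<lambda>t. C\<^sup>2 * (if t > 0 then t ^ 1 * exp (- (1 * t)) else 0))"
    using integrable_power_mult_exp[of 1 1] by simp
  show "integrable lborel (Phi_hat n)"
  proof (rule Bochner_Integration.integrable_bound[OF i1])
    show "AE t in lborel. norm (Phi_hat n t) \<le> norm (C * ((if t > 0 then t ^ 0 * exp (- (1/2 * t)) else 0) + (if t > 0 then t ^ 1 * exp (- (1/2 * t)) else 0)))"
    proof (rule AE_I2)
      fix t :: real
      show "norm (Phi_hat n t) \<le> norm (C * ((if t > 0 then t ^ 0 * exp (- (1/2 * t)) else 0) + (if t > 0 then t ^ 1 * exp (- (1/2 * t)) else 0)))"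
      proof (cases "t > 0")
        case True
        have "sqrt t \<le> 1 + t" using True by (intro real_le_lsqrt) (auto simp: power2_eq_square algebra_simps)
        then have "sqrt t * \<bar>m t\<bar> \<le> (1 + t) * (C * exp (- t / 2))"
          using C True by (intro mult_mono) auto
        then show ?thesis using True C(1) by (simp add: eq norm_mult abs_mult algebra_simps)
      qed (simp add: eq)
    qed
  qed simp
  show "Phi_hat n \<in> L2"
  proof (rule L2_I[OF meas], rule Bochner_Integration.integrable_bound[OF i2])
    show "AE t in lborel. norm ((cmod (Phi_hat n t))\<^sup>2) \<le> norm (C\<^sup>2 * (if t > 0 then t ^ 1 * exp (- (1 * t)) else 0))"
    proof (rule AE_I2)
      fix t :: real
      show "norm ((cmod (Phi_hat n t))\<^sup>2) \<le> norm (C\<^sup>2 * (if t > 0 then t ^ 1 * exp (- (1 * t)) else 0))"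
      proof (cases "t > 0")
        case True
        have "(m t)\<^sup>2 \<le> (C * exp (- t / 2))\<^sup>2"
          using C(2)[of t] True by (metis abs_ge_zero less_imp_le power2_abs power_mono)
        also have "\<dots> = C\<^sup>2 * exp (- t)"
          by (simp add: power_mult_distrib power2_eq_square exp_add[symmetric])
        finally have "t * (m t)\<^sup>2 \<le> t * (C\<^sup>2 * exp (- t))"
          using True by (intro mult_left_mono) auto
        then show ?thesis using True by (simp add: eq norm_mult power_mult_distrib abs_mult mult.left_commute)
      qed (simp add: eq)
    qed
  qed simp
qed

text \<open>The choice in the definition of \<open>Phi\<close> is from a nonempty set, as the explicit Fourier integral is a
member, and all members agree almost everywhere.\<close>

lemma Phi_eq_inverse_fourier: "AE t in lborel. Phi n t = inverse_fourier (Phi_hat n) t"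
  and Phi_L2: "Phi n \<in> L2"
proof -
  have 1: "has_L2_fourier (inverse_fourier (Phi_hat n)) (Phi_hat n)"
    by (rule has_L2_fourier_inverse[OF Phi_hat_L1_L2])
  have "inverse_fourier (Phi_hat n) \<in> Hardy2"
    unfolding Hardy2_def using 1 by (auto simp: has_L2_fourier_def Phi_hat_def intro!: exI[of _ "Phi_hat n"])
  then have "\<exists>f. f \<in> Hardy2 \<and> has_L2_fourier f (Phi_hat n)" using 1 by blast
  then have *: "Phi n \<in> Hardy2 \<and> has_L2_fourier (Phi n) (Phi_hat n)"
    unfolding Phi_def by (rule someI_ex)
  then show "Phi n \<in> L2" by (simp add: Hardy2_def)
  show "AE t in lborel. Phi n t = inverse_fourier (Phi_hat n) t"
    using has_L2_fourier_unique[OF conjunct2[OF *] 1] .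
qed

text \<open>Translation and dilation act on the frequency side by a modulation and the inverse dilation. The
wavelet may be replaced by its explicit Fourier integral, to which Parseval's identity applies.\<close>

theorem wavelet_coefficient:
  assumes fg: "has_L2_fourier f g" and s: "s > 0"
  shows "L2_inner f (translation x (dilation s (Phi n))) = complex_of_real (s / (2 * pi)) * wave g (poly_exp (wavelet_poly n)) 0 x s"
proof -
  have f: "f \<in> L2" and g: "g \<in> L2" using fg by (auto simp: has_L2_fourier_def)
  note [measurable] = L2_D(1)[OF f] L2_D(1)[OF g] L2_D(1)[OF Phi_L2] L2_D(1)[OF Phi_hat_L1_L2(2)]
  define m where "m = poly_exp (wavelet_poly n)"
  (* the Fourier transform of the translated and dilated wavelet *)
  define h where "h = (\<lambda>w. complex_of_real (sqrt s) * exp (- \<i> * of_real x * of_real w) * Phi_hat n (0 + s * w))"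
  have hm[measurable]: "h \<in> borel_measurable borel" unfolding h_def by measurable
  have h1: "integrable lborel h"
  proof (rule Bochner_Integration.integrable_bound)
    show "integrable lborel (\<lambda>w. complex_of_real (sqrt s) * Phi_hat n (0 + s * w))"
      using lborel_integrable_real_affine[OF Phi_hat_L1_L2(1)[of n], of s 0] s by simp
  qed (auto simp: h_def norm_mult)
  have h2: "h \<in> L2"
  proof (rule L2_I[OF hm], rule Bochner_Integration.integrable_bound)
    show "integrable lborel (\<lambda>w. s * (cmod (Phi_hat n (0 + s * w)))\<^sup>2)"
      using lborel_integrable_real_affine[OF L2_D(2)[OF Phi_hat_L1_L2(2)[of n]], of s 0] s by simp
  qed (use s in \<open>auto simp: h_def norm_mult power_mult_distrib\<close>)
  have inv: "inverse_fourier h t = complex_of_real (s powr (-1/2)) * inverse_fourier (Phi_hat n) (- x / s + 1 / s * t)" for t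
  proof -
    have e: "exp (- \<i> * of_real x * of_real w) * exp (\<i> * of_real t * of_real w) = exp (\<i> * of_real (- x / s + 1 / s * t) * of_real (0 + s * w))" for w
    proof -
      have "- \<i> * of_real x * of_real w + \<i> * of_real t * of_real w = \<i> * of_real (- x / s + 1 / s * t) * complex_of_real (0 + s * w)"
        using s by (simp add: field_simps)
      then show ?thesis by (metis exp_add)
    qed
    have "(LINT w|lborel. h w * exp (\<i> * of_real t * of_real w)) =
      (LINT w|lborel. complex_of_real (sqrt s) * (Phi_hat n (0 + s * w) * exp (\<i> * of_real (- x / s + 1 / s * t) * of_real (0 + s * w))))"
      unfolding e[symmetric] h_def by (simp only: ac_simps)
    also have "\<dots> = complex_of_real (sqrt s) * (LINT w|lborel. Phi_hat n (0 + s * w) * exp (\<i> * of_real (- x / s + 1 / s * t) * of_real (0 + s * w)))"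
      by (rule integral_mult_right_zero)
    also have "(LINT w|lborel. Phi_hat n (0 + s * w) * exp (\<i> * of_real (- x / s + 1 / s * t) * of_real (0 + s * w))) =
       (LINT v|lborel. Phi_hat n v * exp (\<i> * of_real (- x / s + 1 / s * t) * of_real v)) / of_real s"
      using lborel_integral_real_affine[of s "\<lambda>v. Phi_hat n v * exp (\<i> * of_real (- x / s + 1 / s * t) * of_real v)" 0] s
      by (simp add: scaleR_conv_of_real)
    finally have "inverse_fourier h t = complex_of_real (sqrt s) / of_real s * inverse_fourier (Phi_hat n) (- x / s + 1 / s * t)"
      unfolding inverse_fourier_def by simp
    moreover have "sqrt s / s = s powr (-1/2)"
    proof -
      have "s powr (-1/2) = 1 / sqrt s"
        using s powr_minus_divide[of s "1/2"] by (simp add: powr_half_sqrt)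
      also have "\<dots> = sqrt s / s"
        using s real_sqrt_mult_self[of s] by (simp add: field_simps)
      finally show ?thesis by simp
    qed
    ultimately show ?thesis by (metis of_real_divide)
  qed
  have "AE t in lborel. Phi n (- x / s + 1 / s * t) = inverse_fourier (Phi_hat n) (- x / s + 1 / s * t)"
    by (rule AE_borel_affine[OF _ _ Phi_eq_inverse_fourier]) (use s in auto)
  then have ae: "AE t in lborel. translation x (dilation s (Phi n)) t = inverse_fourier h t"
  proof eventually_elim
    case (elim t)
    have "(t - x) / s = - x / s + 1 / s * t" by (simp add: diff_divide_distrib)
    then show ?case using elim by (simp add: translation_def dilation_def inv)
  qed
  have "L2_inner f (translation x (dilation s (Phi n))) = (LINT t|lborel. f t * cnj (inverse_fourier h t))"
    unfolding L2_inner_def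
  proof (rule integral_cong_AE)
    show "AE t in lborel. f t * cnj (translation x (dilation s (Phi n)) t) = f t * cnj (inverse_fourier h t)"
      using ae by eventually_elim simp
  qed (auto simp: translation_def dilation_def)
  also have "\<dots> = (LINT w|lborel. g w * cnj (h w)) / (2 * pi)"
    by (rule has_L2_fourier_pairing[OF fg h1 h2])
  also have "(LINT w|lborel. g w * cnj (h w)) = (LINT w|lborel. of_real s * (spectrum g m 0 s w * exp (\<i> * of_real x * of_real w)))"
  proof (rule Bochner_Integration.integral_cong)
    fix w
    show "g w * cnj (h w) = of_real s * (spectrum g m 0 s w * exp (\<i> * of_real x * of_real w))"
    proof (cases "w > 0")
      case True
      have "sqrt s * sqrt (s * w) = s * sqrt w" using s by (simp add: real_sqrt_mult)
      then have "complex_of_real (sqrt s) * complex_of_real (sqrt (s * w)) = of_real s * of_real (sqrt w)"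
        by (metis of_real_mult)
      then show ?thesis using True s
        by (simp add: h_def Phi_hat_eq spectrum_def m_def exp_cnj ac_simps)
    next
      case False
      then show ?thesis using s by (simp add: h_def Phi_hat_eq spectrum_def zero_less_mult_iff)
    qed
  qed simp
  also have "\<dots> = of_real s * wave g m 0 x s" unfolding wave_def by (rule integral_mult_right_zero)
  finally show ?thesis by (simp add: m_def)
qed

lemma ennreal_norm_square_triangle:
  fixes u v :: complex
  shows "ennreal ((cmod u)\<^sup>2) \<le> 2 * ennreal ((cmod v)\<^sup>2) + 2 * ennreal ((cmod (u - v))\<^sup>2)"
proof -
  have "(cmod u)\<^sup>2 \<le> 2 * (cmod v)\<^sup>2 + 2 * (cmod (u - v))\<^sup>2"
    using cmod_diff_square_le[of v "v - u"] by (simp add: norm_minus_commute)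
  then have "ennreal ((cmod u)\<^sup>2) \<le> ennreal (2 * (cmod v)\<^sup>2 + 2 * (cmod (u - v))\<^sup>2)" by (rule ennreal_leI)
  also have "\<dots> = 2 * ennreal ((cmod v)\<^sup>2) + 2 * ennreal ((cmod (u - v))\<^sup>2)"
    by (simp add: ennreal_mult)
  finally show ?thesis .
qed

section \<open>Oscillation on square cells\<close>

definition cell_integral :: "real \<Rightarrow> real \<Rightarrow> real \<Rightarrow> (real \<Rightarrow> real \<Rightarrow> ennreal) \<Rightarrow> ennreal" where
  "cell_integral a b l V = (\<integral>\<^sup>+s. indicator {b..<b+l} s * (\<integral>\<^sup>+x. indicator {a..<a+l} x * V x s \<partial>lborel) \<partial>lborel)"

lemma cell_integral_mono:
  assumes "\<And>x s. x \<in> {a..<a+l} \<Longrightarrow> s \<in> {b..<b+l} \<Longrightarrow> V x s \<le> W x s"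
  shows "cell_integral a b l V \<le> cell_integral a b l W"
  unfolding cell_integral_def
proof (rule nn_integral_mono)
  fix s
  show "indicator {b..<b+l} s * (\<integral>\<^sup>+x. indicator {a..<a+l} x * V x s \<partial>lborel) \<le>
     indicator {b..<b+l} s * (\<integral>\<^sup>+x. indicator {a..<a+l} x * W x s \<partial>lborel)"
  proof (cases "s \<in> {b..<b+l}")
    case True
    have "(\<integral>\<^sup>+x. indicator {a..<a+l} x * V x s \<partial>lborel) \<le> (\<integral>\<^sup>+x. indicator {a..<a+l} x * W x s \<partial>lborel)"
      by (rule nn_integral_mono) (use assms[OF _ True] in \<open>auto simp: indicator_def\<close>)
    then show ?thesis by (rule mult_left_mono) simp
  qed simp
qed

lemma cell_integral_add:
  assumes [measurable]: "case_prod V \<in> borel_measurable (borel \<Otimes>\<^sub>M borel)" "case_prod W \<in> borel_measurable (borel \<Otimes>\<^sub>M borel)"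
  shows "cell_integral a b l (\<lambda>x s. V x s + W x s) = cell_integral a b l V + cell_integral a b l W"
  unfolding cell_integral_def distrib_left
  by (subst nn_integral_add[symmetric], measurable)
     (intro nn_integral_cong, subst nn_integral_add, auto simp: distrib_left)

lemma cell_integral_cmult:
  assumes [measurable]: "case_prod V \<in> borel_measurable (borel \<Otimes>\<^sub>M borel)"
  shows "cell_integral a b l (\<lambda>x s. c * V x s) = c * cell_integral a b l V"
  unfolding cell_integral_def
  by (subst nn_integral_cmult[symmetric], measurable)
     (intro nn_integral_cong, subst mult.left_commute, subst nn_integral_cmult, auto simp: mult.left_commute)

lemma cell_integral_const:
  assumes "l \<ge> 0"
  shows "cell_integral a b l (\<lambda>x s. c) = c * ennreal l * ennreal l"
  using assms by (simp add: cell_integral_def nn_integral_multc nn_integral_cmult mult.commute mult.left_commute)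

lemma cell_integral_only_s:
  assumes "l \<ge> 0" and [measurable]: "V \<in> borel_measurable borel"
  shows "cell_integral a b l (\<lambda>x s. V s) = ennreal l * (\<integral>\<^sup>+s. indicator {b..<b+l} s * V s \<partial>lborel)"
  using assms(1) by (simp add: cell_integral_def nn_integral_multc nn_integral_cmult[symmetric] mult.left_commute)

text \<open>From \<open>(x, s)\<close> one moves horizontally to \<open>(x0, s)\<close> and then vertically to \<open>(x0, s0)\<close>. The horizontal step
is controlled by the \<open>x\<close>-derivative \<open>G1\<close> on the cell. The vertical step involves the \<open>s\<close>-derivative \<open>G2\<close>
only on the line over \<open>x0\<close>; its values there are compared with those on the parallel lines by means of
the mixed derivative \<open>G21\<close>, and then averaged over the cell.\<close>

lemma cell_oscillation:
  fixes G G1 G2 G21 :: "real \<Rightarrow> real \<Rightarrow> complex"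
  assumes l: "l > 0"
    and [measurable]: "case_prod G \<in> borel_measurable (borel \<Otimes>\<^sub>M borel)" "case_prod G1 \<in> borel_measurable (borel \<Otimes>\<^sub>M borel)"
      "case_prod G2 \<in> borel_measurable (borel \<Otimes>\<^sub>M borel)" "case_prod G21 \<in> borel_measurable (borel \<Otimes>\<^sub>M borel)"
    and hx: "\<And>s x y. s \<in> {b..<b+l} \<Longrightarrow> x \<in> {a..<a+l} \<Longrightarrow> y \<in> {a..<a+l} \<Longrightarrow>
      ennreal ((cmod (G x s - G y s))\<^sup>2) \<le> ennreal l * (\<integral>\<^sup>+t. indicator {a..<a+l} t * ennreal ((cmod (G1 t s))\<^sup>2) \<partial>lborel)"
    and hs: "\<And>x s s'. x \<in> {a..<a+l} \<Longrightarrow> s \<in> {b..<b+l} \<Longrightarrow> s' \<in> {b..<b+l} \<Longrightarrow>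
      ennreal ((cmod (G x s - G x s'))\<^sup>2) \<le> ennreal l * (\<integral>\<^sup>+t. indicator {b..<b+l} t * ennreal ((cmod (G2 x t))\<^sup>2) \<partial>lborel)"
    and hsx: "\<And>s x y. s \<in> {b..<b+l} \<Longrightarrow> x \<in> {a..<a+l} \<Longrightarrow> y \<in> {a..<a+l} \<Longrightarrow>
      ennreal ((cmod (G2 x s - G2 y s))\<^sup>2) \<le> ennreal l * (\<integral>\<^sup>+t. indicator {a..<a+l} t * ennreal ((cmod (G21 t s))\<^sup>2) \<partial>lborel)"
    and x0: "x0 \<in> {a..<a+l}" and s0: "s0 \<in> {b..<b+l}"
  shows "cell_integral a b l (\<lambda>x s. ennreal ((cmod (G x s - G x0 s0))\<^sup>2)) \<le>
     2 * (ennreal l)\<^sup>2 * cell_integral a b l (\<lambda>x s. ennreal ((cmod (G1 x s))\<^sup>2)) +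
     4 * (ennreal l)\<^sup>2 * cell_integral a b l (\<lambda>x s. ennreal ((cmod (G2 x s))\<^sup>2)) +
     4 * (ennreal l)^4 * cell_integral a b l (\<lambda>x s. ennreal ((cmod (G21 x s))\<^sup>2))"
proof -
  define L where "L = ennreal l"
  define A1 where "A1 = (\<lambda>s. \<integral>\<^sup>+t. indicator {a..<a+l} t * ennreal ((cmod (G1 t s))\<^sup>2) \<partial>lborel)"
  define A2 where "A2 = (\<lambda>s. \<integral>\<^sup>+t. indicator {a..<a+l} t * ennreal ((cmod (G21 t s))\<^sup>2) \<partial>lborel)"
  define B where "B = (\<integral>\<^sup>+t. indicator {b..<b+l} t * ennreal ((cmod (G2 x0 t))\<^sup>2) \<partial>lborel)"
  have [measurable]: "A1 \<in> borel_measurable borel" "A2 \<in> borel_measurable borel"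
    unfolding A1_def A2_def by measurable
  have [measurable]: "(\<lambda>t. G2 x0 t) \<in> borel_measurable borel" by measurable
  have A1: "(\<integral>\<^sup>+s. indicator {b..<b+l} s * A1 s \<partial>lborel) = cell_integral a b l (\<lambda>x s. ennreal ((cmod (G1 x s))\<^sup>2))"
    unfolding A1_def cell_integral_def ..
  have A2: "(\<integral>\<^sup>+s. indicator {b..<b+l} s * A2 s \<partial>lborel) = cell_integral a b l (\<lambda>x s. ennreal ((cmod (G21 x s))\<^sup>2))"
    unfolding A2_def cell_integral_def ..
  have "L * B = cell_integral a b l (\<lambda>x t. ennreal ((cmod (G2 x0 t))\<^sup>2))"
    unfolding L_def B_def by (rule cell_integral_only_s[symmetric]) (use l in auto)
  also have "\<dots> \<le> cell_integral a b l (\<lambda>x t. 2 * ennreal ((cmod (G2 x t))\<^sup>2) + 2 * (L * A2 t))"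
  proof (rule cell_integral_mono)
    fix x t assume x: "x \<in> {a..<a+l}" and t: "t \<in> {b..<b+l}"
    have "ennreal ((cmod (G2 x0 t))\<^sup>2) \<le> 2 * ennreal ((cmod (G2 x t))\<^sup>2) + 2 * ennreal ((cmod (G2 x0 t - G2 x t))\<^sup>2)"
      by (rule ennreal_norm_square_triangle)
    also have "\<dots> \<le> 2 * ennreal ((cmod (G2 x t))\<^sup>2) + 2 * (L * A2 t)"
      unfolding L_def A2_def by (intro add_left_mono mult_left_mono hsx t x0 x) auto
    finally show "ennreal ((cmod (G2 x0 t))\<^sup>2) \<le> 2 * ennreal ((cmod (G2 x t))\<^sup>2) + 2 * (L * A2 t)" .
  qed
  also have "\<dots> = cell_integral a b l (\<lambda>x t. 2 * ennreal ((cmod (G2 x t))\<^sup>2)) + cell_integral a b l (\<lambda>x t. 2 * (L * A2 t))"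
    by (rule cell_integral_add) measurable
  also have "cell_integral a b l (\<lambda>x t. 2 * ennreal ((cmod (G2 x t))\<^sup>2)) = 2 * cell_integral a b l (\<lambda>x t. ennreal ((cmod (G2 x t))\<^sup>2))"
    by (rule cell_integral_cmult) measurable
  also have "cell_integral a b l (\<lambda>x t. 2 * (L * A2 t)) = 2 * cell_integral a b l (\<lambda>x t. L * A2 t)"
    by (rule cell_integral_cmult) measurable
  also have "cell_integral a b l (\<lambda>x t. L * A2 t) = L * cell_integral a b l (\<lambda>x t. A2 t)"
    by (rule cell_integral_cmult) measurable
  also have "cell_integral a b l (\<lambda>x t. A2 t) = L * cell_integral a b l (\<lambda>x s. ennreal ((cmod (G21 x s))\<^sup>2))"
    unfolding A2[symmetric] L_def by (rule cell_integral_only_s) (use l in auto)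
  finally have B: "L * B \<le> 2 * cell_integral a b l (\<lambda>x t. ennreal ((cmod (G2 x t))\<^sup>2)) + 2 * (L * (L * cell_integral a b l (\<lambda>x s. ennreal ((cmod (G21 x s))\<^sup>2))))" .
  have "cell_integral a b l (\<lambda>x s. ennreal ((cmod (G x s - G x0 s0))\<^sup>2)) \<le> cell_integral a b l (\<lambda>x s. 2 * L * B + 2 * L * A1 s)"
  proof (rule cell_integral_mono)
    fix x s assume x: "x \<in> {a..<a+l}" and s: "s \<in> {b..<b+l}"
    have "ennreal ((cmod (G x s - G x0 s0))\<^sup>2) \<le> 2 * ennreal ((cmod (G x0 s - G x0 s0))\<^sup>2) + 2 * ennreal ((cmod (G x s - G x0 s0 - (G x0 s - G x0 s0)))\<^sup>2)"
      by (rule ennreal_norm_square_triangle)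
    also have "\<dots> = 2 * ennreal ((cmod (G x0 s - G x0 s0))\<^sup>2) + 2 * ennreal ((cmod (G x s - G x0 s))\<^sup>2)" by simp
    also have "\<dots> \<le> 2 * (L * B) + 2 * (L * A1 s)"
      unfolding L_def A1_def B_def by (intro add_mono mult_left_mono hx hs x s x0 s0) auto
    finally show "ennreal ((cmod (G x s - G x0 s0))\<^sup>2) \<le> 2 * L * B + 2 * L * A1 s" by (simp add: mult.assoc)
  qed
  also have "\<dots> = cell_integral a b l (\<lambda>x s. 2 * L * B) + cell_integral a b l (\<lambda>x s. 2 * L * A1 s)"
    by (rule cell_integral_add) measurable
  also have "cell_integral a b l (\<lambda>x s. 2 * L * B) = 2 * L * B * L * L"
    unfolding L_def by (rule cell_integral_const) (use l in auto)
  also have "cell_integral a b l (\<lambda>x s. 2 * L * A1 s) = 2 * L * cell_integral a b l (\<lambda>x s. A1 s)"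
    by (rule cell_integral_cmult) measurable
  also have "cell_integral a b l (\<lambda>x s. A1 s) = L * cell_integral a b l (\<lambda>x s. ennreal ((cmod (G1 x s))\<^sup>2))"
    unfolding A1[symmetric] L_def by (rule cell_integral_only_s) (use l in auto)
  also have "2 * L * B * L * L = 2 * L * L * (L * B)" by (simp only: ac_simps)
  also have "\<dots> \<le> 2 * L * L * (2 * cell_integral a b l (\<lambda>x t. ennreal ((cmod (G2 x t))\<^sup>2)) + 2 * (L * (L * cell_integral a b l (\<lambda>x s. ennreal ((cmod (G21 x s))\<^sup>2)))))"
    by (rule mult_left_mono[OF B]) simp
  finally show ?thesis
    unfolding L_def[symmetric] by (simp add: distrib_left power2_eq_square power4_eq_xxxx ac_simps)
qed

lemma cell_integral_const_bounds:
  fixes G :: "real \<Rightarrow> real \<Rightarrow> complex" and c :: complex and a b l :: real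
  assumes l: "l > 0" and [measurable]: "case_prod G \<in> borel_measurable (borel \<Otimes>\<^sub>M borel)"
  defines "D \<equiv> cell_integral a b l (\<lambda>x s. ennreal ((cmod (G x s - c))\<^sup>2))"
    and "I \<equiv> cell_integral a b l (\<lambda>x s. ennreal ((cmod (G x s))\<^sup>2))"
  shows "ennreal ((cmod c)\<^sup>2) * ennreal l * ennreal l \<le> 2 * I + 2 * D"
    and "I \<le> 2 * (ennreal ((cmod c)\<^sup>2) * ennreal l * ennreal l) + 2 * D"
proof -
  have split: "cell_integral a b l (\<lambda>x s. 2 * V x s + 2 * W x s) = 2 * cell_integral a b l V + 2 * cell_integral a b l W"
    if [measurable]: "case_prod V \<in> borel_measurable (borel \<Otimes>\<^sub>M borel)" "case_prod W \<in> borel_measurable (borel \<Otimes>\<^sub>M borel)" for V W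
  proof -
    have "cell_integral a b l (\<lambda>x s. 2 * V x s + 2 * W x s) = cell_integral a b l (\<lambda>x s. 2 * V x s) + cell_integral a b l (\<lambda>x s. 2 * W x s)"
      by (rule cell_integral_add) measurable
    then show ?thesis using that by (simp only: cell_integral_cmult)
  qed
  have const: "cell_integral a b l (\<lambda>x s. ennreal ((cmod c)\<^sup>2)) = ennreal ((cmod c)\<^sup>2) * ennreal l * ennreal l"
    by (rule cell_integral_const) (use l in simp)
  have "cell_integral a b l (\<lambda>x s. ennreal ((cmod c)\<^sup>2)) \<le> cell_integral a b l (\<lambda>x s. 2 * ennreal ((cmod (G x s))\<^sup>2) + 2 * ennreal ((cmod (G x s - c))\<^sup>2))"
  proof (rule cell_integral_mono)
    fix x s
    show "ennreal ((cmod c)\<^sup>2) \<le> 2 * ennreal ((cmod (G x s))\<^sup>2) + 2 * ennreal ((cmod (G x s - c))\<^sup>2)"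
      using ennreal_norm_square_triangle[of c "G x s"] by (simp add: norm_minus_commute)
  qed
  also have "\<dots> = 2 * I + 2 * D" unfolding I_def D_def by (rule split) measurable
  finally show "ennreal ((cmod c)\<^sup>2) * ennreal l * ennreal l \<le> 2 * I + 2 * D" unfolding const .
  have "I \<le> cell_integral a b l (\<lambda>x s. 2 * ennreal ((cmod c)\<^sup>2) + 2 * ennreal ((cmod (G x s - c))\<^sup>2))"
    unfolding I_def by (intro cell_integral_mono ennreal_norm_square_triangle)
  also have "\<dots> = 2 * cell_integral a b l (\<lambda>x s. ennreal ((cmod c)\<^sup>2)) + 2 * D" unfolding D_def by (rule split) measurable
  finally show "I \<le> 2 * (ennreal ((cmod c)\<^sup>2) * ennreal l * ennreal l) + 2 * D" unfolding const .
qed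

section \<open>Hyperbolic grids\<close>

definition grid_height :: "real \<Rightarrow> int \<Rightarrow> real" where
  "grid_height h j = (1 + h) powr real_of_int j"

text \<open>In hyperbolic terms all cells of one grid are congruent: they are images of one square with lower side at
height \<open>1\<close> under the maps \<open>z \<mapsto> b * z + t\<close> with real \<open>t\<close>. A cell ends at the height at which the next
row begins.\<close>

definition grid_cell :: "real \<Rightarrow> int \<times> int \<Rightarrow> (real \<times> real) set" where
  "grid_cell h q = (let b = grid_height h (fst q); l = h * b; a = real_of_int (snd q) * l in {a..<a+l} \<times> {b..<b+l})"

definition grid_integral :: "real \<Rightarrow> int \<times> int \<Rightarrow> (real \<Rightarrow> real \<Rightarrow> ennreal) \<Rightarrow> ennreal" where
  "grid_integral h q V = (let b = grid_height h (fst q); l = h * b in cell_integral (real_of_int (snd q) * l) b l V)"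

lemma grid_height_pos: "h > 0 \<Longrightarrow> grid_height h j > 0"
  by (simp add: grid_height_def)

text \<open>The cells tile the half plane: the index of the cell of a point is read off from its coordinates.\<close>

lemma grid_cell_iff:
  assumes h: "h > 0"
  shows "(x, s) \<in> grid_cell h q \<longleftrightarrow> s > 0 \<and> q = (\<lfloor>log (1 + h) s\<rfloor>, \<lfloor>x / (h * grid_height h \<lfloor>log (1 + h) s\<rfloor>)\<rfloor>)"
proof -
  obtain j i where q: "q = (j, i)" by fastforce
  define b l where "b = grid_height h j" and "l = h * b"
  have b: "b > 0" and l: "l > 0" using h by (auto simp: b_def l_def grid_height_pos)
  have next_eq: "b + l = (1 + h) powr (real_of_int j + 1)"
    using h by (simp add: b_def l_def grid_height_def powr_add algebra_simps)
  have s: "s \<in> {b..<b+l} \<longleftrightarrow> s > 0 \<and> \<lfloor>log (1 + h) s\<rfloor> = j"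
  proof (cases "s > 0")
    case True
    have "b \<le> s \<longleftrightarrow> real_of_int j \<le> log (1 + h) s"
      using h True by (simp add: b_def grid_height_def le_log_iff)
    moreover have "s < b + l \<longleftrightarrow> log (1 + h) s < real_of_int j + 1"
      using h True unfolding next_eq by (simp add: log_less_iff)
    ultimately show ?thesis using True by (simp add: floor_eq_iff)
  qed (use b in auto)
  have x: "x \<in> {real_of_int i * l..<real_of_int i * l + l} \<longleftrightarrow> \<lfloor>x / l\<rfloor> = i"
    using l unfolding floor_eq_iff by (simp add: le_divide_eq divide_less_eq distrib_right)
  have "(x, s) \<in> grid_cell h q \<longleftrightarrow> s \<in> {b..<b+l} \<and> x \<in> {real_of_int i * l..<real_of_int i * l + l}"
    unfolding grid_cell_def q Let_def b_def l_def by auto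
  then show ?thesis unfolding s x q by (auto simp: b_def l_def)
qed

lemma grid_integral_sum:
  assumes h: "h > 0" and [measurable]: "case_prod V \<in> borel_measurable (borel \<Otimes>\<^sub>M borel)"
  shows "(\<integral>\<^sup>+q. grid_integral h q V \<partial>count_space UNIV) = (\<integral>\<^sup>+s. (if s > 0 then (\<integral>\<^sup>+x. V x s \<partial>lborel) else 0) \<partial>lborel)"
proof -
  have cell[measurable]: "grid_cell h q \<in> sets (borel \<Otimes>\<^sub>M borel)" for q
    unfolding grid_cell_def Let_def by (intro pair_measureI) auto
  have 1: "grid_integral h q V = (\<integral>\<^sup>+s. (\<integral>\<^sup>+x. indicator (grid_cell h q) (x, s) * V x s \<partial>lborel) \<partial>lborel)" for q
    unfolding grid_integral_def cell_integral_def Let_def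
  proof (intro nn_integral_cong)
    fix s
    define b l a where "b = grid_height h (fst q)" and "l = h * b" and "a = real_of_int (snd q) * l"
    have "indicator {b..<b+l} s * (\<integral>\<^sup>+x. indicator {a..<a+l} x * V x s \<partial>lborel) =
        (\<integral>\<^sup>+x. indicator {b..<b+l} s * (indicator {a..<a+l} x * V x s) \<partial>lborel)"
      by (rule nn_integral_cmult[symmetric]) measurable
    also have "\<dots> = (\<integral>\<^sup>+x. indicator (grid_cell h q) (x, s) * V x s \<partial>lborel)"
      by (intro nn_integral_cong) (auto simp: grid_cell_def b_def l_def a_def Let_def indicator_def)
    finally show "indicator {grid_height h (fst q)..<grid_height h (fst q) + h * grid_height h (fst q)} s *
         (\<integral>\<^sup>+ x. indicator {real_of_int (snd q) * (h * grid_height h (fst q))..<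
             real_of_int (snd q) * (h * grid_height h (fst q)) + h * grid_height h (fst q)} x * V x s \<partial>lborel) =
         (\<integral>\<^sup>+x. indicator (grid_cell h q) (x, s) * V x s \<partial>lborel)"
      unfolding b_def l_def a_def .
  qed
  have "(\<integral>\<^sup>+q. grid_integral h q V \<partial>count_space UNIV) =
    (\<integral>\<^sup>+s. (\<integral>\<^sup>+q. (\<integral>\<^sup>+x. indicator (grid_cell h q) (x, s) * V x s \<partial>lborel) \<partial>count_space UNIV) \<partial>lborel)"
    unfolding 1 by (rule nn_integral_count_space_nn_integral[symmetric]) auto
  also have "\<dots> = (\<integral>\<^sup>+s. (if s > 0 then (\<integral>\<^sup>+x. V x s \<partial>lborel) else 0) \<partial>lborel)"
  proof (rule nn_integral_cong)
    fix s :: real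
    have "(\<integral>\<^sup>+q. (\<integral>\<^sup>+x. indicator (grid_cell h q) (x, s) * V x s \<partial>lborel) \<partial>count_space UNIV) =
      (\<integral>\<^sup>+x. (\<integral>\<^sup>+q. indicator (grid_cell h q) (x, s) * V x s \<partial>count_space UNIV) \<partial>lborel)"
      by (rule nn_integral_count_space_nn_integral[symmetric]) auto
    also have "\<dots> = (\<integral>\<^sup>+x. (if s > 0 then V x s else 0) \<partial>lborel)"
    proof (rule nn_integral_cong)
      fix x
      define q0 where "q0 = (\<lfloor>log (1 + h) s\<rfloor>, \<lfloor>x / (h * grid_height h \<lfloor>log (1 + h) s\<rfloor>)\<rfloor>)"
      have "(\<integral>\<^sup>+q. indicator (grid_cell h q) (x, s) * V x s \<partial>count_space UNIV) =
         (\<integral>\<^sup>+q. (if s > 0 then V x s else 0) * indicator {q0} q \<partial>count_space UNIV)"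
        by (intro nn_integral_cong) (auto simp: indicator_def grid_cell_iff[OF h] q0_def)
      also have "\<dots> = (if s > 0 then V x s else 0)"
        by (subst nn_integral_cmult_indicator) auto
      finally show "(\<integral>\<^sup>+q. indicator (grid_cell h q) (x, s) * V x s \<partial>count_space UNIV) = (if s > 0 then V x s else 0)" .
    qed
    also have "\<dots> = (if s > 0 then (\<integral>\<^sup>+x. V x s \<partial>lborel) else 0)" by simp
    finally show "(\<integral>\<^sup>+q. (\<integral>\<^sup>+x. indicator (grid_cell h q) (x, s) * V x s \<partial>lborel) \<partial>count_space UNIV) = (if s > 0 then (\<integral>\<^sup>+x. V x s \<partial>lborel) else 0)" .
  qed
  finally show ?thesis .
qed

section \<open>Sampling inequalities\<close>

lemma sum_le_nn_integral_count_space: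
  fixes f :: "'a \<Rightarrow> ennreal"
  assumes "finite S"
  shows "sum f S \<le> (\<integral>\<^sup>+q. f q \<partial>count_space UNIV)"
proof -
  have "sum f S = (\<integral>\<^sup>+q. f q \<partial>count_space S)" by (rule nn_integral_count_space_finite[OF assms, symmetric])
  also have "\<dots> = (\<integral>\<^sup>+q. f q * indicator S q \<partial>count_space UNIV)"
    by (rule nn_integral_count_space_indicator) simp
  also have "\<dots> \<le> (\<integral>\<^sup>+q. f q \<partial>count_space UNIV)" by (intro nn_integral_mono) (auto simp: indicator_def)
  finally show ?thesis .
qed

lemma nn_integral_count_space_le:
  fixes f :: "'a \<Rightarrow> ennreal"
  assumes inf: "countable (UNIV :: 'a set)" "infinite (UNIV :: 'a set)"
    and le: "\<And>S. finite S \<Longrightarrow> sum f S \<le> B"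
  shows "(\<integral>\<^sup>+q. f q \<partial>count_space UNIV) \<le> B"
proof -
  define e where "e = from_nat_into (UNIV :: 'a set)"
  have e: "bij_betw e UNIV UNIV" unfolding e_def by (rule bij_betw_from_nat_into[OF inf])
  have "(\<integral>\<^sup>+q. f q \<partial>count_space UNIV) = (\<Sum>i. f (e i))"
    using nn_integral_bij_count_space[OF e, of f] by (simp add: nn_integral_count_space_nat)
  also have "\<dots> = (SUP n. \<Sum>i<n. f (e i))" by (rule suminf_eq_SUP)
  also have "\<dots> \<le> B"
  proof (rule SUP_least)
    fix n
    have "(\<Sum>i<n. f (e i)) = sum f (e ` {..<n})"
      using e by (subst sum.reindex) (auto simp: bij_betw_def intro: inj_on_subset)
    also have "\<dots> \<le> B" by (rule le) simp
    finally show "(\<Sum>i<n. f (e i)) \<le> B" .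
  qed
  finally show ?thesis .
qed

text \<open>The properties of \<open>m u = exp (- u) * laguerre n (2 * u)\<close> on which the sampling inequalities depend.\<close>

locale smooth_profile =
  fixes m m' :: "real \<Rightarrow> real"
  assumes m: "decaying m" and m': "decaying m'"
    and deriv: "\<And>u. u > 0 \<Longrightarrow> (m has_real_derivative m' u) (at u)" and cont: "continuous_on {0<..} m'"
begin

definition wave_power :: "(real \<Rightarrow> complex) \<Rightarrow> real \<Rightarrow> real \<Rightarrow> ennreal" where
  "wave_power g x s = ennreal ((cmod (wave g m 0 x s))\<^sup>2)"

text \<open>The squares of the hyperbolic derivatives of the wave: \<open>s * \<partial>\<^sub>x\<close>, \<open>s * \<partial>\<^sub>s\<close> and \<open>s\<^sup>2 * \<partial>\<^sub>x \<partial>\<^sub>s\<close>.\<close>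

definition oscillation_power :: "(real \<Rightarrow> complex) \<Rightarrow> real \<Rightarrow> real \<Rightarrow> ennreal" where
  "oscillation_power g x s = ennreal (s\<^sup>2 * (cmod (wave g m (Suc 0) x s))\<^sup>2) +
     ennreal (s\<^sup>2 * (cmod (wave g m' (Suc 0) x s))\<^sup>2) +
     ennreal (s ^ 4 * (cmod (wave g m' (Suc (Suc 0)) x s))\<^sup>2)"

definition oscillation_constant :: real where
  "oscillation_constant = admissibility m (Suc 0) + admissibility m' (Suc 0) + admissibility m' (Suc (Suc 0))"

lemma wave_pair_measurable [measurable]:
  assumes "decaying r" "g \<in> L2"
  shows "case_prod (wave g r k) \<in> borel_measurable (borel \<Otimes>\<^sub>M borel)"
  unfolding case_prod_beta by (intro wave_measurable assms) auto

lemma weighted_energy: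
  assumes r: "decaying r" and g: "g \<in> L2" and h: "h > 0"
  shows "(\<integral>\<^sup>+q. grid_integral h q (\<lambda>x s. ennreal (s ^ (2 * k) * (cmod (wave g r k x s))\<^sup>2)) \<partial>count_space UNIV) =
    ennreal (2 * pi * admissibility r k) * (\<integral>\<^sup>+w. (if w > 0 then ennreal ((cmod (g w))\<^sup>2) else 0) \<partial>lborel)"
proof -
  have [measurable]: "case_prod (wave g r k) \<in> borel_measurable (borel \<Otimes>\<^sub>M borel)" by (rule wave_pair_measurable[OF r g])
  have "(\<integral>\<^sup>+q. grid_integral h q (\<lambda>x s. ennreal (s ^ (2 * k) * (cmod (wave g r k x s))\<^sup>2)) \<partial>count_space UNIV) =
     (\<integral>\<^sup>+s. (if s > 0 then (\<integral>\<^sup>+x. ennreal (s ^ (2 * k) * (cmod (wave g r k x s))\<^sup>2) \<partial>lborel) else 0) \<partial>lborel)"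
    by (rule grid_integral_sum[OF h]) measurable
  also have "\<dots> = (\<integral>\<^sup>+s. (if s > 0 then ennreal (s ^ (2 * k)) * (\<integral>\<^sup>+x. ennreal ((cmod (wave g r k x s))\<^sup>2) \<partial>lborel) else 0) \<partial>lborel)"
  proof (rule nn_integral_cong)
    fix s :: real
    have [measurable]: "(\<lambda>x. wave g r k x s) \<in> borel_measurable borel"
      by (intro wave_measurable r g) auto
    have "(\<integral>\<^sup>+x. ennreal (s ^ (2 * k) * (cmod (wave g r k x s))\<^sup>2) \<partial>lborel) = ennreal (s ^ (2 * k)) * (\<integral>\<^sup>+x. ennreal ((cmod (wave g r k x s))\<^sup>2) \<partial>lborel)"
      by (subst nn_integral_cmult[symmetric]) (auto simp: ennreal_mult zero_le_even_power)
    then show "(if s > 0 then (\<integral>\<^sup>+x. ennreal (s ^ (2 * k) * (cmod (wave g r k x s))\<^sup>2) \<partial>lborel) else 0) =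
      (if s > 0 then ennreal (s ^ (2 * k)) * (\<integral>\<^sup>+x. ennreal ((cmod (wave g r k x s))\<^sup>2) \<partial>lborel) else 0)" by simp
  qed
  also have "\<dots> = ennreal (2 * pi * admissibility r k) * (\<integral>\<^sup>+w. (if w > 0 then ennreal ((cmod (g w))\<^sup>2) else 0) \<partial>lborel)"
    by (rule wave_energy[OF r g])
  finally show ?thesis .
qed

lemma wave_power_energy:
  assumes g: "g \<in> L2" and h: "h > 0"
  shows "(\<integral>\<^sup>+q. grid_integral h q (wave_power g) \<partial>count_space UNIV) =
    ennreal (2 * pi * admissibility m 0) * (\<integral>\<^sup>+w. (if w > 0 then ennreal ((cmod (g w))\<^sup>2) else 0) \<partial>lborel)"
  using weighted_energy[OF m g h, of 0] by (simp add: wave_power_def[abs_def])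

lemma admissibility_nonneg: "admissibility r k \<ge> 0"
  unfolding admissibility_def by (intro Bochner_Integration.integral_nonneg) auto

lemma grid_integral_add:
  assumes "case_prod V \<in> borel_measurable (borel \<Otimes>\<^sub>M borel)" "case_prod W \<in> borel_measurable (borel \<Otimes>\<^sub>M borel)"
  shows "grid_integral h q (\<lambda>x s. V x s + W x s) = grid_integral h q V + grid_integral h q W"
  unfolding grid_integral_def Let_def by (rule cell_integral_add[OF assms])

lemma oscillation_power_energy:
  assumes g: "g \<in> L2" and h: "h > 0"
  shows "(\<integral>\<^sup>+q. grid_integral h q (oscillation_power g) \<partial>count_space UNIV) =
    ennreal (2 * pi * oscillation_constant) * (\<integral>\<^sup>+w. (if w > 0 then ennreal ((cmod (g w))\<^sup>2) else 0) \<partial>lborel)"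
proof -
  note [measurable] = wave_pair_measurable[OF m g] wave_pair_measurable[OF m' g]
  have split: "grid_integral h q (oscillation_power g) = grid_integral h q (\<lambda>x s. ennreal (s ^ (2 * Suc 0) * (cmod (wave g m (Suc 0) x s))\<^sup>2)) +
     grid_integral h q (\<lambda>x s. ennreal (s ^ (2 * Suc 0) * (cmod (wave g m' (Suc 0) x s))\<^sup>2)) +
     grid_integral h q (\<lambda>x s. ennreal (s ^ (2 * Suc (Suc 0)) * (cmod (wave g m' (Suc (Suc 0)) x s))\<^sup>2))" for q
  proof -
    have "oscillation_power g = (\<lambda>x s. (ennreal (s ^ (2 * Suc 0) * (cmod (wave g m (Suc 0) x s))\<^sup>2) +
      ennreal (s ^ (2 * Suc 0) * (cmod (wave g m' (Suc 0) x s))\<^sup>2)) + ennreal (s ^ (2 * Suc (Suc 0)) * (cmod (wave g m' (Suc (Suc 0)) x s))\<^sup>2))"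
      by (intro ext) (simp add: oscillation_power_def numeral_2_eq_2 eval_nat_numeral)
    then show ?thesis by (simp only:) (subst grid_integral_add, measurable, subst grid_integral_add, measurable)
  qed
  define N where "N = (\<integral>\<^sup>+w. (if w > 0 then ennreal ((cmod (g w))\<^sup>2) else 0) \<partial>lborel)"
  have "(\<integral>\<^sup>+q. grid_integral h q (oscillation_power g) \<partial>count_space UNIV) =
    ennreal (2 * pi * admissibility m (Suc 0)) * N + ennreal (2 * pi * admissibility m' (Suc 0)) * N + ennreal (2 * pi * admissibility m' (Suc (Suc 0))) * N"
    unfolding split N_def weighted_energy[OF m g h, symmetric] weighted_energy[OF m' g h, symmetric]
    by (subst nn_integral_add[symmetric], simp, simp)+ simp
  also have "\<dots> = ennreal (2 * pi * oscillation_constant) * N"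
    by (simp add: oscillation_constant_def distrib_left distrib_right admissibility_nonneg)
  finally show ?thesis unfolding N_def .
qed

text \<open>On a cell of side \<open>l = h * b\<close> one has \<open>l \<le> h * s\<close> and \<open>s \<le> 2 * b\<close>. The first converts the powers of \<open>l\<close>
in the oscillation estimate into the weights of the hyperbolic derivatives; both together make \<open>l\<^sup>2\<close>
comparable with \<open>h\<^sup>2 * s0\<^sup>2\<close>, the factor that belongs to a sample.\<close>

lemma sample_versus_cell:
  assumes g: "g \<in> L2" and h: "0 < h" "h \<le> 1" and z: "(x0, s0) \<in> grid_cell h q"
  shows "ennreal (s0\<^sup>2 * (cmod (wave g m 0 x0 s0))\<^sup>2) \<le> ennreal (8 / h\<^sup>2) * grid_integral h q (wave_power g) + 32 * grid_integral h q (oscillation_power g)"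
    and "grid_integral h q (wave_power g) \<le> ennreal (2 * h\<^sup>2) * ennreal (s0\<^sup>2 * (cmod (wave g m 0 x0 s0))\<^sup>2) + ennreal (8 * h\<^sup>2) * grid_integral h q (oscillation_power g)"
proof -
  note meas[measurable] = wave_pair_measurable[OF m g] wave_pair_measurable[OF m' g]
  define b l a where "b = grid_height h (fst q)" and "l = h * b" and "a = real_of_int (snd q) * l"
  have b: "b > 0" and l: "l > 0" using h by (auto simp: b_def l_def grid_height_pos)
  have lb: "l \<le> b" using h b by (simp add: l_def)
  have x0: "x0 \<in> {a..<a+l}" and s0: "s0 \<in> {b..<b+l}"
    using z unfolding grid_cell_def Let_def a_def b_def l_def by auto
  have gi: "grid_integral h q V = cell_integral a b l V" for V
    by (simp add: grid_integral_def Let_def a_def b_def l_def)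
  define D where "D = cell_integral a b l (\<lambda>x s. ennreal ((cmod (wave g m 0 x s - wave g m 0 x0 s0))\<^sup>2))"
  define J where "J = cell_integral a b l (oscillation_power g)"
  have "D \<le> 2 * (ennreal l)\<^sup>2 * cell_integral a b l (\<lambda>x s. ennreal ((cmod (wave g m (Suc 0) x s))\<^sup>2)) +
     4 * (ennreal l)\<^sup>2 * cell_integral a b l (\<lambda>x s. ennreal ((cmod (wave g m' (Suc 0) x s))\<^sup>2)) +
     4 * (ennreal l)^4 * cell_integral a b l (\<lambda>x s. ennreal ((cmod (wave g m' (Suc (Suc 0)) x s))\<^sup>2))"
    unfolding D_def
    by (rule cell_oscillation[OF l meas(1) meas(1) meas(2) meas(2) _ _ _ x0 s0])
       (use b in \<open>auto intro!: wave_increment_x wave_increment_s m m' g deriv cont\<close>)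
  also have "\<dots> \<le> 4 * ((ennreal l)\<^sup>2 * cell_integral a b l (\<lambda>x s. ennreal ((cmod (wave g m (Suc 0) x s))\<^sup>2)) +
     (ennreal l)\<^sup>2 * cell_integral a b l (\<lambda>x s. ennreal ((cmod (wave g m' (Suc 0) x s))\<^sup>2)) +
     (ennreal l)^4 * cell_integral a b l (\<lambda>x s. ennreal ((cmod (wave g m' (Suc (Suc 0)) x s))\<^sup>2)))"
    unfolding distrib_left mult.assoc[symmetric]
    by (intro add_mono mult_right_mono order_refl) auto
  also have "(ennreal l)\<^sup>2 * cell_integral a b l (\<lambda>x s. ennreal ((cmod (wave g m (Suc 0) x s))\<^sup>2)) +
     (ennreal l)\<^sup>2 * cell_integral a b l (\<lambda>x s. ennreal ((cmod (wave g m' (Suc 0) x s))\<^sup>2)) +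
     (ennreal l)^4 * cell_integral a b l (\<lambda>x s. ennreal ((cmod (wave g m' (Suc (Suc 0)) x s))\<^sup>2)) =
     cell_integral a b l (\<lambda>x s. (ennreal l)\<^sup>2 * ennreal ((cmod (wave g m (Suc 0) x s))\<^sup>2) +
     (ennreal l)\<^sup>2 * ennreal ((cmod (wave g m' (Suc 0) x s))\<^sup>2) + (ennreal l)^4 * ennreal ((cmod (wave g m' (Suc (Suc 0)) x s))\<^sup>2))"
    by (subst cell_integral_add, measurable, subst cell_integral_add, measurable) (simp add: cell_integral_cmult)
  also have "\<dots> \<le> cell_integral a b l (\<lambda>x s. ennreal (h\<^sup>2) * oscillation_power g x s)"
  proof (rule cell_integral_mono)
    fix x s assume s: "s \<in> {b..<b+l}"
    have ls: "l \<le> h * s" using s h by (simp add: l_def)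
    have l2: "l\<^sup>2 \<le> h\<^sup>2 * s\<^sup>2" using power_mono[OF ls, of 2] l by (simp add: power_mult_distrib)
    have "l ^ 4 \<le> h ^ 4 * s ^ 4" using power_mono[OF ls, of 4] l by (simp add: power_mult_distrib)
    also have "\<dots> \<le> h\<^sup>2 * s ^ 4" using h by (intro mult_right_mono power_decreasing) auto
    finally have l4: "l ^ 4 \<le> h\<^sup>2 * s ^ 4" .
    have E2: "(ennreal l)\<^sup>2 * ennreal (c\<^sup>2) \<le> ennreal (h\<^sup>2) * ennreal (s\<^sup>2 * c\<^sup>2)" for c
      using l l2 by (simp add: ennreal_power ennreal_mult[symmetric] mult.assoc[symmetric] mult_right_mono)
    have E4: "(ennreal l)^4 * ennreal (c\<^sup>2) \<le> ennreal (h\<^sup>2) * ennreal (s^4 * c\<^sup>2)" for c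
      using l l4 by (simp add: ennreal_power ennreal_mult[symmetric] mult.assoc[symmetric] mult_right_mono zero_le_even_power)
    show "(ennreal l)\<^sup>2 * ennreal ((cmod (wave g m (Suc 0) x s))\<^sup>2) +
     (ennreal l)\<^sup>2 * ennreal ((cmod (wave g m' (Suc 0) x s))\<^sup>2) + (ennreal l)^4 * ennreal ((cmod (wave g m' (Suc (Suc 0)) x s))\<^sup>2) \<le>
      ennreal (h\<^sup>2) * oscillation_power g x s"
      unfolding oscillation_power_def distrib_left by (intro add_mono E2 E4)
  qed
  also have "cell_integral a b l (\<lambda>x s. ennreal (h\<^sup>2) * oscillation_power g x s) = ennreal (h\<^sup>2) * J"
    unfolding J_def by (rule cell_integral_cmult) (unfold oscillation_power_def, measurable)
  finally have D: "D \<le> 4 * (ennreal (h\<^sup>2) * J)" by (simp add: mult_left_mono)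
  define P where "P = cell_integral a b l (wave_power g)"
  define c where "c = (cmod (wave g m 0 x0 s0))\<^sup>2"
  have c: "c \<ge> 0" by (simp add: c_def)
  have up: "ennreal c * ennreal l * ennreal l \<le> 2 * P + 2 * D"
    and low: "P \<le> 2 * (ennreal c * ennreal l * ennreal l) + 2 * D"
    unfolding c_def P_def D_def wave_power_def using cell_integral_const_bounds[OF l meas(1)] by auto
  have sb: "s0 \<le> 2 * b" "b \<le> s0" using s0 lb by auto
  have "s0\<^sup>2 \<le> (2 * b)\<^sup>2" using sb b by (intro power_mono) auto
  also have "\<dots> = 4 / h\<^sup>2 * (l * l)" using h by (simp add: l_def power2_eq_square)
  finally have "s0\<^sup>2 * c \<le> 4 / h\<^sup>2 * (l * l) * c" using c by (rule mult_right_mono)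
  then have "ennreal (s0\<^sup>2 * c) \<le> ennreal (4 / h\<^sup>2) * (ennreal c * ennreal l * ennreal l)"
    using l c by (simp add: ennreal_mult[symmetric] ac_simps)
  also have "\<dots> \<le> ennreal (4 / h\<^sup>2) * (2 * P + 2 * (4 * (ennreal (h\<^sup>2) * J)))"
    by (intro mult_left_mono order_trans[OF up] add_left_mono D) auto
  also have "\<dots> = ennreal (4 / h\<^sup>2) * ennreal 2 * P + ennreal (4 / h\<^sup>2) * ennreal 8 * ennreal (h\<^sup>2) * J"
    by (simp add: distrib_left ac_simps)
  also have "\<dots> = ennreal (8 / h\<^sup>2) * P + 32 * J"
  proof -
    have "ennreal (4 / h\<^sup>2) * ennreal 2 = ennreal (4 / h\<^sup>2 * 2)" by (rule ennreal_mult[symmetric]) auto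
    moreover have "ennreal (4 / h\<^sup>2) * ennreal 8 * ennreal (h\<^sup>2) = ennreal (4 / h\<^sup>2 * 8 * h\<^sup>2)"
      by (simp only: ennreal_mult[symmetric] divide_nonneg_nonneg mult_nonneg_nonneg zero_le_power2 zero_le_numeral)
    moreover have "4 / h\<^sup>2 * 8 * h\<^sup>2 = 32" using h by simp
    ultimately show ?thesis by (simp only: ennreal_numeral) simp
  qed
  finally show "ennreal (s0\<^sup>2 * (cmod (wave g m 0 x0 s0))\<^sup>2) \<le> ennreal (8 / h\<^sup>2) * grid_integral h q (wave_power g) + 32 * grid_integral h q (oscillation_power g)"
    unfolding gi c_def P_def J_def .
  have "l * l \<le> h\<^sup>2 * s0\<^sup>2"
    using mult_mono[OF sb(2) sb(2)] b h sb by (simp add: l_def power2_eq_square mult_left_mono)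
  then have "c * (l * l) \<le> c * (h\<^sup>2 * s0\<^sup>2)" using c by (rule mult_left_mono)
  then have "ennreal c * ennreal l * ennreal l \<le> ennreal (h\<^sup>2) * ennreal (s0\<^sup>2 * c)"
    using l c by (simp add: ennreal_mult[symmetric] ac_simps)
  then have "P \<le> 2 * (ennreal (h\<^sup>2) * ennreal (s0\<^sup>2 * c)) + 2 * (4 * (ennreal (h\<^sup>2) * J))"
    by (intro order_trans[OF low] add_mono mult_left_mono D) auto
  also have "\<dots> = ennreal 2 * ennreal (h\<^sup>2) * ennreal (s0\<^sup>2 * c) + ennreal 8 * ennreal (h\<^sup>2) * J"
    by (simp add: ac_simps)
  also have "\<dots> = ennreal (2 * h\<^sup>2) * ennreal (s0\<^sup>2 * c) + ennreal (8 * h\<^sup>2) * J"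
    by (simp only: ennreal_mult[symmetric] zero_le_power2 zero_le_numeral)
  finally show "grid_integral h q (wave_power g) \<le> ennreal (2 * h\<^sup>2) * ennreal (s0\<^sup>2 * (cmod (wave g m 0 x0 s0))\<^sup>2) + ennreal (8 * h\<^sup>2) * grid_integral h q (oscillation_power g)"
    unfolding gi c_def P_def J_def .
qed

definition sample_power :: "(real \<Rightarrow> complex) \<Rightarrow> complex \<Rightarrow> real" where
  "sample_power g z = (Im z)\<^sup>2 * (cmod (wave g m 0 (Re z) (Im z)))\<^sup>2"

lemma sample_power_nonneg: "sample_power g z \<ge> 0" by (simp add: sample_power_def)

text \<open>Points in distinct cells can be charged to disjoint parts of the energy.\<close>

lemma sampling_upper_bound:
  assumes g: "g \<in> L2" and h: "0 < h" "h \<le> 1"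
    and A: "finite A" "A \<subseteq> upper_half_plane"
    and sep: "\<And>z w q. z \<in> A \<Longrightarrow> w \<in> A \<Longrightarrow> (Re z, Im z) \<in> grid_cell h q \<Longrightarrow> (Re w, Im w) \<in> grid_cell h q \<Longrightarrow> z = w"
  defines "N \<equiv> (\<integral>\<^sup>+w. (if w > 0 then ennreal ((cmod (g w))\<^sup>2) else 0) \<partial>lborel)"
  shows "ennreal (\<Sum>z\<in>A. sample_power g z) \<le> ennreal (8 / h\<^sup>2) * (ennreal (2 * pi * admissibility m 0) * N) + 32 * (ennreal (2 * pi * oscillation_constant) * N)"
proof -
  define U where "U = (\<lambda>q. ennreal (8 / h\<^sup>2) * grid_integral h q (wave_power g) + 32 * grid_integral h q (oscillation_power g))"
  define Q where "Q = (\<lambda>z. (\<lfloor>log (1 + h) (Im z)\<rfloor>, \<lfloor>Re z / (h * grid_height h \<lfloor>log (1 + h) (Im z)\<rfloor>)\<rfloor>))"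
  have Q: "(Re z, Im z) \<in> grid_cell h (Q z)" if "z \<in> A" for z
    unfolding grid_cell_iff[OF h(1)] Q_def using that A by (auto simp: upper_half_plane_def)
  have inj: "inj_on Q A"
    by (rule inj_onI) (metis Q sep)
  have "ennreal (\<Sum>z\<in>A. sample_power g z) = (\<Sum>z\<in>A. ennreal (sample_power g z))"
    by (rule sum_ennreal[symmetric]) (rule sample_power_nonneg)
  also have "\<dots> \<le> (\<Sum>z\<in>A. U (Q z))"
    unfolding U_def sample_power_def by (intro sum_mono sample_versus_cell(1) g h Q)
  also have "\<dots> = sum U (Q ` A)" using inj by (simp add: sum.reindex)
  also have "\<dots> \<le> (\<integral>\<^sup>+q. U q \<partial>count_space UNIV)" by (rule sum_le_nn_integral_count_space) (use A in simp)
  also have "\<dots> = ennreal (8 / h\<^sup>2) * (\<integral>\<^sup>+q. grid_integral h q (wave_power g) \<partial>count_space UNIV) + 32 * (\<integral>\<^sup>+q. grid_integral h q (oscillation_power g) \<partial>count_space UNIV)"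
    unfolding U_def by (subst nn_integral_add) (auto simp: nn_integral_cmult)
  finally show ?thesis unfolding wave_power_energy[OF g h(1)] oscillation_power_energy[OF g h(1)] N_def .
qed

text \<open>One sample per cell determines the energy up to the oscillation.\<close>

lemma sampling_lower_bound:
  assumes g: "g \<in> L2" and h: "0 < h" "h \<le> 1"
    and z: "\<And>q. (Re (z q), Im (z q)) \<in> grid_cell h q" and B: "\<And>S. finite S \<Longrightarrow> (\<Sum>w\<in>z ` S. sample_power g w) \<le> B"
  defines "N \<equiv> (\<integral>\<^sup>+w. (if w > 0 then ennreal ((cmod (g w))\<^sup>2) else 0) \<partial>lborel)"
  shows "ennreal (2 * pi * admissibility m 0) * N \<le> ennreal (2 * h\<^sup>2) * ennreal B + ennreal (8 * h\<^sup>2) * (ennreal (2 * pi * oscillation_constant) * N)"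
proof -
  have inj: "inj z"
  proof (rule injI)
    fix p q assume "z p = z q"
    then show "p = q" using z[of p] z[of q] unfolding grid_cell_iff[OF h(1)] by auto
  qed
  have "ennreal (2 * pi * admissibility m 0) * N = (\<integral>\<^sup>+q. grid_integral h q (wave_power g) \<partial>count_space UNIV)"
    unfolding wave_power_energy[OF g h(1)] N_def ..
  also have "\<dots> \<le> (\<integral>\<^sup>+q. ennreal (2 * h\<^sup>2) * ennreal (sample_power g (z q)) + ennreal (8 * h\<^sup>2) * grid_integral h q (oscillation_power g) \<partial>count_space UNIV)"
    unfolding sample_power_def by (intro nn_integral_mono sample_versus_cell(2) g h z)
  also have "\<dots> = ennreal (2 * h\<^sup>2) * (\<integral>\<^sup>+q. ennreal (sample_power g (z q)) \<partial>count_space UNIV) + ennreal (8 * h\<^sup>2) * (\<integral>\<^sup>+q. grid_integral h q (oscillation_power g) \<partial>count_space UNIV)"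
    by (subst nn_integral_add) (auto simp: nn_integral_cmult)
  also have "(\<integral>\<^sup>+q. ennreal (sample_power g (z q)) \<partial>count_space UNIV) \<le> ennreal B"
  proof (rule nn_integral_count_space_le)
    show "infinite (UNIV :: (int \<times> int) set)" by (simp add: finite_prod infinite_UNIV_int)
    fix S :: "(int \<times> int) set" assume S: "finite S"
    have "(\<Sum>q\<in>S. ennreal (sample_power g (z q))) = ennreal (\<Sum>q\<in>S. sample_power g (z q))"
      by (rule sum_ennreal) (rule sample_power_nonneg)
    also have "(\<Sum>q\<in>S. sample_power g (z q)) = (\<Sum>w\<in>z ` S. sample_power g w)"
      using inj by (subst sum.reindex) (auto intro: inj_on_subset)
    finally show "(\<Sum>q\<in>S. ennreal (sample_power g (z q))) \<le> ennreal B" using B[OF S] by (simp add: ennreal_leI)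
  qed simp
  finally show ?thesis unfolding oscillation_power_energy[OF g h(1)] N_def
    by (simp add: add_right_mono mult_left_mono)
qed

end

section \<open>Hyperbolic distance and grid cells\<close>

lemma cmod_diff_cnj_gt:
  assumes "Im z > 0" "Im w > 0"
  shows "cmod (z - w) < cmod (z - cnj w)"
proof -
  have "0 < 4 * (Im z * Im w)" using assms by simp
  then have "(cmod (z - w))\<^sup>2 < (cmod (z - cnj w))\<^sup>2"
    unfolding cmod_power2 by (simp add: power2_eq_square algebra_simps)
  then show ?thesis by (rule power_less_imp_less_base) simp
qed

lemma hyp_dist_less_imp:
  assumes z: "Im z > 0" and w: "Im w > 0" and r: "0 < r" "r < 1"
    and d: "hyp_dist z w < 1/2 * ln ((1 + r) / (1 - r))"
  shows "cmod (z - w) < r * cmod (z - cnj w)"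
proof -
  define p where "p = pseudohyp_dist z w"
  have pos: "cmod (z - cnj w) > 0" using cmod_diff_cnj_gt[OF z w] norm_ge_zero[of "z - w"] by linarith
  have p: "p = cmod (z - w) / cmod (z - cnj w)" by (simp add: p_def pseudohyp_dist_def norm_divide)
  have p1: "0 \<le> p" "p < 1" using cmod_diff_cnj_gt[OF z w] pos by (auto simp: p)
  have "ln ((1 + p) / (1 - p)) < ln ((1 + r) / (1 - r))" using d by (simp add: hyp_dist_def p_def)
  then have "(1 + p) / (1 - p) < (1 + r) / (1 - r)" using p1 r by (subst (asm) ln_less_cancel_iff) auto
  then have "(1 + p) * (1 - r) < (1 + r) * (1 - p)" using p1 r by (simp add: divide_less_eq less_divide_eq split: if_splits)
  then have "p < r" by (simp add: algebra_simps)
  then show ?thesis unfolding p using pos by (simp add: divide_less_eq)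
qed

text \<open>A pseudohyperbolic distance below \<open>h / 16\<close> from the centre of a cell keeps a point within Euclidean
distance \<open>l / 2\<close>, since the centre has height at most \<open>2 * b\<close>.\<close>

lemma hyp_ball_subset_grid_cell:
  assumes h: "0 < h" "h \<le> 1"
  obtains z where "z \<in> upper_half_plane"
    "\<And>w. w \<in> hyp_ball z (1/2 * ln ((1 + h / 16) / (1 - h / 16))) \<Longrightarrow> (Re w, Im w) \<in> grid_cell h q"
proof -
  define b l a where "b = grid_height h (fst q)" and "l = h * b" and "a = real_of_int (snd q) * l"
  have b: "b > 0" and l: "l > 0" using h by (auto simp: b_def l_def grid_height_pos)
  have lb: "l \<le> b" using h b by (simp add: l_def)
  define z where "z = Complex (a + l / 2) (b + l / 2)"
  show thesis
  proof (rule that)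
    show "z \<in> upper_half_plane" using b l by (simp add: z_def upper_half_plane_def)
    fix w assume "w \<in> hyp_ball z (1/2 * ln ((1 + h / 16) / (1 - h / 16)))"
    then have w: "Im w > 0" and d: "hyp_dist z w < 1/2 * ln ((1 + h / 16) / (1 - h / 16))"
      by (auto simp: hyp_ball_def upper_half_plane_def)
    have Imz: "Im z > 0" "Im z \<le> 2 * b" using b l lb by (auto simp: z_def)
    have "cmod (z - w) < h / 16 * cmod (z - cnj w)"
      by (rule hyp_dist_less_imp[OF Imz(1) w _ _ d]) (use h in auto)
    also have "h / 16 * cmod (z - cnj w) \<le> h / 16 * (cmod (z - w) + 4 * b)"
    proof (rule mult_left_mono)
      have "cnj (z - w) + (z - cnj z) = z - cnj w" by simp
      then have "cmod (z - cnj w) \<le> cmod (cnj (z - w)) + cmod (z - cnj z)"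
        using norm_triangle_ineq[of "cnj (z - w)" "z - cnj z"] by (simp only:)
      moreover have "cmod (cnj (z - w)) = cmod (z - w)" by (rule complex_mod_cnj)
      moreover have "cmod (z - cnj z) = 2 * Im z" using Imz(1) by (simp add: complex_diff_cnj norm_mult)
      ultimately show "cmod (z - cnj w) \<le> cmod (z - w) + 4 * b" using Imz(2) by linarith
    qed (use h in simp)
    also have "\<dots> = h / 16 * cmod (z - w) + l / 4" by (simp add: l_def distrib_left)
    finally have "cmod (z - w) < h / 16 * cmod (z - w) + l / 4" .
    moreover have "h / 16 * cmod (z - w) \<le> 1 / 16 * cmod (z - w)" using h by (intro mult_right_mono) auto
    ultimately have zw: "cmod (z - w) < l / 2" using l by linarith
    have "\<bar>Re z - Re w\<bar> < l / 2" "\<bar>Im z - Im w\<bar> < l / 2"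
      using abs_Re_le_cmod[of "z - w"] abs_Im_le_cmod[of "z - w"] zw by auto
    moreover have "Re z = a + l / 2" "Im z = b + l / 2" by (simp_all add: z_def)
    ultimately have "a \<le> Re w" "Re w < a + l" "b \<le> Im w" "Im w < b + l" by linarith+
    then show "(Re w, Im w) \<in> grid_cell h q"
      unfolding grid_cell_def Let_def b_def[symmetric] l_def[symmetric] a_def[symmetric] by simp
  qed
qed

text \<open>Two points of a cell are at most \<open>2 * h * b\<close> apart, while the complex conjugate of one is at distance
at least \<open>2 * b\<close> from the other. This makes the pseudohyperbolic distance at most \<open>h\<close>.\<close>

lemma hyp_dist_grid_cell_le:
  assumes h: "0 < h" "h \<le> 1/2" and z: "(Re z, Im z) \<in> grid_cell h q" and w: "(Re w, Im w) \<in> grid_cell h q"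
  shows "hyp_dist z w \<le> 2 * h"
proof -
  define b l a where "b = grid_height h (fst q)" and "l = h * b" and "a = real_of_int (snd q) * l"
  have b: "b > 0" and l: "l > 0" using h by (auto simp: b_def l_def grid_height_pos)
  have zw: "Re z \<in> {a..<a+l}" "Im z \<in> {b..<b+l}" "Re w \<in> {a..<a+l}" "Im w \<in> {b..<b+l}"
    using z w unfolding grid_cell_def Let_def a_def b_def l_def by auto
  have "\<bar>Re (z - w)\<bar> \<le> l" "\<bar>Im (z - w)\<bar> \<le> l"
    using zw by (simp_all add: abs_le_iff)
  then have n: "cmod (z - w) \<le> 2 * l" using cmod_le[of "z - w"] by linarith
  have "Im (z - cnj w) = Im z + Im w" by simp
  then have d: "2 * b \<le> cmod (z - cnj w)"
    using abs_Im_le_cmod[of "z - cnj w"] zw(2,4) by (simp only: atLeastLessThan_iff) linarith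
  define p where "p = pseudohyp_dist z w"
  have p_eq: "p = cmod (z - w) / cmod (z - cnj w)" unfolding p_def pseudohyp_dist_def by (rule norm_divide)
  have "p \<le> (2 * l) / (2 * b)" unfolding p_eq by (rule frac_le) (use n d b l in linarith)+
  also have "(2 * l) / (2 * b) = h" using b by (simp add: l_def)
  finally have p: "p \<le> h" .
  have p0: "0 \<le> p" unfolding p_eq by (intro divide_nonneg_nonneg norm_ge_zero)
  have p1: "1 - p > 0" "1 - p \<ge> 1 / 2" using p h(2) by linarith+
  have "(1 + p) / (1 - p) = ((1 - p) + 2 * p) / (1 - p)" by (rule arg_cong2[where f="(/)"]) linarith+
  also have "\<dots> = 1 + 2 * p / (1 - p)" unfolding add_divide_distrib using p1(1) by simp
  finally have q: "(1 + p) / (1 - p) - 1 = 2 * p / (1 - p)" by linarith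
  have "ln ((1 + p) / (1 - p)) \<le> (1 + p) / (1 - p) - 1"
    by (rule ln_le_minus_one) (use p0 p1 in \<open>intro divide_pos_pos; linarith\<close>)
  also have "\<dots> \<le> 2 * h / (1 / 2)" unfolding q by (rule frac_le) (use p p0 p1 h in linarith)+
  finally show ?thesis unfolding hyp_dist_def p_def[symmetric] by simp
qed

lemma hyp_uniformly_discrete_separated:
  assumes "hyp_uniformly_discrete \<Gamma>"
  obtains c where "c > 0" "\<And>z w. z \<in> \<Gamma> \<Longrightarrow> w \<in> \<Gamma> \<Longrightarrow> z \<noteq> w \<Longrightarrow> c < hyp_dist z w"
proof -
  obtain c where c: "0 < ereal c" "ereal c < (INF (z, w) \<in> {(z, w). z \<in> \<Gamma> \<and> w \<in> \<Gamma> \<and> z \<noteq> w}. ereal (hyp_dist z w))"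
    using ereal_dense2[OF assms[unfolded hyp_uniformly_discrete_def]] by auto
  show thesis
  proof (rule that)
    show "c > 0" using c(1) by simp
    fix z w assume "z \<in> \<Gamma>" "w \<in> \<Gamma>" "z \<noteq> w"
    then have "(INF (z, w) \<in> {(z, w). z \<in> \<Gamma> \<and> w \<in> \<Gamma> \<and> z \<noteq> w}. ereal (hyp_dist z w)) \<le> ereal (hyp_dist z w)"
      by (intro INF_lower2[of "(z, w)"]) auto
    with c(2) have "ereal c < ereal (hyp_dist z w)" by (rule less_le_trans)
    then show "c < hyp_dist z w" by simp
  qed
qed

section \<open>The frame property\<close>

text \<open>As the transform vanishes on the negative half line, the energy on the positive frequencies is all of it.\<close>

lemma Hardy2_spectrum:
  assumes "f \<in> Hardy2"
  obtains g where "has_L2_fourier f g"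
    "(\<integral>\<^sup>+w. (if w > 0 then ennreal ((cmod (g w))\<^sup>2) else 0) \<partial>lborel) = ennreal (2 * pi * (L2_norm f)\<^sup>2)"
proof -
  obtain g where fg: "has_L2_fourier f g" and ae: "AE w in lborel. w < 0 \<longrightarrow> g w = 0"
    using assms by (auto simp: Hardy2_def)
  have g: "g \<in> L2" using fg by (simp add: has_L2_fourier_def)
  have "AE w in lborel. w \<noteq> (0::real)" by (rule AE_lborel_singleton)
  with ae have "AE w in lborel. (if w > 0 then ennreal ((cmod (g w))\<^sup>2) else 0) = ennreal ((cmod (g w))\<^sup>2)"
    by eventually_elim auto
  then have "(\<integral>\<^sup>+w. (if w > 0 then ennreal ((cmod (g w))\<^sup>2) else 0) \<partial>lborel) = (\<integral>\<^sup>+w. ennreal ((cmod (g w))\<^sup>2) \<partial>lborel)"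
    by (rule nn_integral_cong_AE)
  also have "\<dots> = ennreal (LINT w|lborel. (cmod (g w))\<^sup>2)"
    by (rule nn_integral_eq_integral) (use L2_D(2)[OF g] in auto)
  also have "(LINT w|lborel. (cmod (g w))\<^sup>2) = 2 * pi * (L2_norm f)\<^sup>2"
    unfolding Plancherel[OF fg] L2_norm_def by simp
  finally show thesis using that fg by blast
qed

lemma smooth_profile_poly_exp: "smooth_profile (poly_exp p) (poly_exp (pderiv p - p))"
  by unfold_locales (rule decaying_poly_exp poly_exp_derivative continuous_on_poly_exp)+

lemma ennreal_two_products:
  assumes "0 \<le> a" "0 \<le> b" "0 \<le> c" "0 \<le> a'" "0 \<le> b'"
  shows "ennreal a * (ennreal b * ennreal c) + ennreal a' * (ennreal b' * ennreal c) = ennreal (a * (b * c) + a' * (b' * c))"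
  using assms by (simp add: ennreal_mult)

lemma ennreal_mixed_products:
  assumes "0 \<le> a" "0 \<le> b" "0 \<le> c" "0 \<le> a'" "0 \<le> b'"
  shows "ennreal a * ennreal b + ennreal a' * (ennreal b' * ennreal c) = ennreal (a * b + a' * (b' * c))"
  using assms by (simp add: ennreal_mult)

theorem theorem5:
  fixes n :: nat
  shows "\<exists>\<delta>::real. \<delta> > 0 \<and>
    (\<forall>\<Gamma> \<subseteq> upper_half_plane.
       hyp_uniformly_discrete \<Gamma> \<and>
       (\<forall>z \<in> upper_half_plane. hyp_ball z \<delta> \<inter> \<Gamma> \<noteq> {}) \<longrightarrow>
       wavelet_frame (Phi n) \<Gamma>)"
proof -
  define p where "p = wavelet_poly n"
  define m where "m = poly_exp p"
  define m' where "m' = poly_exp (pderiv p - p)"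
  interpret smooth_profile m m' unfolding m_def m'_def by (rule smooth_profile_poly_exp)
  define \<kappa>0 where "\<kappa>0 = admissibility m 0"
  define \<kappa> where "\<kappa> = oscillation_constant"
  have \<kappa>0: "\<kappa>0 > 0" unfolding \<kappa>0_def m_def p_def by (intro admissibility_poly_exp_pos wavelet_poly_nonzero)
  have \<kappa>: "\<kappa> \<ge> 0" by (simp add: \<kappa>_def oscillation_constant_def admissibility_nonneg)
  (* this choice gives \<open>8 * h\<^sup>2 * \<kappa> \<le> \<kappa>0 / 2\<close>: the oscillation is at most half of the energy *)
  define h where "h = min 1 (\<kappa>0 / (16 * (\<kappa> + \<kappa>0)))"
  have h: "0 < h" "h \<le> 1" using \<kappa>0 \<kappa> by (auto simp: h_def add_nonneg_pos)
  have "16 * h\<^sup>2 * \<kappa> \<le> 16 * h * (\<kappa> + \<kappa>0)"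
    using h \<kappa> \<kappa>0 by (intro mult_mono) (auto simp: power2_eq_square mult_left_le)
  also have "\<dots> \<le> 16 * (\<kappa>0 / (16 * (\<kappa> + \<kappa>0))) * (\<kappa> + \<kappa>0)"
    using \<kappa> \<kappa>0 by (intro mult_right_mono mult_left_mono) (auto simp: h_def)
  also have "\<dots> = \<kappa>0"
  proof -
    have "16 * (\<kappa>0 / (16 * K)) * K = \<kappa>0" if "K > 0" for K :: real using that by simp
    then show ?thesis using \<kappa> \<kappa>0 by (simp only: add_nonneg_pos)
  qed
  finally have h\<kappa>: "16 * h\<^sup>2 * \<kappa> \<le> \<kappa>0" .
  (* the hyperbolic distance that corresponds to the pseudohyperbolic distance \<open>h / 16\<close> *)
  define \<delta> where "\<delta> = 1/2 * ln ((1 + h / 16) / (1 - h / 16))"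
  have "wavelet_frame (Phi n) \<Gamma>"
    if \<Gamma>: "\<Gamma> \<subseteq> upper_half_plane" and disc: "hyp_uniformly_discrete \<Gamma>"
      and dense: "\<forall>z \<in> upper_half_plane. hyp_ball z \<delta> \<inter> \<Gamma> \<noteq> {}" for \<Gamma>
  proof -
    obtain c where c: "c > 0" "\<And>z w. z \<in> \<Gamma> \<Longrightarrow> w \<in> \<Gamma> \<Longrightarrow> z \<noteq> w \<Longrightarrow> c < hyp_dist z w"
      using hyp_uniformly_discrete_separated[OF disc] by blast
    (* a second mesh size: two points in a cell of this grid have hyperbolic distance at most \<open>2 * k \<le> c\<close> *)
    define k where "k = min (1/2) (c / 2)"
    have k: "0 < k" "k \<le> 1/2" "2 * k \<le> c" using c(1) by (auto simp: k_def)
    have sep: "z = w" if "z \<in> \<Gamma>" "w \<in> \<Gamma>" "(Re z, Im z) \<in> grid_cell k q" "(Re w, Im w) \<in> grid_cell k q" for z w q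
      using hyp_dist_grid_cell_le[OF k(1,2) that(3,4)] c(2)[OF that(1,2)] k(3) by fastforce
    have "\<exists>z. z \<in> \<Gamma> \<and> (Re z, Im z) \<in> grid_cell h q" for q
    proof -
      obtain z where "z \<in> upper_half_plane" "\<And>w. w \<in> hyp_ball z \<delta> \<Longrightarrow> (Re w, Im w) \<in> grid_cell h q"
        unfolding \<delta>_def using hyp_ball_subset_grid_cell[OF h] by blast
      then show ?thesis using dense by blast
    qed
    then obtain \<zeta> where \<zeta>: "\<And>q. \<zeta> q \<in> \<Gamma>" "\<And>q. (Re (\<zeta> q), Im (\<zeta> q)) \<in> grid_cell h q" by metis
    define A where "A = \<kappa>0 / (4 * h\<^sup>2)"
    define B where "B = 8 / k\<^sup>2 * \<kappa>0 + 32 * \<kappa>"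
    have A: "A > 0" using \<kappa>0 h by (simp add: A_def)
    have B: "B > 0" using \<kappa>0 \<kappa> k by (simp add: B_def add_pos_nonneg)
    have "(\<lambda>z. (cmod (L2_inner f (translation (Re z) (dilation (Im z) (Phi n)))))\<^sup>2) summable_on \<Gamma> \<and>
       A * (L2_norm f)\<^sup>2 \<le> (\<Sum>\<^sub>\<infinity>z\<in>\<Gamma>. (cmod (L2_inner f (translation (Re z) (dilation (Im z) (Phi n)))))\<^sup>2) \<and>
       (\<Sum>\<^sub>\<infinity>z\<in>\<Gamma>. (cmod (L2_inner f (translation (Re z) (dilation (Im z) (Phi n)))))\<^sup>2) \<le> B * (L2_norm f)\<^sup>2"
      if f: "f \<in> Hardy2" for f
    proof -
      obtain g where fg: "has_L2_fourier f g" and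
        N: "(\<integral>\<^sup>+w. (if w > 0 then ennreal ((cmod (g w))\<^sup>2) else 0) \<partial>lborel) = ennreal (2 * pi * (L2_norm f)\<^sup>2)"
        using Hardy2_spectrum[OF f] by blast
      have g: "g \<in> L2" using fg by (simp add: has_L2_fourier_def)
      define F where "F = (L2_norm f)\<^sup>2"
      have F: "F \<ge> 0" by (simp add: F_def)
      define C where "C = (\<lambda>z. (cmod (L2_inner f (translation (Re z) (dilation (Im z) (Phi n)))))\<^sup>2)"
      have CS: "sample_power g z = (2 * pi)\<^sup>2 * C z" if "z \<in> \<Gamma>" for z
      proof -
        have "Im z > 0" using that \<Gamma> by (auto simp: upper_half_plane_def)
        from wavelet_coefficient[OF fg this, of "Re z" n]
        have "C z = (Im z / (2 * pi))\<^sup>2 * (cmod (wave g m 0 (Re z) (Im z)))\<^sup>2"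
          unfolding C_def m_def p_def by (simp add: norm_mult power_mult_distrib norm_divide power_divide)
        then show ?thesis by (simp add: sample_power_def power_divide)
      qed
      have C0: "C z \<ge> 0" for z by (simp add: C_def)
      have sumC: "(\<Sum>z\<in>X. sample_power g z) = (2 * pi)\<^sup>2 * sum C X" if "X \<subseteq> \<Gamma>" for X
        unfolding sum_distrib_left using that CS by (intro sum.cong) auto
      have upper: "sum C X \<le> B * F" if X: "finite X" "X \<subseteq> \<Gamma>" for X
      proof -
        have "ennreal (\<Sum>z\<in>X. sample_power g z) \<le> ennreal (8 / k\<^sup>2) * (ennreal (2 * pi * \<kappa>0) * ennreal (2 * pi * F)) + ennreal 32 * (ennreal (2 * pi * \<kappa>) * ennreal (2 * pi * F))"
          unfolding \<kappa>0_def \<kappa>_def F_def N[symmetric] ennreal_numeral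
        proof (rule sampling_upper_bound[OF g k(1) _ X(1)])
          show "k \<le> 1" using k(2) by simp
          show "X \<subseteq> upper_half_plane" using X \<Gamma> by blast
          show "z = w" if "z \<in> X" "w \<in> X" "(Re z, Im z) \<in> grid_cell k q" "(Re w, Im w) \<in> grid_cell k q" for z w q
            using that X sep by blast
        qed
        also have "\<dots> = ennreal (8 / k\<^sup>2 * (2 * pi * \<kappa>0 * (2 * pi * F)) + 32 * (2 * pi * \<kappa> * (2 * pi * F)))"
          by (rule ennreal_two_products) (use \<kappa>0 \<kappa> F in simp_all)
        also have "8 / k\<^sup>2 * (2 * pi * \<kappa>0 * (2 * pi * F)) + 32 * (2 * pi * \<kappa> * (2 * pi * F)) = (2 * pi)\<^sup>2 * (B * F)"
          by (simp add: B_def power2_eq_square algebra_simps)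
        finally have "(2 * pi)\<^sup>2 * sum C X \<le> (2 * pi)\<^sup>2 * (B * F)"
          unfolding sumC[OF X(2)] using B F by (subst (asm) ennreal_le_iff) auto
        then show ?thesis by (rule mult_left_le_imp_le) simp
      qed
      have summ: "C summable_on \<Gamma>"
        by (rule nonneg_bdd_above_summable_on) (use C0 upper in \<open>auto intro!: bdd_aboveI\<close>)
      define S where "S = (\<Sum>\<^sub>\<infinity>z\<in>\<Gamma>. C z)"
      have S0: "S \<ge> 0" unfolding S_def by (intro infsum_nonneg C0)
      have SB: "S \<le> B * F" unfolding S_def by (rule infsum_le_finite_sums[OF summ upper])
      have "(\<Sum>w\<in>\<zeta> ` X. sample_power g w) \<le> (2 * pi)\<^sup>2 * S" if "finite X" for X
      proof -
        have sub: "\<zeta> ` X \<subseteq> \<Gamma>" using \<zeta>(1) by auto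
        have "sum C (\<zeta> ` X) \<le> S" unfolding S_def
          by (rule finite_sum_le_infsum[OF summ _ sub]) (use that C0 in auto)
        then show ?thesis unfolding sumC[OF sub] by (rule mult_left_mono) simp
      qed
      from sampling_lower_bound[OF g h \<zeta>(2) this, unfolded N]
      have "ennreal (2 * pi * \<kappa>0) * ennreal (2 * pi * F) \<le> ennreal (2 * h\<^sup>2) * ennreal ((2 * pi)\<^sup>2 * S) + ennreal (8 * h\<^sup>2) * (ennreal (2 * pi * \<kappa>) * ennreal (2 * pi * F))"
        unfolding \<kappa>0_def \<kappa>_def F_def by simp
      also have "\<dots> = ennreal (2 * h\<^sup>2 * ((2 * pi)\<^sup>2 * S) + 8 * h\<^sup>2 * (2 * pi * \<kappa> * (2 * pi * F)))"
        by (rule ennreal_mixed_products) (use \<kappa> F S0 in simp_all)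
      also have "ennreal (2 * pi * \<kappa>0) * ennreal (2 * pi * F) = ennreal (2 * pi * \<kappa>0 * (2 * pi * F))"
        by (rule ennreal_mult[symmetric]) (use \<kappa>0 F in simp_all)
      finally have "2 * pi * \<kappa>0 * (2 * pi * F) \<le> 2 * h\<^sup>2 * ((2 * pi)\<^sup>2 * S) + 8 * h\<^sup>2 * (2 * pi * \<kappa> * (2 * pi * F))"
        by (subst (asm) ennreal_le_iff) (use \<kappa> F S0 in simp_all)
      then have "(2 * pi)\<^sup>2 * (\<kappa>0 * F) \<le> (2 * pi)\<^sup>2 * (2 * h\<^sup>2 * S + 8 * h\<^sup>2 * \<kappa> * F)"
        by (simp add: power2_eq_square algebra_simps)
      then have "\<kappa>0 * F \<le> 2 * h\<^sup>2 * S + 8 * h\<^sup>2 * \<kappa> * F" by (rule mult_left_le_imp_le) simp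
      moreover have "16 * h\<^sup>2 * \<kappa> * F \<le> \<kappa>0 * F" by (rule mult_right_mono[OF h\<kappa> F])
      ultimately have "\<kappa>0 * F \<le> 4 * h\<^sup>2 * S" by linarith
      then have "A * F \<le> S" using h by (simp add: A_def field_simps)
      then show ?thesis using summ SB unfolding S_def F_def C_def by blast
    qed
    then show ?thesis unfolding wavelet_frame_def Let_def using A B by blast
  qed
  moreover have "\<delta> > 0" unfolding \<delta>_def using h by simp
  ultimately show ?thesis by blast
qed

end
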